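(* Let $\mathcal{F}$ be a locally fiberwise homogeneous fibration of a connected open set $W\subseteq S^3$ by great circles. Assume that the distance-decreasing function $f:V\to S^2$ associated to $\mathcal{F}$ is of class $C^2$. Then $\mathcal{F}$ is a portion of a Hopf fibration, i.e. there is a Hopf fibration of $S^3$ such that every fiber of $\mathcal{F}$ is a fiber of that Hopf fibration.
   Context: $S^3\subset\mathbb{R}^4$ is the unit sphere with its round metric. A fibration of an open set $W$ by great circles is a fibration of $W$ all of whose fibers are great circles of $S^3$ (each entirely contained in $W$). A fibration $\mathcal{F}$ of $W$ is locally fiberwise homogeneous if for any two fibers there are open sets around them and an isometry taking the one open set onto the other, taking fibers of $\mathcal{F}$ to fibers of $\mathcal{F}$, and taking the first given fiber to the second. Associated function: an oriented great circle in $S^3$ is identified with the oriented 2-plane through the origin in $\mathbb{R}^4$ that it spans, i.e. with a point of the Grassmann manifold $G_2\mathbb{R}^4$ of oriented 2-planes in $\mathbb{R}^4$. $G_2\mathbb{R}^4$ is identified with $S^2\times S^2$ by sending the oriented plane with oriented orthonormal basis $(u,v)$ to the normalized self-dual and anti-self-dual components of $u\wedge v\in\Lambda^2\mathbb{R}^4=\Lambda^2_+\oplus\Lambda^2_-$, each of which lies in a round unit 2-sphere. By a theorem of Gluck and Warner, the fibers of a great circle fibration of a (connected) open set of $S^3$, consistently oriented, form a submanifold of $S^2\times S^2$ which is the graph of a distance-decreasing function $f:V\to S^2$ from an open set $V$ in one $S^2$ factor to the other $S^2$ factor; this $f$ is the distance-decreasing function associated to $\mathcal{F}$. A Hopf fibration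 of $S^3$ is any image under an isometry of $S^3$ of the fibration of $S^3\subset\mathbb{C}^2$ by its intersections with complex lines; equivalently, a great circle fibration whose associated function is constant on all of $S^2$. *)

theory Defs
  imports "HOL-Analysis.Analysis"
begin

section \<open>Round spheres and great circles\<close>

abbreviation S2 :: "(real ^ 3) set" where "S2 \<equiv> sphere 0 1"

abbreviation S3 :: "(real ^ 4) set" where "S3 \<equiv> sphere 0 1"

text \<open>The geodesic distance of the round metric, for points of a unit sphere.\<close>

definition sphere_dist :: "'a::real_inner \<Rightarrow> 'a \<Rightarrow> real" where
  "sphere_dist x y = arccos (x \<bullet> y)"

definition isometry_onto :: "(real ^ 4 \<Rightarrow> real ^ 4) \<Rightarrow> (real ^ 4) set \<Rightarrow> (real ^ 4) set \<Rightarrow> bool" where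
  "isometry_onto g A B \<longleftrightarrow>
     g ` A = B \<and> (\<forall>x\<in>A. \<forall>y\<in>A. sphere_dist (g x) (g y) = sphere_dist x y)"

definition great_circle :: "(real ^ 4) set \<Rightarrow> bool" where
  "great_circle C \<longleftrightarrow> (\<exists>P. subspace P \<and> dim P = 2 \<and> C = P \<inter> S3)"


section \<open>Fibrations by great circles\<close>

definition fiber_bundle ::
  "'a topology \<Rightarrow> 'b topology \<Rightarrow> 'c topology \<Rightarrow> ('a \<Rightarrow> 'b) \<Rightarrow> bool" where
  "fiber_bundle X B Y p \<longleftrightarrow>
     continuous_map X B p \<and> p ` topspace X = topspace B \<and>
     (\<forall>b\<in>topspace B. \<exists>U \<phi>. openin B U \<and> b \<in> U \<and>
        homeomorphic_map (subtopology X {x \<in> topspace X. p x \<in> U})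
          (prod_topology (subtopology B U) Y) \<phi> \<and>
        (\<forall>x\<in>topspace X. p x \<in> U \<longrightarrow> fst (\<phi> x) = p x))"

text \<open>A fibration is represented by the set of its fibers. The base space is an arbitrary
  topological space; since its points correspond to the fibers, letting its points be sets of
  points of \<open>\<real>\<^sup>4\<close> is no restriction.\<close>

definition great_circle_fibration :: "(real ^ 4) set \<Rightarrow> (real ^ 4) set set \<Rightarrow> bool" where
  "great_circle_fibration W F \<longleftrightarrow>
     openin (top_of_set S3) W \<and>
     (\<forall>C\<in>F. great_circle C) \<and>
     (\<exists>(B :: (real ^ 4) set topology) p.
        fiber_bundle (top_of_set W) B (top_of_set (sphere (0::complex) 1)) p \<and>
        F = (\<lambda>b. {x \<in> W. p x = b}) ` topspace B)"

text \<open>The open sets need not be unions of fibers; the fibers that an isometry has to respect are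
  those contained in its domain.\<close>

definition locally_fiberwise_homogeneous :: "(real ^ 4) set \<Rightarrow> (real ^ 4) set set \<Rightarrow> bool" where
  "locally_fiberwise_homogeneous W F \<longleftrightarrow>
     (\<forall>C\<in>F. \<forall>D\<in>F. \<exists>A B g.
        openin (top_of_set W) A \<and> openin (top_of_set W) B \<and> C \<subseteq> A \<and> D \<subseteq> B \<and>
        isometry_onto g A B \<and>
        (\<forall>E\<in>F. E \<subseteq> A \<longrightarrow> g ` E \<in> F) \<and>
        g ` C = D)"


section \<open>Hopf fibrations\<close>

text \<open>\<open>\<real>\<^sup>4\<close> is identified with \<open>\<complex>\<^sup>2\<close> by \<open>x \<mapsto> (x\<^sub>1 + i x\<^sub>2, x\<^sub>3 + i x\<^sub>4)\<close>.\<close>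

definition to_C2 :: "real ^ 4 \<Rightarrow> complex \<times> complex" where
  "to_C2 x = (Complex (x $ 1) (x $ 2), Complex (x $ 3) (x $ 4))"

definition complex_lines :: "(complex \<times> complex) set set" where
  "complex_lines = {{(c * a, c * b) | c. True} | a b. (a, b) \<noteq> (0, 0)}"

definition standard_Hopf_fibration :: "(real ^ 4) set set" where
  "standard_Hopf_fibration = {{x \<in> S3. to_C2 x \<in> L} | L. L \<in> complex_lines}"

definition Hopf_fibration :: "(real ^ 4) set set \<Rightarrow> bool" where
  "Hopf_fibration H \<longleftrightarrow>
     (\<exists>g. isometry_onto g S3 S3 \<and> H = (\<lambda>C. g ` C) ` standard_Hopf_fibration)"


section \<open>The associated function\<close>

text \<open>\<open>plucker u v i j\<close> is the coefficient of \<open>e\<^sub>i \<and> e\<^sub>j\<close> in \<open>u \<and> v\<close>. For orthonormal \<open>u\<close>, \<open>v\<close> the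
  self-dual and anti-self-dual components of \<open>u \<and> v\<close> both have norm \<open>1 / sqrt 2\<close>; \<open>self_dual\<close> and
  \<open>anti_self_dual\<close> give these components, multiplied by \<open>sqrt 2\<close>, in the orthonormal bases
  \<open>(e\<^sub>1 \<and> e\<^sub>2 \<plusminus> e\<^sub>3 \<and> e\<^sub>4) / sqrt 2\<close>, \<open>(e\<^sub>1 \<and> e\<^sub>3 \<mp> e\<^sub>2 \<and> e\<^sub>4) / sqrt 2\<close>, \<open>(e\<^sub>1 \<and> e\<^sub>4 \<plusminus> e\<^sub>2 \<and> e\<^sub>3) / sqrt 2\<close>
  of the self-dual (upper signs) and anti-self-dual (lower signs) 2-vectors. Both values depend
  only on the oriented plane spanned by \<open>(u, v)\<close>.\<close>

definition plucker :: "real ^ 4 \<Rightarrow> real ^ 4 \<Rightarrow> 4 \<Rightarrow> 4 \<Rightarrow> real" where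
  "plucker u v i j = u $ i * v $ j - u $ j * v $ i"

definition self_dual :: "real ^ 4 \<Rightarrow> real ^ 4 \<Rightarrow> real ^ 3" where
  "self_dual u v = vector
     [plucker u v 1 2 + plucker u v 3 4,
      plucker u v 1 3 - plucker u v 2 4,
      plucker u v 1 4 + plucker u v 2 3]"

definition anti_self_dual :: "real ^ 4 \<Rightarrow> real ^ 4 \<Rightarrow> real ^ 3" where
  "anti_self_dual u v = vector
     [plucker u v 1 2 - plucker u v 3 4,
      plucker u v 1 3 + plucker u v 2 4,
      plucker u v 1 4 - plucker u v 2 3]"

text \<open>A consistent orientation of the fibers is given by a continuous unit vector field tangent to
  them. The oriented plane of the fiber through \<open>x\<close> then has the oriented orthonormal basis
  \<open>(x, \<tau> x)\<close>.\<close>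

definition consistent_orientation ::
  "(real ^ 4) set \<Rightarrow> (real ^ 4) set set \<Rightarrow> (real ^ 4 \<Rightarrow> real ^ 4) \<Rightarrow> bool" where
  "consistent_orientation W F \<tau> \<longleftrightarrow>
     continuous_on W \<tau> \<and>
     (\<forall>C\<in>F. \<forall>x\<in>C. norm (\<tau> x) = 1 \<and> x \<bullet> \<tau> x = 0 \<and> \<tau> x \<in> span C)"

definition oriented_fibers ::
  "(real ^ 4) set \<Rightarrow> (real ^ 4 \<Rightarrow> real ^ 4) \<Rightarrow> ((real ^ 3) \<times> (real ^ 3)) set" where
  "oriented_fibers W \<tau> = {(self_dual x (\<tau> x), anti_self_dual x (\<tau> x)) | x. x \<in> W}"

definition distance_decreasing_on :: "(real ^ 3) set \<Rightarrow> (real ^ 3 \<Rightarrow> real ^ 3) \<Rightarrow> bool" where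
  "distance_decreasing_on V f \<longleftrightarrow>
     (\<forall>a\<in>V. \<forall>b\<in>V. a \<noteq> b \<longrightarrow> sphere_dist (f a) (f b) < sphere_dist a b)"

text \<open>The domain \<open>V\<close> may lie in either one of the two \<open>S\<^sup>2\<close> factors.\<close>

definition associated_function ::
  "(real ^ 4) set \<Rightarrow> (real ^ 4) set set \<Rightarrow> (real ^ 3) set \<Rightarrow> (real ^ 3 \<Rightarrow> real ^ 3) \<Rightarrow> bool" where
  "associated_function W F V f \<longleftrightarrow>
     openin (top_of_set S2) V \<and> f ` V \<subseteq> S2 \<and> distance_decreasing_on V f \<and>
     (\<exists>\<tau>. consistent_orientation W F \<tau> \<and>
        (oriented_fibers W \<tau> = {(a, f a) | a. a \<in> V} \<or>
         oriented_fibers W \<tau> = {(f a, a) | a. a \<in> V}))"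


section \<open>Functions of class \<open>C\<^sup>2\<close>\<close>

definition C2_on_open :: "'a::euclidean_space set \<Rightarrow> ('a \<Rightarrow> 'b::euclidean_space) \<Rightarrow> bool" where
  "C2_on_open U f \<longleftrightarrow> open U \<and>
     (\<exists>(f' :: 'a \<Rightarrow> 'a \<Rightarrow>\<^sub>L 'b) (f'' :: 'a \<Rightarrow> 'a \<Rightarrow>\<^sub>L 'a \<Rightarrow>\<^sub>L 'b).
        (\<forall>x\<in>U. (f has_derivative blinfun_apply (f' x)) (at x)) \<and>
        (\<forall>x\<in>U. (f' has_derivative blinfun_apply (f'' x)) (at x)) \<and>
        continuous_on U f'')"

text \<open>On a subset of a Euclidean space, such as an open subset of a sphere, a function is \<open>C\<^sup>2\<close> if
  it extends locally to a \<open>C\<^sup>2\<close> function on an open subset of the ambient space.\<close>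

definition C2_on :: "'a::euclidean_space set \<Rightarrow> ('a \<Rightarrow> 'b::euclidean_space) \<Rightarrow> bool" where
  "C2_on V f \<longleftrightarrow>
     (\<forall>x\<in>V. \<exists>U h. x \<in> U \<and> C2_on_open U h \<and> (\<forall>y\<in>U \<inter> V. h y = f y))"

end

theory Submission
  imports Defs
begin

text \<open>By local fiberwise homogeneity, any two points of \<open>V\<close> are related by orthogonal maps \<open>A\<close>, \<open>B\<close> of
  three-space with \<open>f \<circ> A = B \<circ> f\<close> near the first point: an isometry of \<open>S\<^sup>3\<close> acts on the two factors
  of oriented planes by orthogonal maps, and if it exchanges the factors, then both \<open>f\<close> and an inverse of
  \<open>f\<close> would decrease distances. Hence the singular values of the differential of \<open>f\<close> are constant on
  \<open>V\<close>. If they are distinct, then the unit field along the singular direction is part of an orthonormal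
  frame whose connection coefficients are constant, which the positive curvature of \<open>S\<^sup>2\<close> excludes. If
  they are equal and positive, then \<open>f\<close> is a local homothety; it maps great circles to great
  circles, so comparison of Jacobi fields shows that it preserves distances, contradicting that \<open>f\<close>
  decreases them. So the differential vanishes and \<open>f\<close> is constant. The constant is an orthogonal complex
  structure of four-space, and the fibers are the great circles in its complex lines.\<close>

section \<open>Second derivatives\<close>

text \<open>Regularity is the obstacle. With \<open>f\<close> of class C2 the metric pulled back by
  \<open>f\<close> is only C1, and so is the field of singular directions, while the curvature
  identity involves second derivatives of that field. Homogeneity supplies them. The local
  symmetries preserve the field up to sign, so the squares of its connection coefficients are
  constant, and continuity makes the coefficients themselves constant near a point. The first
  derivative of the field is then an algebraic expression in the frame, hence differentiable again.
  For this reason the symmetry of second derivatives is proved under differentiability of the first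
  derivative at a single point, without continuity of the second.\<close>

lemma second_difference_estimate:
  fixes F :: "'a::real_normed_vector \<Rightarrow> real"
  assumes S: "open S" "x \<in> S"
    and F: "\<And>y. y \<in> S \<Longrightarrow> (F has_derivative F' y) (at y)"
    and L: "((\<lambda>y. F' y v) has_derivative L) (at x)"
    and e: "e > 0"
  shows "\<forall>\<^sub>F h in at_right 0.
    \<bar>F (x + h *\<^sub>R v + h *\<^sub>R w) - F (x + h *\<^sub>R v) - F (x + h *\<^sub>R w) + F x - h\<^sup>2 * L w\<bar> \<le> e * h\<^sup>2"
proof -
  define M where "M = norm v + norm w + 1"
  \<comment> \<open>Two values of the derivative, at points within \<open>h * M\<close> of
    \<open>x\<close>, are compared with its linearization, each with error
    \<open>\<epsilon> * (h * M)\<close>; this choice makes the total \<open>e * h\<close>.\<close>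
  define \<epsilon> where "\<epsilon> = e / (2 * M)"
  have M: "M > 0" by (simp add: M_def add_nonneg_pos)
  then have \<epsilon>: "\<epsilon> > 0" using e by (simp add: \<epsilon>_def)
  interpret L: bounded_linear L using L has_derivative_bounded_linear by blast
  obtain d1 where d1: "d1 > 0" "ball x d1 \<subseteq> S" using S openE by blast
  obtain d2 where d2: "d2 > 0"
    "\<And>z. norm (z - x) < d2 \<Longrightarrow> \<bar>F' z v - F' x v - L (z - x)\<bar> \<le> \<epsilon> * norm (z - x)"
    using L \<epsilon> unfolding has_derivative_at_alt by (auto simp: real_norm_def)
  define d where "d = min d1 d2"
  have d: "d > 0" using d1 d2 by (simp add: d_def)
  have *: "\<bar>F (x + h *\<^sub>R v + h *\<^sub>R w) - F (x + h *\<^sub>R v) - F (x + h *\<^sub>R w) + F x - h\<^sup>2 * L w\<bar> \<le> e * h\<^sup>2"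
    if h: "0 < h" "h < d / M" for h
  proof -
    have hM: "h * M < d" using h M by (simp add: field_simps)
    have small: "norm (t *\<^sub>R v + s *\<^sub>R w) \<le> h * M" if "0 \<le> t" "t \<le> h" "0 \<le> s" "s \<le> h" for t s
    proof -
      have "norm (t *\<^sub>R v + s *\<^sub>R w) \<le> t * norm v + s * norm w"
        using that by (intro order_trans[OF norm_triangle_ineq]) simp
      also have "\<dots> \<le> h * norm v + h * norm w"
        using that by (intro add_mono mult_right_mono) auto
      also have "\<dots> \<le> h * M" using h by (simp add: M_def algebra_simps)
      finally show ?thesis .
    qed
    have inS: "x + t *\<^sub>R v + s *\<^sub>R w \<in> S" if "0 \<le> t" "t \<le> h" "0 \<le> s" "s \<le> h" for t s
    proof -
      have "dist x (x + t *\<^sub>R v + s *\<^sub>R w) = norm (t *\<^sub>R v + s *\<^sub>R w)"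
        by (metis (no_types, lifting) add.assoc add_diff_cancel_left' dist_commute dist_norm)
      also have "\<dots> < d1" using small[OF that] hM by (simp add: d_def)
      finally show ?thesis using d1 by auto
    qed
    have est: "\<bar>F' (x + t *\<^sub>R v + s *\<^sub>R w) v - F' x v - L (t *\<^sub>R v + s *\<^sub>R w)\<bar> \<le> \<epsilon> * (h * M)"
      if "0 \<le> t" "t \<le> h" "0 \<le> s" "s \<le> h" for t s
    proof -
      have eq: "(x + t *\<^sub>R v + s *\<^sub>R w) - x = t *\<^sub>R v + s *\<^sub>R w" by simp
      have "norm (t *\<^sub>R v + s *\<^sub>R w) < d2" using small[OF that] hM by (simp add: d_def)
      then have "\<bar>F' (x + t *\<^sub>R v + s *\<^sub>R w) v - F' x v - L (t *\<^sub>R v + s *\<^sub>R w)\<bar>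
          \<le> \<epsilon> * norm (t *\<^sub>R v + s *\<^sub>R w)"
        using d2(2)[of "x + t *\<^sub>R v + s *\<^sub>R w"] unfolding eq by simp
      also have "\<dots> \<le> \<epsilon> * (h * M)" using small[OF that] \<epsilon> by simp
      finally show ?thesis .
    qed
    \<comment> \<open>The second difference is \<open>u h - u 0\<close>. The mean value theorem in
      the direction \<open>v\<close> turns it into \<open>h\<close> times a difference of
      \<open>F' _ v\<close> at two points, where differentiability at \<open>x\<close> alone
      applies.\<close>
    define u where "u t = F (x + t *\<^sub>R v + h *\<^sub>R w) - F (x + t *\<^sub>R v + 0 *\<^sub>R w)" for t
    have der: "((\<lambda>t. F (x + t *\<^sub>R v + s *\<^sub>R w)) has_real_derivative F' (x + t *\<^sub>R v + s *\<^sub>R w) v) (at t)"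
      if "0 \<le> t" "t \<le> h" "0 \<le> s" "s \<le> h" for t s
    proof -
      have D: "(F has_derivative F' (x + t *\<^sub>R v + s *\<^sub>R w)) (at (x + t *\<^sub>R v + s *\<^sub>R w))"
        using F inS that by blast
      have "((\<lambda>t. F (x + t *\<^sub>R v + s *\<^sub>R w)) has_derivative (\<lambda>k. F' (x + t *\<^sub>R v + s *\<^sub>R w) (k *\<^sub>R v))) (at t)"
        by (rule has_derivative_compose[where f="\<lambda>t. x + t *\<^sub>R v + s *\<^sub>R w" and g=F, OF _ D])
          (auto intro!: derivative_eq_intros)
      then show ?thesis
        using linear_scale[OF has_derivative_linear[OF D]]
        by (simp add: has_field_derivative_def mult.commute cong: if_cong)
          (simp add: mult_commute_abs)
    qed
    have "\<exists>\<xi>. 0 < \<xi> \<and> \<xi> < h \<and> u h - u 0 = (h - 0) * (F' (x + \<xi> *\<^sub>R v + h *\<^sub>R w) v - F' (x + \<xi> *\<^sub>R v + 0 *\<^sub>R w) v)"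
    proof (rule MVT2)
      show "0 < h" by fact
      show "(u has_real_derivative F' (x + t *\<^sub>R v + h *\<^sub>R w) v - F' (x + t *\<^sub>R v + 0 *\<^sub>R w) v) (at t)"
        if "0 \<le> t" "t \<le> h" for t
        unfolding u_def using that h by (intro DERIV_diff der) auto
    qed
    then obtain \<xi> where \<xi>: "0 < \<xi>" "\<xi> < h"
      "u h - u 0 = h * (F' (x + \<xi> *\<^sub>R v + h *\<^sub>R w) v - F' (x + \<xi> *\<^sub>R v + 0 *\<^sub>R w) v)" by auto
    have "\<bar>(F' (x + \<xi> *\<^sub>R v + h *\<^sub>R w) v - F' (x + \<xi> *\<^sub>R v + 0 *\<^sub>R w) v) - h * L w\<bar> \<le> 2 * (\<epsilon> * (h * M))"
      using est[of \<xi> h] est[of \<xi> 0] \<xi> h by (simp add: L.add L.scaleR)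
    also have "2 * (\<epsilon> * (h * M)) = e * h" using M by (simp add: \<epsilon>_def)
    finally have "h * \<bar>(F' (x + \<xi> *\<^sub>R v + h *\<^sub>R w) v - F' (x + \<xi> *\<^sub>R v + 0 *\<^sub>R w) v) - h * L w\<bar> \<le> h * (e * h)"
      using h by (simp add: mult_left_mono)
    then have "\<bar>u h - u 0 - h\<^sup>2 * L w\<bar> \<le> e * h\<^sup>2"
      using h abs_mult[of h "(F' (x + \<xi> *\<^sub>R v + h *\<^sub>R w) v - F' (x + \<xi> *\<^sub>R v + 0 *\<^sub>R w) v) - h * L w"]
      unfolding \<xi>(3) by (simp add: right_diff_distrib power2_eq_square mult.assoc mult.left_commute)
    then show ?thesis by (simp add: u_def algebra_simps)
  qed
  have "\<forall>\<^sub>F h in at_right 0. 0 < h \<and> h < d / M"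
    using d M by (auto intro!: eventually_at_right_less simp: eventually_at_right_field intro: exI[of _ "d/M"])
  then show ?thesis by eventually_elim (use * in blast)
qed

text \<open>The second difference is symmetric in \<open>v\<close> and \<open>w\<close>, so after
  division by \<open>h\<^sup>2\<close> it tends both to \<open>Lv w\<close> and to
  \<open>Lw v\<close>. With \<open>e\<close> a third of their distance, the two errors cannot bridge
  the gap.\<close>

lemma second_derivative_symmetric_real:
  fixes F :: "'a::real_normed_vector \<Rightarrow> real"
  assumes S: "open S" "x \<in> S"
    and F: "\<And>y. y \<in> S \<Longrightarrow> (F has_derivative F' y) (at y)"
    and v: "((\<lambda>y. F' y v) has_derivative Lv) (at x)"
    and w: "((\<lambda>y. F' y w) has_derivative Lw) (at x)"
  shows "Lv w = Lw v"
proof (rule ccontr)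
  assume ne: "Lv w \<noteq> Lw v"
  define e where "e = \<bar>Lv w - Lw v\<bar> / 3"
  have e: "e > 0" using ne by (simp add: e_def)
  have "\<forall>\<^sub>F h in at_right 0. h > 0 \<and>
    \<bar>F (x + h *\<^sub>R v + h *\<^sub>R w) - F (x + h *\<^sub>R v) - F (x + h *\<^sub>R w) + F x - h\<^sup>2 * Lv w\<bar> \<le> e * h\<^sup>2 \<and>
    \<bar>F (x + h *\<^sub>R w + h *\<^sub>R v) - F (x + h *\<^sub>R w) - F (x + h *\<^sub>R v) + F x - h\<^sup>2 * Lw v\<bar> \<le> e * h\<^sup>2"
    using second_difference_estimate[OF S F v e] second_difference_estimate[OF S F w e]
    by (intro eventually_conj eventually_at_right_less)
  then obtain h where h: "h > 0"
    "\<bar>F (x + h *\<^sub>R v + h *\<^sub>R w) - F (x + h *\<^sub>R v) - F (x + h *\<^sub>R w) + F x - h\<^sup>2 * Lv w\<bar> \<le> e * h\<^sup>2"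
    "\<bar>F (x + h *\<^sub>R w + h *\<^sub>R v) - F (x + h *\<^sub>R w) - F (x + h *\<^sub>R v) + F x - h\<^sup>2 * Lw v\<bar> \<le> e * h\<^sup>2"
    using eventually_happens'[OF trivial_limit_at_right_real] by blast
  have "x + h *\<^sub>R w + h *\<^sub>R v = x + h *\<^sub>R v + h *\<^sub>R w" by (simp add: algebra_simps)
  with h(2,3) have "\<bar>h\<^sup>2 * Lv w - h\<^sup>2 * Lw v\<bar> \<le> 2 * (e * h\<^sup>2)" by (simp add: abs_le_iff)
  moreover have "\<bar>h\<^sup>2 * Lv w - h\<^sup>2 * Lw v\<bar> = h\<^sup>2 * \<bar>Lv w - Lw v\<bar>"
    by (simp add: abs_mult flip: right_diff_distrib)
  ultimately have "h\<^sup>2 * \<bar>Lv w - Lw v\<bar> \<le> h\<^sup>2 * (2 * e)" by (simp add: algebra_simps)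
  then have "\<bar>Lv w - Lw v\<bar> \<le> 2 * e" using h(1) by simp
  then show False using e by (simp add: e_def)
qed

lemma second_derivative_symmetric:
  fixes F :: "'a::real_normed_vector \<Rightarrow> 'b::real_inner"
  assumes S: "open S" "x \<in> S"
    and F: "\<And>y. y \<in> S \<Longrightarrow> (F has_derivative F' y) (at y)"
    and v: "((\<lambda>y. F' y v) has_derivative Lv) (at x)"
    and w: "((\<lambda>y. F' y w) has_derivative Lw) (at x)"
  shows "Lv w = Lw v"
proof -
  have "Lv w \<bullet> c = Lw v \<bullet> c" for c
    by (rule second_derivative_symmetric_real[OF S, of "\<lambda>y. F y \<bullet> c" "\<lambda>y k. F' y k \<bullet> c" v "\<lambda>k. Lv k \<bullet> c" w "\<lambda>k. Lw k \<bullet> c"])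
      (auto intro!: has_derivative_inner_left F v w)
  then show ?thesis by (metis vector_eq_rdot)
qed

section \<open>Cones over subsets of the unit sphere and radial extensions\<close>

definition open_cone :: "'a::real_normed_vector set \<Rightarrow> 'a set" where
  "open_cone V = {x. x \<noteq> 0 \<and> sgn x \<in> V}"

lemma open_open_cone:
  fixes V :: "'a::real_normed_vector set"
  assumes "openin (top_of_set (sphere 0 1)) V"
  shows "open (open_cone V)"
proof -
  obtain T where T: "open T" "V = sphere 0 1 \<inter> T" using assms by (auto simp: openin_open)
  have "continuous_on (- {0::'a}) sgn" by (intro continuous_intros) auto
  then have "open ((- {0}) \<inter> sgn -` T)" by (intro continuous_open_preimage) (use T in auto)
  moreover have "open_cone V = (- {0}) \<inter> sgn -` T" by (auto simp: open_cone_def T norm_sgn)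
  ultimately show ?thesis by simp
qed

lemma connected_open_cone:
  fixes V :: "'a::real_normed_vector set"
  assumes "connected V" "V \<subseteq> sphere 0 1"
  shows "connected (open_cone V)"
proof -
  have "connected ((\<lambda>(t, x). t *\<^sub>R x) ` ({0<..} \<times> V))"
    using assms(1) by (intro connected_continuous_image connected_Times continuous_intros)
      (auto simp: split_beta intro!: continuous_intros)
  moreover have "open_cone V = (\<lambda>(t, x). t *\<^sub>R x) ` ({0<..} \<times> V)"
  proof (intro subset_antisym subsetI)
    fix x assume "x \<in> open_cone V"
    then have "x = norm x *\<^sub>R sgn x" "norm x > 0" "sgn x \<in> V"
      by (auto simp: open_cone_def sgn_div_norm)
    then show "x \<in> (\<lambda>(t, x). t *\<^sub>R x) ` ({0<..} \<times> V)" by force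
  next
    fix x assume "x \<in> (\<lambda>(t, x). t *\<^sub>R x) ` ({0<..} \<times> V)"
    then obtain t y where ty: "t > 0" "y \<in> V" "x = t *\<^sub>R y" by auto
    moreover have "norm y = 1" using ty assms by auto
    ultimately show "x \<in> open_cone V" by (auto simp: open_cone_def sgn_div_norm)
  qed
  ultimately show ?thesis by simp
qed

text \<open>The component of \<open>v\<close> orthogonal to \<open>x\<close>, divided by
  \<open>norm x\<close>.\<close>

definition sgn_deriv :: "'a::real_inner \<Rightarrow> 'a \<Rightarrow> 'a" where
  "sgn_deriv x v = v /\<^sub>R norm x - ((x \<bullet> v) / norm x ^ 3) *\<^sub>R x"

definition sgn_deriv2 :: "'a::real_inner \<Rightarrow> 'a \<Rightarrow> 'a \<Rightarrow> 'a" where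
  "sgn_deriv2 x v w = - ((x \<bullet> w) / norm x ^ 3) *\<^sub>R v - ((w \<bullet> v) / norm x ^ 3) *\<^sub>R x
     + (3 * (x \<bullet> v) * (x \<bullet> w) / norm x ^ 5) *\<^sub>R x - ((x \<bullet> v) / norm x ^ 3) *\<^sub>R w"

lemma has_derivative_sgn:
  fixes x :: "'a::real_inner"
  assumes "x \<noteq> 0"
  shows "(sgn has_derivative sgn_deriv x) (at x)"
proof -
  have "((\<lambda>y::'a. y /\<^sub>R norm y) has_derivative sgn_deriv x) (at x)"
    using assms
    by (auto intro!: derivative_eq_intros has_derivative_norm
      simp: sgn_deriv_def fun_eq_iff sgn_div_norm divide_simps power3_eq_cube algebra_simps inner_commute)
  then show ?thesis by (simp add: sgn_div_norm[abs_def])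
qed

lemma has_derivative_sgn_deriv:
  fixes x :: "'a::real_inner"
  assumes "x \<noteq> 0"
  shows "((\<lambda>y. sgn_deriv y v) has_derivative sgn_deriv2 x v) (at x)"
  unfolding sgn_deriv_def
  using assms
  by (auto intro!: derivative_eq_intros has_derivative_norm
      simp: sgn_deriv2_def fun_eq_iff sgn_div_norm field_simps power3_eq_cube numeral_eq_Suc inner_commute
      simp flip: scaleR_left_distrib)

lemma continuous_on_sgn_deriv:
  "continuous_on (- {0}) (\<lambda>x. sgn_deriv x v)"
  unfolding sgn_deriv_def by (intro continuous_intros) auto

lemma continuous_on_sgn_deriv2:
  "continuous_on (- {0}) (\<lambda>x. sgn_deriv2 x v w)"
  unfolding sgn_deriv2_def by (intro continuous_intros) auto

text \<open>The local C2 extensions of \<open>f\<close> vary with the point and need not be constant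
  on rays, but composed with \<open>sgn\<close> they all coincide locally with
  \<open>f \<circ> sgn\<close>. Their derivatives are therefore determined by that function and
  patch together.\<close>

lemma C2_on_radial_extension:
  fixes f :: "'a::euclidean_space \<Rightarrow> 'b::euclidean_space"
  assumes V: "openin (top_of_set (sphere 0 1)) V" and f: "C2_on V f"
  obtains F' F'' where
    "\<And>x. x \<in> open_cone V \<Longrightarrow> ((\<lambda>x. f (sgn x)) has_derivative F' x) (at x)"
    "\<And>x v. x \<in> open_cone V \<Longrightarrow> ((\<lambda>y. F' y v) has_derivative F'' x v) (at x)"
    "\<And>v w. continuous_on (open_cone V) (\<lambda>x. F'' x v w)"
proof -
  define F where "F x = f (sgn x)" for x
  have "\<exists>N G' G''. open N \<and> x0 \<in> N \<and> N \<subseteq> open_cone V \<and>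
      (\<forall>x\<in>N. (F has_derivative G' x) (at x)) \<and>
      (\<forall>x\<in>N. \<forall>v. ((\<lambda>y. G' y v) has_derivative G'' x v) (at x)) \<and>
      (\<forall>v w. continuous_on N (\<lambda>x. G'' x v w))"
    if x0: "x0 \<in> open_cone V" for x0
  proof -
    obtain U h where U: "sgn x0 \<in> U" "C2_on_open U h" "\<And>y. y \<in> U \<inter> V \<Longrightarrow> h y = f y"
      using f x0 unfolding C2_on_def open_cone_def by blast
    obtain h' :: "'a \<Rightarrow> 'a \<Rightarrow>\<^sub>L 'b" and h'' :: "'a \<Rightarrow> 'a \<Rightarrow>\<^sub>L 'a \<Rightarrow>\<^sub>L 'b"
      where h: "open U" "\<And>x. x \<in> U \<Longrightarrow> (h has_derivative blinfun_apply (h' x)) (at x)"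
        "\<And>x. x \<in> U \<Longrightarrow> (h' has_derivative blinfun_apply (h'' x)) (at x)" "continuous_on U h''"
      using U(2) unfolding C2_on_open_def by blast
    define N where "N = open_cone V \<inter> ((- {0}) \<inter> sgn -` U)"
    have "continuous_on (- {0::'a}) sgn" by (intro continuous_intros) auto
    then have "open ((- {0}) \<inter> sgn -` U)" by (intro continuous_open_preimage) (use h in auto)
    then have N: "open N" using open_open_cone[OF V] by (auto simp: N_def)
    have x0N: "x0 \<in> N" using x0 U(1) by (auto simp: N_def open_cone_def)
    have Fh: "F y = h (sgn y)" if "y \<in> N" for y
      using that U(3) by (auto simp: N_def open_cone_def F_def)
    have sgn': "(sgn has_derivative sgn_deriv y) (at y)" and ne: "y \<noteq> 0" and inU: "sgn y \<in> U"
      if "y \<in> N" for y using that by (auto simp: N_def intro: has_derivative_sgn)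
    define G' where "G' x v = h' (sgn x) (sgn_deriv x v)" for x v
    define G'' where "G'' x v w = h'' (sgn x) (sgn_deriv x w) (sgn_deriv x v)
      + h' (sgn x) (sgn_deriv2 x v w)" for x v w
    have 1: "(F has_derivative G' x) (at x)" if x: "x \<in> N" for x
    proof -
      have "((\<lambda>y. h (sgn y)) has_derivative G' x) (at x)"
        unfolding G'_def by (rule has_derivative_compose[OF sgn'[OF x] h(2)[OF inU[OF x]]])
      then show ?thesis
        by (rule has_derivative_transform_within_open[OF _ N x]) (simp add: Fh)
    qed
    have h's: "((\<lambda>y. h' (sgn y)) has_derivative (\<lambda>w. h'' (sgn x) (sgn_deriv x w))) (at x)"
      if x: "x \<in> N" for x
      by (rule has_derivative_compose[OF sgn'[OF x] h(3)[OF inU[OF x]]])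
    have 2: "((\<lambda>y. G' y v) has_derivative G'' x v) (at x)" if x: "x \<in> N" for x v
      using bounded_bilinear.FDERIV[OF bounded_bilinear_blinfun_apply h's[OF x]
          has_derivative_sgn_deriv[OF ne[OF x], of v]]
      unfolding G'_def G''_def by (simp add: add.commute)
    have cs: "continuous_on N sgn" using ne by (intro continuous_intros) auto
    have ch'': "continuous_on N (\<lambda>x. h'' (sgn x))"
      by (rule continuous_on_compose2[OF h(4) cs]) (use inU in auto)
    have ch': "continuous_on N (\<lambda>x. h' (sgn x))"
      using h's N by (meson continuous_at_imp_continuous_on has_derivative_continuous)
    have sub: "N \<subseteq> - {0}" using ne by auto
    have 3: "continuous_on N (\<lambda>x. G'' x v w)" for v w
      unfolding G''_def
      by (intro continuous_intros ch'' ch' continuous_on_subset[OF continuous_on_sgn_deriv sub]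
          continuous_on_subset[OF continuous_on_sgn_deriv2 sub])
    show ?thesis
      using N x0N 1 2 3 by (intro exI[of _ N] exI[of _ G'] exI[of _ G'']) (auto simp: N_def)
  qed
  then obtain N G' G'' where NG: "\<And>x. x \<in> open_cone V \<Longrightarrow> open (N x) \<and> x \<in> N x \<and> N x \<subseteq> open_cone V \<and>
      (\<forall>y\<in>N x. (F has_derivative G' x y) (at y)) \<and>
      (\<forall>y\<in>N x. \<forall>v. ((\<lambda>y. G' x y v) has_derivative G'' x y v) (at y)) \<and>
      (\<forall>v w. continuous_on (N x) (\<lambda>y. G'' x y v w))" by metis
  define F' where "F' y = G' y y" for y
  define F'' where "F'' y = G'' y y" for y
  have eq': "F' y = G' x y" if "x \<in> open_cone V" "y \<in> N x" for x y
  proof -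
    have "y \<in> open_cone V" using NG that by blast
    then show ?thesis unfolding F'_def using NG that by (metis has_derivative_unique)
  qed
  have d2: "((\<lambda>y. F' y v) has_derivative G'' x y v) (at y)" if "x \<in> open_cone V" "y \<in> N x" for x y v
  proof -
    have D: "((\<lambda>y. G' x y v) has_derivative G'' x y v) (at y)" "open (N x)" using NG that by blast+
    show ?thesis by (rule has_derivative_transform_within_open[OF D(1,2) that(2)]) (simp add: eq'[OF that(1)])
  qed
  have eq'': "F'' y = G'' x y" if "x \<in> open_cone V" "y \<in> N x" for x y
  proof
    fix v
    have y: "y \<in> open_cone V" "y \<in> N y" using NG that by blast+
    show "F'' y v = G'' x y v"
      unfolding F''_def using d2[OF that, of v] d2[OF y, of v] has_derivative_unique by blast
  qed
  show thesis
  proof (rule that)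
    fix x assume x: "x \<in> open_cone V"
    have xN: "x \<in> N x" using NG x by blast
    show "((\<lambda>x. f (sgn x)) has_derivative F' x) (at x)"
      using NG[OF x] unfolding F'_def F_def by blast
    show "((\<lambda>y. F' y v) has_derivative F'' x v) (at x)" for v
      using d2[OF x xN] by (simp add: F''_def)
  next
    fix v w
    have "isCont (\<lambda>x. F'' x v w) x" if x: "x \<in> open_cone V" for x
    proof -
      have N: "open (N x)" "x \<in> N x" "continuous_on (N x) (\<lambda>y. G'' x y v w)" using NG[OF x] by blast+
      then have "continuous_on (N x) (\<lambda>y. F'' y v w)"
        by (subst continuous_on_cong[OF refl]) (use eq''[OF x] in auto)
      then show ?thesis using N by (simp add: continuous_on_eq_continuous_at)
    qed
    then show "continuous_on (open_cone V) (\<lambda>x. F'' x v w)"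
      by (simp add: continuous_at_imp_continuous_on)
  qed
qed

section \<open>Orthonormal frames of three-space\<close>

definition orthonormal_triple :: "'a::real_inner \<Rightarrow> 'a \<Rightarrow> 'a \<Rightarrow> bool" where
  "orthonormal_triple a u v \<longleftrightarrow>
     norm a = 1 \<and> norm u = 1 \<and> norm v = 1 \<and> a \<bullet> u = 0 \<and> a \<bullet> v = 0 \<and> u \<bullet> v = 0"

lemma orthonormal_tripleD:
  assumes "orthonormal_triple a u v"
  shows "a \<bullet> a = 1" "u \<bullet> u = 1" "v \<bullet> v = 1" "a \<bullet> u = 0" "a \<bullet> v = 0" "u \<bullet> v = 0"
    "u \<bullet> a = 0" "v \<bullet> a = 0" "v \<bullet> u = 0"
  using assms by (auto simp: orthonormal_triple_def norm_eq_1 inner_commute)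

lemma orthonormal_triple_orthogonal_imp_0:
  fixes a u v w :: "real ^ 3"
  assumes "orthonormal_triple a u v" "w \<bullet> a = 0" "w \<bullet> u = 0" "w \<bullet> v = 0"
  shows "w = 0"
proof (rule ccontr)
  assume "w \<noteq> 0"
  note o = orthonormal_tripleD[OF assms(1)]
  have ne: "a \<noteq> 0" "u \<noteq> 0" "v \<noteq> 0" "a \<noteq> u" "a \<noteq> v" "u \<noteq> v" "w \<noteq> a" "w \<noteq> u" "w \<noteq> v"
    using o assms \<open>w \<noteq> 0\<close> by auto
  have "independent {a, u, v, w}"
    by (rule pairwise_orthogonal_independent)
      (use o assms ne \<open>w \<noteq> 0\<close> in \<open>auto simp: pairwise_def orthogonal_def inner_commute\<close>)
  then have "card {a, u, v, w} \<le> DIM(real ^ 3)" by (rule independent_bound[THEN conjunct2])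
  then show False using ne by auto
qed

lemma orthonormal_triple_expansion:
  fixes a u v w :: "real ^ 3"
  assumes "orthonormal_triple a u v"
  shows "w = (w \<bullet> a) *\<^sub>R a + (w \<bullet> u) *\<^sub>R u + (w \<bullet> v) *\<^sub>R v"
proof -
  note o = orthonormal_tripleD[OF assms]
  have "w - ((w \<bullet> a) *\<^sub>R a + (w \<bullet> u) *\<^sub>R u + (w \<bullet> v) *\<^sub>R v) = 0"
    by (rule orthonormal_triple_orthogonal_imp_0[OF assms]) (simp_all add: inner_simps o)
  then show ?thesis by simp
qed

lemma orthonormal_triple_norm:
  fixes a u v w :: "real ^ 3"
  assumes "orthonormal_triple a u v"
  shows "w \<bullet> w = (w \<bullet> a)\<^sup>2 + (w \<bullet> u)\<^sup>2 + (w \<bullet> v)\<^sup>2"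
proof -
  have "w \<bullet> w = w \<bullet> ((w \<bullet> a) *\<^sub>R a + (w \<bullet> u) *\<^sub>R u + (w \<bullet> v) *\<^sub>R v)"
    using orthonormal_triple_expansion[OF assms, of w] by simp
  then show ?thesis by (simp add: inner_simps power2_eq_square)
qed

lemma orthonormal_triple_cross3:
  assumes "norm a = 1" "norm u = 1" "a \<bullet> u = 0"
  shows "orthonormal_triple a u (cross3 a u)"
  using assms by (auto simp: orthonormal_triple_def dot_cross_self norm_eq_1 dot_cross inner_commute)

lemma exists_orthonormal_triple:
  fixes a :: "real ^ 3"
  assumes "norm a = 1"
  obtains u v where "orthonormal_triple a u v"
proof -
  obtain y where y: "y \<noteq> 0" "a \<bullet> y = 0"
    using orthogonal_to_vector_exists[of a] by (auto simp: orthogonal_def)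
  then have "orthonormal_triple a (sgn y) (cross3 a (sgn y))"
    by (intro orthonormal_triple_cross3 assms) (auto simp: norm_sgn sgn_div_norm)
  then show thesis by (rule that)
qed

text \<open>Rotating the frame by a right angle changes the sign of \<open>D u \<bullet> D v\<close>, so that some
  intermediate rotation makes it vanish.\<close>

lemma linear_diagonalizing_frame:
  fixes D :: "real ^ 3 \<Rightarrow> real ^ 3"
  assumes "linear D" "norm a = 1"
  obtains u v where "orthonormal_triple a u v" "D u \<bullet> D v = 0"
proof -
  interpret linear D by fact
  obtain u v where uv: "orthonormal_triple a u v" using exists_orthonormal_triple assms by blast
  note o = orthonormal_tripleD[OF uv]
  define U where "U t = cos t *\<^sub>R u + sin t *\<^sub>R v" for t
  define V where "V t = - sin t *\<^sub>R u + cos t *\<^sub>R v" for t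
  define \<phi> where "\<phi> t = D (U t) \<bullet> D (V t)" for t
  have frame: "orthonormal_triple a (U t) (V t)" for t
    unfolding orthonormal_triple_def norm_eq_1 U_def V_def
    using sin_cos_squared_add3[of t] by (simp add: inner_simps o algebra_simps)
  have cont: "continuous_on {0..pi/2} \<phi>"
    unfolding \<phi>_def U_def V_def by (simp add: add scale diff neg, intro continuous_intros)
  have "\<phi> 0 = D u \<bullet> D v" "\<phi> (pi/2) = - (D u \<bullet> D v)"
    by (simp_all add: \<phi>_def U_def V_def neg inner_commute)
  then have "\<exists>t. 0 \<le> t \<and> t \<le> pi/2 \<and> \<phi> t = 0"
    using IVT'[of \<phi> 0 0 "pi/2"] IVT2'[of \<phi> "pi/2" 0 0] cont by (cases "D u \<bullet> D v \<le> 0") auto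
  then show thesis using that frame unfolding \<phi>_def by blast
qed

section \<open>Homogeneous maps of class C2\<close>

text \<open>Maps of an open subset of the unit sphere are represented by their extensions to the open
  cone over it that are constant on rays, so that ordinary derivatives can be used.\<close>

locale homogeneous_map =
  fixes K :: "(real ^ 3) set" and F :: "real ^ 3 \<Rightarrow> real ^ 3"
    and F' :: "real ^ 3 \<Rightarrow> real ^ 3 \<Rightarrow> real ^ 3"
    and F'' :: "real ^ 3 \<Rightarrow> real ^ 3 \<Rightarrow> real ^ 3 \<Rightarrow> real ^ 3"
  assumes open_K: "open K" and connected_K: "connected K" and zero_notin_K: "0 \<notin> K"
    and scale_K: "\<And>x t. x \<in> K \<Longrightarrow> t > 0 \<Longrightarrow> t *\<^sub>R x \<in> K"
    and scale_F: "\<And>x t. x \<in> K \<Longrightarrow> t > 0 \<Longrightarrow> F (t *\<^sub>R x) = F x"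
    and norm_F: "\<And>x. x \<in> K \<Longrightarrow> norm (F x) = 1"
    and deriv_F: "\<And>x. x \<in> K \<Longrightarrow> (F has_derivative F' x) (at x)"
    and deriv_F': "\<And>x v. x \<in> K \<Longrightarrow> ((\<lambda>y. F' y v) has_derivative F'' x v) (at x)"
    and continuous_F'': "\<And>v w. continuous_on K (\<lambda>x. F'' x v w)"
    and homogeneous: "\<And>x y. \<lbrakk>x \<in> K; y \<in> K; norm x = 1; norm y = 1\<rbrakk> \<Longrightarrow>
      \<exists>A B N. orthogonal_transformation A \<and> orthogonal_transformation B \<and> open N \<and> x \<in> N \<and>
        N \<subseteq> K \<and> A ` N \<subseteq> K \<and> A x = y \<and> (\<forall>z\<in>N. F (A z) = B (F z))"
    and decreasing: "\<And>x y. \<lbrakk>x \<in> K; y \<in> K; norm x = 1; norm y = 1; x \<noteq> y\<rbrakk> \<Longrightarrow> x \<bullet> y < F x \<bullet> F y"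
begin

lemma linear_F': "x \<in> K \<Longrightarrow> linear (F' x)"
  using deriv_F has_derivative_linear by blast

lemma F'_radial:
  assumes x: "x \<in> K" shows "F' x x = 0"
proof -
  have "((\<lambda>t. F (t *\<^sub>R x)) has_derivative (\<lambda>t. F' x (t *\<^sub>R x))) (at 1)"
    by (rule has_derivative_compose[where f = "\<lambda>t. t *\<^sub>R x" and g = F])
      (use deriv_F[OF x] in \<open>auto intro!: derivative_eq_intros\<close>)
  moreover have "((\<lambda>t. F (t *\<^sub>R x)) has_derivative (\<lambda>t. 0)) (at 1)"
    by (rule has_derivative_transform_within_open[OF has_derivative_const[of "F x"], of "{0<..}"])
      (use scale_F[OF x] in auto)
  ultimately have "(\<lambda>t. F' x (t *\<^sub>R x)) = (\<lambda>t. 0)" by (rule has_derivative_unique)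
  from fun_cong[OF this, of 1] show ?thesis by simp
qed

lemma F'_scale:
  assumes x: "x \<in> K" and t: "t > 0" shows "F' (t *\<^sub>R x) v = F' x v /\<^sub>R t"
proof -
  have "((\<lambda>y. F (t *\<^sub>R y)) has_derivative (\<lambda>w. F' (t *\<^sub>R x) (t *\<^sub>R w))) (at x)"
    by (rule has_derivative_compose[where f = "\<lambda>y. t *\<^sub>R y" and g = F])
      (use deriv_F[OF scale_K[OF x t]] in \<open>auto intro!: derivative_eq_intros\<close>)
  moreover have "((\<lambda>y. F (t *\<^sub>R y)) has_derivative F' x) (at x)"
    by (rule has_derivative_transform_within_open[OF deriv_F[OF x] open_K x]) (simp add: scale_F t)
  ultimately have "(\<lambda>w. F' (t *\<^sub>R x) (t *\<^sub>R w)) = F' x" by (rule has_derivative_unique)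
  from fun_cong[OF this, of "v /\<^sub>R t"] show ?thesis
    using t linear_scale[OF linear_F'[OF x], of "inverse t" v] by simp
qed

lemma F'_orthogonal:
  assumes x: "x \<in> K" shows "F' x v \<bullet> F x = 0"
proof -
  have "((\<lambda>y. F y \<bullet> F y) has_derivative (\<lambda>v. F x \<bullet> F' x v + F' x v \<bullet> F x)) (at x)"
    by (intro has_derivative_inner deriv_F x)
  moreover have "((\<lambda>y. F y \<bullet> F y) has_derivative (\<lambda>v. 0)) (at x)"
    by (rule has_derivative_transform_within_open[OF has_derivative_const[of 1] open_K x])
      (metis norm_F norm_eq_1)
  ultimately have "(\<lambda>v. F x \<bullet> F' x v + F' x v \<bullet> F x) = (\<lambda>v. 0)" by (rule has_derivative_unique)
  from fun_cong[OF this, of v] show ?thesis by (simp add: inner_commute)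
qed

lemma F''_symmetric: "x \<in> K \<Longrightarrow> F'' x v w = F'' x w v"
  by (rule second_derivative_symmetric[OF open_K _ deriv_F deriv_F' deriv_F'])

lemma F'_intertwine:
  assumes "orthogonal_transformation A" "orthogonal_transformation B" "open N" "x \<in> N"
    "N \<subseteq> K" "A ` N \<subseteq> K" "\<forall>z\<in>N. F (A z) = B (F z)"
  shows "F' (A x) (A v) = B (F' x v)"
proof -
  have bl: "bounded_linear A" "bounded_linear B"
    using assms(1,2) by (auto simp: linear_linear orthogonal_transformation_def)
  have K: "x \<in> K" "A x \<in> K" using assms by auto
  have "((\<lambda>z. F (A z)) has_derivative (\<lambda>v. F' (A x) (A v))) (at x)"
    by (rule has_derivative_compose[OF bounded_linear.has_derivative[OF bl(1) has_derivative_ident] deriv_F[OF K(2)]])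
  moreover have "((\<lambda>z. B (F z)) has_derivative (\<lambda>v. B (F' x v))) (at x)"
    by (rule bounded_linear.has_derivative[OF bl(2) deriv_F[OF K(1)]])
  then have "((\<lambda>z. F (A z)) has_derivative (\<lambda>v. B (F' x v))) (at x)"
    by (rule has_derivative_transform_within_open[OF _ assms(3,4)]) (use assms in auto)
  ultimately have "(\<lambda>v. F' (A x) (A v)) = (\<lambda>v. B (F' x v))" by (rule has_derivative_unique)
  then show ?thesis by meson
qed

lemma F'_inner_scale:
  assumes "x \<in> K"
  shows "F' x v \<bullet> F' x w = (F' (sgn x) v \<bullet> F' (sgn x) w) / (norm x)\<^sup>2"
proof -
  have n: "norm x > 0" using assms zero_notin_K by auto
  have "sgn x \<in> K" using scale_K[OF assms, of "inverse (norm x)"] n by (simp add: sgn_div_norm)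
  moreover have "x = norm x *\<^sub>R sgn x" using n by (simp add: sgn_div_norm)
  ultimately have "F' x u = F' (sgn x) u /\<^sub>R norm x" for u
    using F'_scale[of "sgn x" "norm x" u] n by simp
  then show ?thesis by (simp add: power2_eq_square field_simps)
qed

lemma sgn_in_K: "x \<in> K \<Longrightarrow> sgn x \<in> K"
  using scale_K[of x "inverse (norm x)"] zero_notin_K by (auto simp: sgn_div_norm)

lemma transitive:
  assumes "x \<in> K" "y \<in> K" "norm x = 1" "norm y = 1"
  obtains A B N where "orthogonal_transformation A" "orthogonal_transformation B" "open N" "x \<in> N"
    "N \<subseteq> K" "A ` N \<subseteq> K" "A x = y" "\<forall>z\<in>N. F (A z) = B (F z)"
    "\<And>v. F' y (A v) = B (F' x v)"
proof -
  obtain A B N where *: "orthogonal_transformation A" "orthogonal_transformation B" "open N" "x \<in> N"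
    "N \<subseteq> K" "A ` N \<subseteq> K" "A x = y" "\<forall>z\<in>N. F (A z) = B (F z)"
    using homogeneous[OF assms] by metis
  show thesis
    by (rule that[OF *]) (use F'_intertwine[OF *(1-6,8)] *(7) in auto)
qed

end

section \<open>The conformal case\<close>

text \<open>The difference \<open>z\<close> of the two sides solves the same equation with zero
  initial data, and its energy \<open>(z' t)\<^sup>2 + s\<^sup>2 * (z t)\<^sup>2\<close> is
  conserved.\<close>

lemma harmonic_oscillator:
  fixes y y' :: "real \<Rightarrow> real"
  assumes s: "s > 0"
    and y: "\<And>t. \<bar>t\<bar> < \<delta> \<Longrightarrow> (y has_real_derivative y' t) (at t)"
    and y': "\<And>t. \<bar>t\<bar> < \<delta> \<Longrightarrow> (y' has_real_derivative - (s\<^sup>2 * y t)) (at t)"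
    and t: "\<bar>t\<bar> < \<delta>"
  shows "y t = cos (s * t) * y 0 + sin (s * t) / s * y' 0"
proof -
  define z where "z t = y t - (cos (s * t) * y 0 + sin (s * t) / s * y' 0)" for t
  define z' where "z' t = y' t - (- s * sin (s * t) * y 0 + cos (s * t) * y' 0)" for t
  have z: "(z has_real_derivative z' t) (at t)" if "\<bar>t\<bar> < \<delta>" for t
    unfolding z_def z'_def using s by (auto intro!: derivative_eq_intros y[OF that])
  have z': "(z' has_real_derivative - (s\<^sup>2 * z t)) (at t)" if "\<bar>t\<bar> < \<delta>" for t
    unfolding z_def z'_def using s
    by (auto intro!: derivative_eq_intros y'[OF that] simp: power2_eq_square field_simps)
  have "((\<lambda>t. (z' t)\<^sup>2 + s\<^sup>2 * (z t)\<^sup>2) has_real_derivative 0) (at t)" if "\<bar>t\<bar> < \<delta>" for t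
    by (auto intro!: derivative_eq_intros z[OF that] z'[OF that])
  then have "(z' t)\<^sup>2 + s\<^sup>2 * (z t)\<^sup>2 = (z' 0)\<^sup>2 + s\<^sup>2 * (z 0)\<^sup>2"
    by (intro DERIV_isconst3[of "-\<delta>" \<delta>]) (use t in auto)
  also have "\<dots> = 0" by (simp add: z_def z'_def)
  finally have "z t = 0" using s by (simp add: add_nonneg_eq_0_iff)
  then show ?thesis by (simp add: z_def)
qed

text \<open>Differentiating the identity once gives \<open>cos (s * t) = cos t\<close>, and once
  more \<open>s * sin (s * t) = sin t\<close>; together with the identity itself this yields
  \<open>s * s = 1\<close>.\<close>

lemma sin_homogeneous_imp_1:
  fixes s \<delta> :: real
  assumes "s > 0" "\<delta> > 0" and eq: "\<And>t. 0 < t \<Longrightarrow> t < \<delta> \<Longrightarrow> sin (s * t) = s * sin t"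
  shows "s = 1"
proof -
  have zero: "D = 0" if "(g has_real_derivative D) (at t)" "0 < t" "t < \<delta>"
    "\<And>t. 0 < t \<Longrightarrow> t < \<delta> \<Longrightarrow> g t = 0" for g D t
  proof -
    have "(g has_real_derivative 0) (at t)"
      by (rule has_field_derivative_transform_within_open[OF DERIV_const[of 0], of "{0<..<\<delta>}"])
        (use that in auto)
    then show "D = 0" using that(1) DERIV_unique by blast
  qed
  have 1: "s * (cos (s * t) - cos t) = 0" if "0 < t" "t < \<delta>" for t
    by (rule zero[of "\<lambda>t. sin (s * t) - s * sin t" _ t])
      (use that eq in \<open>auto intro!: derivative_eq_intros simp: algebra_simps\<close>)
  have 2: "s * sin (s * t) - sin t = 0" if "0 < t" "t < \<delta>" for t
  proof -
    have "- (s * sin (s * t) - sin t) = 0"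
      by (rule zero[of "\<lambda>t. cos (s * t) - cos t" _ t])
        (use that 1 assms in \<open>auto intro!: derivative_eq_intros\<close>)
    then show ?thesis by simp
  qed
  define t where "t = min \<delta> 1 / 2"
  have t: "0 < t" "t < \<delta>" "t < pi" using assms pi_gt3 by (auto simp: t_def)
  have "s * (s * sin t) = sin t" using 2[of t] eq[of t] t by simp
  then have "s * s = 1" using sin_gt_zero[of t] t by (simp add: mult.assoc[symmetric])
  then show ?thesis using assms(1) by (metis abs_of_pos abs_1 power2_eq_1_iff power2_eq_square abs_minus_cancel)
qed

context homogeneous_map
begin

context
  fixes s :: real
  assumes s: "s > 0"
    and conformal: "\<And>x v w. x \<in> K \<Longrightarrow> norm x = 1 \<Longrightarrow>
      F' x v \<bullet> F' x w = s\<^sup>2 * (v \<bullet> w - (v \<bullet> x) * (w \<bullet> x))"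
begin

lemma conformal_cone:
  assumes "x \<in> K"
  shows "F' x v \<bullet> F' x w = s\<^sup>2 * ((v \<bullet> w) / (x \<bullet> x) - (v \<bullet> x) * (w \<bullet> x) / (x \<bullet> x)\<^sup>2)"
proof -
  have n: "norm x > 0" using assms zero_notin_K by auto
  have "F' x v \<bullet> F' x w = (F' (sgn x) v \<bullet> F' (sgn x) w) / (norm x)\<^sup>2" by (rule F'_inner_scale[OF assms])
  also have "\<dots> = s\<^sup>2 * (v \<bullet> w - (v \<bullet> sgn x) * (w \<bullet> sgn x)) / (norm x)\<^sup>2"
    using conformal[OF sgn_in_K[OF assms]] n by (simp add: norm_sgn)
  also have "\<dots> = s\<^sup>2 * ((v \<bullet> w) / (x \<bullet> x) - (v \<bullet> x) * (w \<bullet> x) / (x \<bullet> x)\<^sup>2)"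
    using n by (simp add: sgn_div_norm dot_square_norm field_simps power2_eq_square)
  finally show ?thesis .
qed

text \<open>This is the argument for uniqueness of the Levi-Civita connection. On vectors tangent at
  \<open>p\<close> the pulled-back metric has derivative zero in tangent directions, so the
  trilinear form \<open>T\<close> is antisymmetric in its first two arguments; it is symmetric in
  the last two, and such a form vanishes.\<close>

lemma conformal_F''_normal:
  assumes p: "p \<in> K" "norm p = 1" and t: "a \<bullet> p = 0" "b \<bullet> p = 0" "c \<bullet> p = 0"
  shows "F' p a \<bullet> F'' p b c = 0"
proof -
  have anti: "F' p a \<bullet> F'' p b c + F'' p a c \<bullet> F' p b = 0"
    if t: "a \<bullet> p = 0" "b \<bullet> p = 0" "c \<bullet> p = 0" for a b c
  proof -
    have "((\<lambda>x. F' x a \<bullet> F' x b) has_derivative (\<lambda>c. F' p a \<bullet> F'' p b c + F'' p a c \<bullet> F' p b)) (at p)"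
      by (intro has_derivative_inner deriv_F' p)
    moreover have "((\<lambda>x. s\<^sup>2 * ((a \<bullet> b) / (x \<bullet> x) - (a \<bullet> x) * (b \<bullet> x) / (x \<bullet> x)\<^sup>2)) has_derivative
      (\<lambda>c. - (s\<^sup>2 * (a \<bullet> b) * 2 * (p \<bullet> c)))) (at p)"
      using p t by (auto intro!: derivative_eq_intros simp: norm_eq_1 inner_commute fun_eq_iff)
    then have "((\<lambda>x. F' x a \<bullet> F' x b) has_derivative (\<lambda>c. - (s\<^sup>2 * (a \<bullet> b) * 2 * (p \<bullet> c)))) (at p)"
      by (rule has_derivative_transform_within_open[OF _ open_K p(1)]) (simp add: conformal_cone)
    ultimately have "(\<lambda>c. F' p a \<bullet> F'' p b c + F'' p a c \<bullet> F' p b) = (\<lambda>c. - (s\<^sup>2 * (a \<bullet> b) * 2 * (p \<bullet> c)))"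
      by (rule has_derivative_unique)
    from fun_cong[OF this, of c] show ?thesis using t by (simp add: inner_commute)
  qed
  define T where "T a b c = F' p a \<bullet> F'' p b c" for a b c
  have A: "T a b c = - T b a c" if "a \<bullet> p = 0" "b \<bullet> p = 0" "c \<bullet> p = 0" for a b c
    using anti[OF that] by (simp add: T_def inner_commute)
  have S: "T a b c = T a c b" for a b c using F''_symmetric p by (simp add: T_def)
  have "T a b c = - T a b c"
    using A[of a b c] A[of a c b] A[of b c a] S[of a b c] S[of b a c] S[of c a b] t by linarith
  then show ?thesis by (simp add: T_def)
qed

text \<open>The tangential components vanish by \<open>conformal_F''_normal\<close>, and
  differentiating \<open>F' y u \<bullet> F y = 0\<close> gives the normal one. As
  \<open>F' p\<close> is injective on the tangent plane, these are all components.\<close>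

lemma conformal_F'':
  assumes p: "p \<in> K" "norm p = 1" and u: "norm u = 1" "u \<bullet> p = 0"
  shows "F'' p u u = - (s\<^sup>2 *\<^sub>R F p)"
proof -
  define v where "v = cross3 p u"
  have tr: "orthonormal_triple p u v"
    unfolding v_def using p u by (intro orthonormal_triple_cross3) (auto simp: inner_commute)
  note o = orthonormal_tripleD[OF tr]
  have F'': "F'' p u u \<bullet> F p = - s\<^sup>2"
  proof -
    have "((\<lambda>y. F' y u \<bullet> F y) has_derivative (\<lambda>w. F' p u \<bullet> F' p w + F'' p u w \<bullet> F p)) (at p)"
      by (intro has_derivative_inner deriv_F deriv_F' p)
    moreover have "((\<lambda>y. F' y u \<bullet> F y) has_derivative (\<lambda>w. 0)) (at p)"
      by (rule has_derivative_transform_within_open[OF has_derivative_const[of 0] open_K p(1)])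
        (simp add: F'_orthogonal)
    ultimately have "(\<lambda>w. F' p u \<bullet> F' p w + F'' p u w \<bullet> F p) = (\<lambda>w. 0)" by (rule has_derivative_unique)
    from fun_cong[OF this, of u] show ?thesis using conformal[OF p] o by simp
  qed
  have "orthonormal_triple (F p) (F' p u /\<^sub>R s) (F' p v /\<^sub>R s)"
    unfolding orthonormal_triple_def norm_eq_1
    using conformal[OF p, of u u] conformal[OF p, of v v] conformal[OF p, of u v]
      F'_orthogonal[OF p(1)] norm_F[OF p(1)] s o
    by (simp add: inner_commute norm_eq_1 power2_eq_square field_simps)
  then have "F'' p u u + s\<^sup>2 *\<^sub>R F p = 0"
    by (rule orthonormal_triple_orthogonal_imp_0)
      (use conformal_F''_normal[OF p] F'_orthogonal[OF p(1)] F'' norm_F[OF p(1)] o in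
        \<open>auto simp: inner_simps inner_commute norm_eq_1\<close>)
  then show ?thesis by (simp add: eq_neg_iff_add_eq_0)
qed

text \<open>Along the great circle \<open>c\<close> the second derivative of \<open>F (c t)\<close>
  is \<open>F''\<close> on the velocity plus \<open>F'\<close> on the acceleration
  \<open>- c t\<close>, and the latter vanishes because \<open>F\<close> is constant on rays. What
  remains is the oscillator equation of frequency \<open>s\<close>.\<close>

lemma conformal_great_circle:
  assumes p: "p \<in> K" "norm p = 1" and u: "norm u = 1" "u \<bullet> p = 0"
    and K: "\<And>t. \<bar>t\<bar> < \<delta> \<Longrightarrow> cos t *\<^sub>R p + sin t *\<^sub>R u \<in> K" and t: "\<bar>t\<bar> < \<delta>"
  shows "F (cos t *\<^sub>R p + sin t *\<^sub>R u) = cos (s * t) *\<^sub>R F p + (sin (s * t) / s) *\<^sub>R F' p u"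
proof -
  define c where "c t = cos t *\<^sub>R p + sin t *\<^sub>R u" for t
  define c' where "c' t = - sin t *\<^sub>R p + cos t *\<^sub>R u" for t
  have pp: "p \<bullet> p = 1" "u \<bullet> u = 1" "p \<bullet> u = 0" "u \<bullet> p = 0" using p u by (auto simp: norm_eq_1 inner_commute)
  have cc: "norm (c t) = 1" "norm (c' t) = 1" "c' t \<bullet> c t = 0" for t
    unfolding norm_eq_1 c_def c'_def using sin_cos_squared_add3[of t]
    by (simp_all add: inner_simps pp algebra_simps)
  have c: "(c has_derivative (\<lambda>h. h *\<^sub>R c' t)) (at t)" for t
    unfolding c_def c'_def by (auto intro!: derivative_eq_intros simp: algebra_simps fun_eq_iff)
  have lin: "linear (F' (c t))" and lin'': "linear (F'' (c t) v)" if "\<bar>t\<bar> < \<delta>" for t v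
    using K[OF that] linear_F' has_derivative_linear[OF deriv_F'] by (auto simp: c_def)
  have linc': "L (c' t) = - sin t *\<^sub>R L p + cos t *\<^sub>R L u" if "linear L" for t and L :: "real ^ 3 \<Rightarrow> real ^ 3"
    using that by (simp add: c'_def linear_add linear_scale linear_neg linear_diff)
  have g: "((\<lambda>t. F (c t)) has_derivative (\<lambda>h. h *\<^sub>R F' (c t) (c' t))) (at t)" if "\<bar>t\<bar> < \<delta>" for t
  proof -
    have "((\<lambda>t. F (c t)) has_derivative (\<lambda>h. F' (c t) (h *\<^sub>R c' t))) (at t)"
      by (rule has_derivative_compose[OF c deriv_F]) (use K[OF that] in \<open>simp add: c_def\<close>)
    then show ?thesis by (simp add: linear_scale[OF lin[OF that]])
  qed
  have F'c: "((\<lambda>t. F' (c t) v) has_derivative (\<lambda>h. h *\<^sub>R F'' (c t) v (c' t))) (at t)" if "\<bar>t\<bar> < \<delta>" for t v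
  proof -
    have "((\<lambda>t. F' (c t) v) has_derivative (\<lambda>h. F'' (c t) v (h *\<^sub>R c' t))) (at t)"
      by (rule has_derivative_compose[OF c deriv_F']) (use K[OF that] in \<open>simp add: c_def\<close>)
    then show ?thesis by (simp add: linear_scale[OF lin''[OF that]])
  qed
  \<comment> \<open>The velocity is expanded in the fixed vectors \<open>p\<close> and
    \<open>u\<close>, because the derivative of \<open>F'\<close> is given for a fixed second
    argument.\<close>
  define g' where "g' t = - sin t *\<^sub>R F' (c t) p + cos t *\<^sub>R F' (c t) u" for t
  have g'_eq: "g' t = F' (c t) (c' t)" if "\<bar>t\<bar> < \<delta>" for t
    using linc'[OF lin[OF that]] by (simp add: g'_def)
  have g': "(g' has_derivative (\<lambda>h. h *\<^sub>R - (s\<^sup>2 *\<^sub>R F (c t)))) (at t)" if t: "\<bar>t\<bar> < \<delta>" for t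
  proof -
    have Kt: "c t \<in> K" using K[OF t] by (simp add: c_def)
    have "F' (c t) (c t) = cos t *\<^sub>R F' (c t) p + sin t *\<^sub>R F' (c t) u"
      using lin[OF t] by (subst (2) c_def) (simp add: linear_add linear_scale)
    then have 1: "cos t *\<^sub>R F' (c t) p + sin t *\<^sub>R F' (c t) u = 0" using F'_radial[OF Kt] by simp
    have "F'' (c t) (c' t) (c' t) = - sin t *\<^sub>R F'' (c t) (c' t) p + cos t *\<^sub>R F'' (c t) (c' t) u"
      using linc'[OF lin''[OF t]] .
    then have 2: "- sin t *\<^sub>R F'' (c t) p (c' t) + cos t *\<^sub>R F'' (c t) u (c' t) = - (s\<^sup>2 *\<^sub>R F (c t))"
      using F''_symmetric[OF Kt] conformal_F''[OF Kt, of "c' t"] cc by simp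
    have "(g' has_derivative (\<lambda>h. h *\<^sub>R ((- sin t *\<^sub>R F'' (c t) p (c' t) + cos t *\<^sub>R F'' (c t) u (c' t))
      - (cos t *\<^sub>R F' (c t) p + sin t *\<^sub>R F' (c t) u)))) (at t)"
      unfolding g'_def by (rule derivative_eq_intros F'c[OF t] refl)+ (simp add: fun_eq_iff algebra_simps)
    then show ?thesis unfolding 1 2 by simp
  qed
  have "F (c t) \<bullet> w = (cos (s * t) *\<^sub>R F p + (sin (s * t) / s) *\<^sub>R F' p u) \<bullet> w" for w
  proof -
    have "F (c t) \<bullet> w = cos (s * t) * (F (c 0) \<bullet> w) + sin (s * t) / s * (g' 0 \<bullet> w)"
    proof (rule harmonic_oscillator[OF s _ _ t])
      fix t assume t: "\<bar>t\<bar> < \<delta>"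
      show "((\<lambda>t. F (c t) \<bullet> w) has_real_derivative g' t \<bullet> w) (at t)"
        unfolding has_field_derivative_def
        by (rule has_derivative_eq_rhs[OF has_derivative_inner_left[OF g[OF t], of w]])
          (simp add: g'_eq[OF t] fun_eq_iff)
      show "((\<lambda>t. g' t \<bullet> w) has_real_derivative - (s\<^sup>2 * (F (c t) \<bullet> w))) (at t)"
        unfolding has_field_derivative_def
        by (rule has_derivative_eq_rhs[OF has_derivative_inner_left[OF g'[OF t], of w]])
          (simp add: fun_eq_iff)
    qed
    then show ?thesis by (simp add: c_def g'_def inner_simps)
  qed
  then show ?thesis unfolding c_def[symmetric] by (metis vector_eq_rdot)
qed

text \<open>The circle of radius \<open>t\<close> about \<open>p\<close> goes to the circle of
  radius \<open>s * t\<close> about \<open>F p\<close>. The speed of the image at \<open>q\<close>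
  is \<open>s * sin t\<close> by conformality there and \<open>sin (s * t)\<close> by the explicit
  formula, which forces \<open>s = 1\<close>. Then \<open>F\<close> keeps distances along great
  circles from \<open>p\<close>, against the strict inequality \<open>decreasing\<close>.\<close>

lemma conformal_contradiction:
  assumes p: "p \<in> K" "norm p = 1"
  shows False
proof -
  obtain u v where tr: "orthonormal_triple p u v" using exists_orthonormal_triple p by blast
  note o = orthonormal_tripleD[OF tr]
  obtain r where r: "r > 0" "ball p r \<subseteq> K" using open_K p openE by blast
  \<comment> \<open>The bound \<open>r / 2\<close> keeps the arcs inside the ball, since chords are
    no longer than arcs; the other two keep \<open>t\<close> and \<open>s * t\<close> below 1, where
    sines of positive numbers are positive.\<close>
  define \<delta> where "\<delta> = min (min 1 (1 / s)) (r / 2)"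
  have \<delta>: "\<delta> > 0" "\<delta> \<le> 1" "\<delta> \<le> 1 / s" using r s by (auto simp: \<delta>_def)
  have inK: "cos t *\<^sub>R p + sin t *\<^sub>R w \<in> K" if "\<bar>t\<bar> < \<delta>" "norm w = 1" "w \<bullet> p = 0" for t w
  proof -
    have "(norm (p - (cos t *\<^sub>R p + sin t *\<^sub>R w)))\<^sup>2 = 1 - 2 * cos t + ((cos t)\<^sup>2 + (sin t)\<^sup>2)"
      unfolding power2_norm_eq_inner using that p
      by (simp add: inner_simps inner_commute norm_eq_1 algebra_simps power2_eq_square)
    also have "\<dots> = 2 - 2 * cos (2 * (t / 2))" by simp
    also have "\<dots> = (2 * \<bar>sin (t / 2)\<bar>)\<^sup>2" unfolding cos_double_sin by (simp add: power_mult_distrib)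
    finally have "norm (p - (cos t *\<^sub>R p + sin t *\<^sub>R w)) = 2 * \<bar>sin (t / 2)\<bar>"
      by (rule power2_eq_imp_eq) auto
    also have "\<dots> \<le> \<bar>t\<bar>" using abs_sin_x_le_abs_x[of "t / 2"] by simp
    also have "\<dots> < r" using that r by (simp add: \<delta>_def)
    finally have "norm (p - (cos t *\<^sub>R p + sin t *\<^sub>R w)) < r" .
    then show ?thesis using r(2) by (auto simp: dist_norm)
  qed
  have circ: "F (cos t *\<^sub>R p + sin t *\<^sub>R w) = cos (s * t) *\<^sub>R F p + (sin (s * t) / s) *\<^sub>R F' p w"
    if "\<bar>t\<bar> < \<delta>" "norm w = 1" "w \<bullet> p = 0" for t w
    by (rule conformal_great_circle[OF p that(2,3) inK that(1)]) (use that in auto)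
  have eq: "sin (s * t) = s * sin t" if t: "0 < t" "t < \<delta>" for t
  proof -
    \<comment> \<open>The initial direction turns about \<open>p\<close>. The derivative in
      \<open>\<phi>\<close> at 0 is a Jacobi field, computed once through \<open>F' q\<close> and
      once from the explicit formula \<open>circ\<close>.\<close>
    define w where "w \<phi> = cos \<phi> *\<^sub>R u + sin \<phi> *\<^sub>R v" for \<phi>
    have w: "norm (w \<phi>) = 1" "w \<phi> \<bullet> p = 0" for \<phi>
      unfolding w_def norm_eq_1 using sin_cos_squared_add3[of \<phi>]
      by (simp_all add: inner_simps o algebra_simps)
    define q where "q = cos t *\<^sub>R p + sin t *\<^sub>R u"
    have q: "q \<in> K" "norm q = 1" "v \<bullet> q = 0"
      using inK[of t u] t o sin_cos_squared_add3[of t]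
      by (auto simp: q_def norm_eq_1 inner_simps algebra_simps)
    have "((\<lambda>\<phi>. F (cos t *\<^sub>R p + sin t *\<^sub>R w \<phi>)) has_derivative (\<lambda>h. F' q (h *\<^sub>R (sin t *\<^sub>R v)))) (at 0)"
    proof (rule has_derivative_compose[where g = F and f = "\<lambda>\<phi>. cos t *\<^sub>R p + sin t *\<^sub>R w \<phi>"
          and g' = "F' q" and f' = "\<lambda>h. h *\<^sub>R (sin t *\<^sub>R v)"])
      show "((\<lambda>\<phi>. cos t *\<^sub>R p + sin t *\<^sub>R w \<phi>) has_derivative (\<lambda>h. h *\<^sub>R (sin t *\<^sub>R v))) (at 0)"
        unfolding w_def by (auto intro!: derivative_eq_intros simp: fun_eq_iff algebra_simps)
      show "(F has_derivative F' q) (at (cos t *\<^sub>R p + sin t *\<^sub>R w 0))"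
        using deriv_F[OF q(1)] by (simp add: q_def w_def)
    qed
    moreover have "(\<lambda>\<phi>. F (cos t *\<^sub>R p + sin t *\<^sub>R w \<phi>)) =
      (\<lambda>\<phi>. cos (s * t) *\<^sub>R F p + (sin (s * t) / s) *\<^sub>R (cos \<phi> *\<^sub>R F' p u + sin \<phi> *\<^sub>R F' p v))"
      using circ[OF _ w] t linear_F'[OF p(1)] by (simp add: w_def linear_add linear_scale fun_eq_iff)
    moreover have "((\<lambda>\<phi>. cos (s * t) *\<^sub>R F p + (sin (s * t) / s) *\<^sub>R (cos \<phi> *\<^sub>R F' p u + sin \<phi> *\<^sub>R F' p v))
      has_derivative (\<lambda>h. h *\<^sub>R ((sin (s * t) / s) *\<^sub>R F' p v))) (at 0)"
      using s by (auto intro!: derivative_eq_intros simp: fun_eq_iff algebra_simps)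
    ultimately have "(\<lambda>h. F' q (h *\<^sub>R (sin t *\<^sub>R v))) = (\<lambda>h. h *\<^sub>R ((sin (s * t) / s) *\<^sub>R F' p v))"
      using has_derivative_unique by (metis (no_types, lifting))
    from fun_cong[OF this, of 1] have e: "sin t *\<^sub>R F' q v = (sin (s * t) / s) *\<^sub>R F' p v"
      using linear_F'[OF q(1)] by (simp add: linear_scale)
    have n: "norm (F' q v) = s" "norm (F' p v) = s"
      unfolding norm_eq_sqrt_inner using conformal[OF q(1,2), of v v] conformal[OF p, of v v] o q s by auto
    have pos: "sin t > 0" using t \<delta> pi_gt3 by (intro sin_gt_zero) auto
    have "sin t * s = \<bar>sin (s * t)\<bar>"
      using arg_cong[OF e, of norm] n s pos by simp
    moreover have "s * t < 1" using mult_strict_left_mono[of t "1 / s" s] t \<delta>(3) s by simp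
    then have "sin (s * t) > 0" using s t pi_gt3 by (intro sin_gt_zero) auto
    ultimately show ?thesis by (simp add: mult.commute)
  qed
  have s1: "s = 1" by (rule sin_homogeneous_imp_1[OF s \<delta>(1) eq])
  define t where "t = \<delta> / 2"
  have t: "0 < t" "t < \<delta>" "t < pi" using \<delta> pi_gt3 by (auto simp: t_def)
  define q where "q = cos t *\<^sub>R p + sin t *\<^sub>R u"
  have q: "q \<in> K" "norm q = 1" "p \<bullet> q = cos t"
    using inK[of t u] t o sin_cos_squared_add3[of t] by (auto simp: q_def norm_eq_1 inner_simps algebra_simps)
  have "cos t < 1" using t cos_monotone_0_pi[of 0 t] by simp
  then have "p \<noteq> q" using q o by auto
  then have "p \<bullet> q < F p \<bullet> F q" by (intro decreasing p q)
  also have "F q = cos t *\<^sub>R F p + sin t *\<^sub>R F' p u"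
    using circ[of t u] t o s1 by (simp add: q_def norm_eq_1)
  finally show False
    using q F'_orthogonal[OF p(1), of u] norm_F[OF p(1)] by (simp add: inner_simps inner_commute norm_eq_1)
qed

end

end

section \<open>The case of two distinct singular values\<close>

lemma cross3_orthonormal_triple:
  assumes "orthonormal_triple a e (cross3 a e)"
  shows "cross3 e (cross3 a e) = a" "cross3 a (cross3 a e) = - e" "cross3 (cross3 a e) e = - a"
  using orthonormal_tripleD[OF assms] by (simp_all add: Lagrange cross_skew[of "cross3 a e" e])

text \<open>The unit field \<open>E\<close> and its rotation \<open>E2\<close> would be an orthonormal frame on a piece of the unit
  sphere with constant connection coefficients \<open>\<alpha>\<close> and \<open>\<beta>\<close>. The curvature of such a frame is
  \<open>- \<alpha>\<^sup>2 - \<beta>\<^sup>2\<close>, but the sphere has curvature \<open>1\<close>. The curvature enters as the symmetry of the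
  second derivative of \<open>E\<close>.\<close>

lemma no_frame_with_constant_coefficients:
  fixes E :: "real ^ 3 \<Rightarrow> real ^ 3" and \<alpha> \<beta> :: real
  defines "E2 \<equiv> \<lambda>x. cross3 (sgn x) (E x)"
  assumes N: "open N" "a \<in> N" "norm a = 1"
    and E_a: "norm (E a) = 1" "a \<bullet> E a = 0"
    and dE: "\<And>x. x \<in> N \<Longrightarrow> (E has_derivative E' x) (at x)"
    and form: "\<And>x w. x \<in> N \<Longrightarrow> E' x w = inverse (norm x) *\<^sub>R
      ((w \<bullet> E x) *\<^sub>R (\<alpha> *\<^sub>R E2 x - sgn x) + (w \<bullet> E2 x) *\<^sub>R (\<beta> *\<^sub>R E2 x))"
  shows False
proof -
  have sa: "sgn a = a" using N by (simp add: sgn_div_norm)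
  define e where "e = E a"
  define f where "f = cross3 a e"
  have tr: "orthonormal_triple a e f" unfolding f_def e_def using N E_a by (intro orthonormal_triple_cross3)
  note o = orthonormal_tripleD[OF tr]
  note cr = cross3_orthonormal_triple[OF tr[unfolded f_def], folded f_def]
  have E2a: "E2 a = f" by (simp add: E2_def f_def e_def sa)
  have Ea: "E' a w = (w \<bullet> e) *\<^sub>R (\<alpha> *\<^sub>R f - a) + (w \<bullet> f) *\<^sub>R (\<beta> *\<^sub>R f)" for w
    using form[OF N(2), of w] N by (simp add: E2a sa e_def)
  define s' where "s' = sgn_deriv a"
  have ds: "(sgn has_derivative s') (at a)" unfolding s'_def by (rule has_derivative_sgn) (use N in auto)
  have s'_eq: "s' w = w - (w \<bullet> a) *\<^sub>R a" for w
    using N by (simp add: s'_def sgn_deriv_def inner_commute)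
  define E2' where "E2' w = cross3 a (E' a w) + cross3 (s' w) e" for w
  have dE2: "(E2 has_derivative E2') (at a)"
  proof -
    have bb: "bounded_bilinear cross3" using bilinear_cross bilinear_conv_bounded_bilinear by blast
    show ?thesis
      unfolding E2_def E2'_def using bounded_bilinear.FDERIV[OF bb ds dE[OF N(2)]] by (simp add: sa e_def)
  qed
  define n' where "n' w = - (a \<bullet> w)" for w
  have dn: "((\<lambda>x. inverse (norm x)) has_derivative n') (at a)"
    unfolding n'_def using N by (auto intro!: derivative_eq_intros has_derivative_norm simp: fun_eq_iff sa inner_commute)
  \<comment> \<open>\<open>L v\<close> is the product rule applied to the right-hand side of
    \<open>form\<close>. This is the source of the second derivative of \<open>E\<close>, which is
    itself assumed differentiable only once.\<close>
  define L where "L v w = n' w *\<^sub>R ((v \<bullet> e) *\<^sub>R (\<alpha> *\<^sub>R f - a) + (v \<bullet> f) *\<^sub>R (\<beta> *\<^sub>R f))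
    + ((v \<bullet> E' a w) *\<^sub>R (\<alpha> *\<^sub>R f - a) + (v \<bullet> e) *\<^sub>R (\<alpha> *\<^sub>R E2' w - s' w)
      + (v \<bullet> E2' w) *\<^sub>R (\<beta> *\<^sub>R f) + (v \<bullet> f) *\<^sub>R (\<beta> *\<^sub>R E2' w))" for v w
  have dE': "((\<lambda>x. E' x v) has_derivative L v) (at a)" for v
  proof -
    have "((\<lambda>x. inverse (norm x) *\<^sub>R
      ((v \<bullet> E x) *\<^sub>R (\<alpha> *\<^sub>R E2 x - sgn x) + (v \<bullet> E2 x) *\<^sub>R (\<beta> *\<^sub>R E2 x))) has_derivative L v) (at a)"
      by (rule derivative_eq_intros dn ds dE2 dE[OF N(2)] refl)+
        (simp add: L_def fun_eq_iff N E2a sa e_def algebra_simps)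
    then show ?thesis
      by (rule has_derivative_transform_within_open[OF _ N(1,2)]) (simp add: form)
  qed
  have "L e f = L f e"
    by (rule second_derivative_symmetric[OF N(1,2) dE dE' dE'])
  moreover have E2'e: "E2' e = - \<alpha> *\<^sub>R e" "E2' f = - \<beta> *\<^sub>R e - a"
    by (simp_all add: E2'_def Ea s'_eq o cr cross_mult_right Cross3.right_diff_distrib)
  \<comment> \<open>The components along \<open>a\<close> and \<open>e\<close> agree in both orders.
    Along \<open>f\<close>, the 1 in \<open>1 + \<beta>\<^sup>2\<close> comes from the derivative of
    \<open>sgn\<close>, that is, from the curvature of the sphere.\<close>
  have "L e f = - (\<alpha> * \<beta>) *\<^sub>R e - \<alpha> *\<^sub>R a - (1 + \<beta>\<^sup>2) *\<^sub>R f"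
    unfolding L_def E2'e
    by (simp add: n'_def Ea s'_eq o inner_simps algebra_simps power2_eq_square)
  moreover have "L f e = (\<alpha> * \<alpha>) *\<^sub>R f - \<alpha> *\<^sub>R a - (\<alpha> * \<beta>) *\<^sub>R e"
    unfolding L_def E2'e
    by (simp add: n'_def Ea s'_eq o inner_simps algebra_simps power2_eq_square)
  ultimately have "(- (\<alpha> * \<beta>) *\<^sub>R e - \<alpha> *\<^sub>R a - (1 + \<beta>\<^sup>2) *\<^sub>R f) \<bullet> f = ((\<alpha> * \<alpha>) *\<^sub>R f - \<alpha> *\<^sub>R a - (\<alpha> * \<beta>) *\<^sub>R e) \<bullet> f"
    by metis
  then have "- (1 + \<beta>\<^sup>2) = \<alpha> * \<alpha>" by (simp add: inner_simps o)
  then show False by (smt (verit) zero_le_power2 zero_le_square)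
qed

lemma sgn_sgn_vector: "sgn (sgn x) = sgn x" for x :: "'a::real_normed_vector"
  by (cases "x = 0") (simp_all add: sgn_div_norm[of "sgn x"] norm_sgn)

context homogeneous_map
begin

context
  fixes a u v :: "real ^ 3" and l m :: real
  assumes a: "a \<in> K" and frame: "orthonormal_triple a u v" and diag: "F' a u \<bullet> F' a v = 0"
    and l: "F' a u \<bullet> F' a u = l" and m: "F' a v \<bullet> F' a v = m" and lm: "l \<noteq> m"
begin

text \<open>At a unit vector \<open>x\<close> with unit eigenvector \<open>e\<close> of the symmetric form \<open>F' x c \<bullet> F' x w\<close> for the
  eigenvalue \<open>l\<close>, the map \<open>Q x\<close> is \<open>l - m\<close> times the projection to the line of \<open>e\<close>. Its image gives a
  differentiable choice of \<open>e\<close>.\<close>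

definition Q :: "real ^ 3 \<Rightarrow> real ^ 3 \<Rightarrow> real ^ 3" where
  "Q x c = (x \<bullet> x) *\<^sub>R (\<Sum>b\<in>Basis. (F' x b \<bullet> F' x c) *\<^sub>R b) - m *\<^sub>R (c - ((c \<bullet> x) / (x \<bullet> x)) *\<^sub>R x)"

definition Q' :: "real ^ 3 \<Rightarrow> real ^ 3 \<Rightarrow> real ^ 3 \<Rightarrow> real ^ 3" where
  "Q' x c w = (2 * (x \<bullet> w)) *\<^sub>R (\<Sum>b\<in>Basis. (F' x b \<bullet> F' x c) *\<^sub>R b)
    + (x \<bullet> x) *\<^sub>R (\<Sum>b\<in>Basis. (F' x b \<bullet> F'' x c w + F'' x b w \<bullet> F' x c) *\<^sub>R b)
    + m *\<^sub>R (((c \<bullet> w) / (x \<bullet> x) - 2 * (c \<bullet> x) * (x \<bullet> w) / (x \<bullet> x)\<^sup>2) *\<^sub>R x + ((c \<bullet> x) / (x \<bullet> x)) *\<^sub>R w)"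

lemma norm_a: "norm a = 1" using frame by (simp add: orthonormal_triple_def)

lemma inner_F'_basis:
  assumes "x \<in> K"
  shows "(\<Sum>b\<in>Basis. (F' x b \<bullet> F' x c) *\<^sub>R b) \<bullet> w = F' x c \<bullet> F' x w"
proof -
  have "F' x w = (\<Sum>b\<in>Basis. (w \<bullet> b) *\<^sub>R F' x b)"
    using linear_sum[OF linear_F'[OF assms], of "\<lambda>b. (w \<bullet> b) *\<^sub>R b" Basis]
    by (simp add: euclidean_representation linear_scale[OF linear_F'[OF assms]])
  then show ?thesis
    by (simp add: inner_sum_left inner_sum_right inner_commute mult.commute)
qed

lemma Q_inner:
  assumes "x \<in> K"
  shows "Q x c \<bullet> w = (x \<bullet> x) * (F' x c \<bullet> F' x w) - m * (c \<bullet> w - (c \<bullet> x) * (w \<bullet> x) / (x \<bullet> x))"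
  using inner_F'_basis[OF assms, of c w] by (simp add: Q_def inner_simps inner_commute)

text \<open>The factor \<open>x \<bullet> x\<close> in \<open>Q\<close> cancels the degree -1
  homogeneity of the two occurrences of \<open>F'\<close>.\<close>

lemma Q_sgn:
  assumes "x \<in> K" shows "Q (sgn x) c = Q x c"
proof -
  have n: "norm x > 0" using assms zero_notin_K by auto
  have "Q (sgn x) c \<bullet> w = Q x c \<bullet> w" for w
    unfolding Q_inner[OF assms] Q_inner[OF sgn_in_K[OF assms]] F'_inner_scale[OF assms]
    using n by (simp add: sgn_div_norm dot_square_norm power2_eq_square field_simps)
  then show ?thesis by (metis vector_eq_rdot)
qed

lemma Q_radial: "x \<in> K \<Longrightarrow> Q x x = 0"
  using zero_notin_K by (auto simp: Q_def F'_radial)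

lemma Q_intertwine:
  assumes x: "x \<in> K" and y: "y \<in> K" and AB: "orthogonal_transformation A" "orthogonal_transformation B"
    "A x = y" "\<And>v. F' y (A v) = B (F' x v)"
  shows "Q y (A c) = A (Q x c)"
proof -
  have A: "A z \<bullet> A w = z \<bullet> w" and B: "B z \<bullet> B w = z \<bullet> w" for z w
    using AB by (auto simp: orthogonal_transformation_def)
  have yy: "y \<bullet> y = x \<bullet> x" "A z \<bullet> y = z \<bullet> x" for z using A AB(3) by metis+
  have "Q y (A c) \<bullet> A w = A (Q x c) \<bullet> A w" for w
    by (simp add: Q_inner[OF x] Q_inner[OF y] AB(4) A B yy)
  then have "Q y (A c) \<bullet> w = A (Q x c) \<bullet> w" for w
    using orthogonal_transformation_surj[OF AB(1)] by (metis surjD)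
  then show ?thesis by (metis vector_eq_rdot)
qed

text \<open>All of \<open>Q x\<close> is prescribed, not only its value at \<open>e\<close>: it has
  rank one, so for \<open>l \<noteq> m\<close> the unit vector \<open>e\<close> is determined up to
  sign.\<close>

definition eig :: "real ^ 3 \<Rightarrow> real ^ 3 \<Rightarrow> bool" where
  "eig x e \<longleftrightarrow> norm e = 1 \<and> (\<forall>c. Q x c = ((l - m) * (c \<bullet> e)) *\<^sub>R e)"

text \<open>In the frame \<open>a\<close>, \<open>u\<close>, \<open>v\<close> the form is diagonal
  with entries 0, \<open>l\<close>, \<open>m\<close>; subtracting \<open>m\<close> on the tangent
  plane leaves \<open>l - m\<close> on \<open>u\<close> alone.\<close>

lemma eig_a: "eig a u"
proof -
  note o = orthonormal_tripleD[OF frame]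
  have F': "F' a c = (c \<bullet> u) *\<^sub>R F' a u + (c \<bullet> v) *\<^sub>R F' a v" for c
  proof -
    have "F' a c = F' a ((c \<bullet> a) *\<^sub>R a + (c \<bullet> u) *\<^sub>R u + (c \<bullet> v) *\<^sub>R v)"
      using orthonormal_triple_expansion[OF frame, of c] by simp
    then show ?thesis
      by (simp add: linear_add[OF linear_F'[OF a]] linear_scale[OF linear_F'[OF a]] F'_radial[OF a])
  qed
  have "Q a c \<bullet> w = (((l - m) * (c \<bullet> u)) *\<^sub>R u) \<bullet> w" for c w
  proof -
    have "F' a c \<bullet> F' a w = l * (c \<bullet> u) * (w \<bullet> u) + m * (c \<bullet> v) * (w \<bullet> v)"
      using diag l m by (simp add: F'[of c] F'[of w] inner_simps inner_commute)
    moreover have "c \<bullet> w = (c \<bullet> a) * (w \<bullet> a) + (c \<bullet> u) * (w \<bullet> u) + (c \<bullet> v) * (w \<bullet> v)"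
      by (subst orthonormal_triple_expansion[OF frame, of w]) (simp add: inner_simps mult.commute)
    ultimately show ?thesis
      by (simp add: Q_inner[OF a] o inner_commute[of u w] algebra_simps)
  qed
  then have "Q a c = ((l - m) * (c \<bullet> u)) *\<^sub>R u" for c by (metis vector_eq_rdot)
  then show ?thesis using frame by (simp add: eig_def orthonormal_triple_def)
qed

lemma eig_unique:
  assumes "eig x e" "eig x e'" shows "e' = e \<or> e' = - e"
proof -
  have n: "norm e = 1" "norm e' = 1" using assms by (auto simp: eig_def)
  then have "Q x e' = (l - m) *\<^sub>R e'" using assms(2) by (simp add: eig_def norm_eq_1)
  moreover have "Q x e' = (l - m) *\<^sub>R ((e' \<bullet> e) *\<^sub>R e)" using assms(1) by (simp add: eig_def)
  ultimately have e': "e' = (e' \<bullet> e) *\<^sub>R e" using lm by (metis scaleR_cancel_left right_minus_eq)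
  then have "\<bar>e' \<bullet> e\<bar> = 1" using n by (metis norm_scaleR mult.right_neutral)
  then show ?thesis using e' by (metis abs_eq_iff abs_1 scaleR_one scaleR_minus1_left)
qed

lemma eig_tangent:
  assumes "x \<in> K" "eig x e" shows "x \<bullet> e = 0"
proof -
  have "((l - m) * (x \<bullet> e)) *\<^sub>R e = 0" using assms Q_radial by (metis eig_def)
  moreover have "e \<noteq> 0" using assms by (auto simp: eig_def)
  ultimately show ?thesis using lm by simp
qed

lemma eig_intertwine:
  assumes x: "x \<in> K" and y: "y \<in> K" and AB: "orthogonal_transformation A" "orthogonal_transformation B"
    "A x = y" "\<And>v. F' y (A v) = B (F' x v)" and e: "eig x e"
  shows "eig y (A e)"
proof -
  interpret A: linear A using AB by (simp add: orthogonal_transformation_def)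
  have A: "A z \<bullet> A w = z \<bullet> w" for z w using AB by (auto simp: orthogonal_transformation_def)
  have "Q y c = ((l - m) * (c \<bullet> A e)) *\<^sub>R A e" for c
  proof -
    obtain c' where "c = A c'" using orthogonal_transformation_surj[OF AB(1)] by (metis surjD)
    then show ?thesis using e Q_intertwine[OF x y AB, of c'] by (simp add: eig_def A.scale A)
  qed
  moreover have "norm (A e) = 1" using e A by (simp add: eig_def norm_eq_1)
  ultimately show ?thesis by (simp add: eig_def)
qed

lemma has_derivative_Q:
  assumes "x \<in> K" shows "((\<lambda>y. Q y c) has_derivative Q' x c) (at x)"
proof -
  have "x \<bullet> x \<noteq> 0" using assms zero_notin_K by auto
  then show ?thesis
    unfolding Q_def
    by (auto intro!: derivative_eq_intros deriv_F' assms
        simp: Q'_def fun_eq_iff inner_commute power2_eq_square field_simps)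
qed

lemma continuous_F': "continuous_on K (\<lambda>x. F' x w)"
  using deriv_F' by (meson continuous_at_imp_continuous_on has_derivative_continuous)

lemma continuous_Q: "continuous_on K (\<lambda>x. Q x c)"
  using has_derivative_Q by (meson continuous_at_imp_continuous_on has_derivative_continuous)

lemma continuous_Q': "continuous_on K (\<lambda>x. Q' x c w)"
  unfolding Q'_def by (intro continuous_intros continuous_F' continuous_F'') (use zero_notin_K in auto)

text \<open>The points whose eigenline is not orthogonal to \<open>u\<close>: there
  \<open>Q x u\<close> is a nonzero vector in the eigenline, and normalizing it also fixes a
  sign.\<close>

definition G :: "(real ^ 3) set" where "G = {x \<in> K. Q x u \<noteq> 0}"

definition E :: "real ^ 3 \<Rightarrow> real ^ 3" where "E x = sgn (Q x u)"

definition E' :: "real ^ 3 \<Rightarrow> real ^ 3 \<Rightarrow> real ^ 3" where "E' x w = sgn_deriv (Q x u) (Q' x u w)"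

lemma open_G: "open G"
proof -
  have "G = K \<inter> (\<lambda>x. Q x u) -` (- {0})" by (auto simp: G_def)
  moreover have "open (K \<inter> (\<lambda>x. Q x u) -` (- {0}))"
    by (intro continuous_open_preimage continuous_Q open_K) auto
  ultimately show ?thesis by simp
qed

lemma G_sub: "x \<in> G \<Longrightarrow> x \<in> K" and G_ne: "x \<in> G \<Longrightarrow> x \<noteq> 0" using zero_notin_K by (auto simp: G_def)

lemma sgn_G: "x \<in> G \<Longrightarrow> sgn x \<in> G" by (simp add: G_def sgn_in_K Q_sgn)

lemma E_sgn: "x \<in> G \<Longrightarrow> E (sgn x) = E x" by (simp add: E_def G_def Q_sgn)

lemma a_G: "a \<in> G"
  using eig_a a lm frame by (auto simp: G_def eig_def orthonormal_triple_def norm_eq_1)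

lemma norm_E: "x \<in> G \<Longrightarrow> norm (E x) = 1" by (simp add: E_def G_def norm_sgn)

text \<open>There is an eigenline at \<open>x\<close> because a symmetry carrying \<open>a\<close>
  to \<open>x\<close> transports \<open>u\<close>; the vector \<open>Q x u\<close> lies in
  it.\<close>

lemma eig_E:
  assumes "x \<in> G" "norm x = 1" shows "eig x (E x)"
proof -
  obtain A B where AB: "orthogonal_transformation A" "orthogonal_transformation B" "A a = x"
    "\<And>v. F' x (A v) = B (F' a v)"
    using transitive[OF a G_sub[OF assms(1)] norm_a assms(2)] by metis
  define e where "e = A u"
  have e: "eig x e" unfolding e_def by (rule eig_intertwine[OF a G_sub[OF assms(1)] AB eig_a])
  define r where "r = (l - m) * (u \<bullet> e)"
  have q: "Q x u = r *\<^sub>R e" using e by (simp add: eig_def r_def)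
  then have "r \<noteq> 0" using assms by (auto simp: G_def)
  have "sgn e = e" using e by (simp add: eig_def sgn_div_norm)
  then have "E x = sgn r *\<^sub>R e" unfolding E_def q by (simp add: sgn_scaleR)
  then have "E x = e \<or> E x = - e" using \<open>r \<noteq> 0\<close> by (auto simp: sgn_real_def)
  then show ?thesis using e by (auto simp: eig_def)
qed

lemma E_tangent: assumes "x \<in> G" shows "E x \<bullet> x = 0"
proof -
  have "sgn x \<bullet> E (sgn x) = 0"
    using eig_tangent[OF G_sub eig_E] sgn_G[OF assms] G_ne[OF assms] by (simp add: norm_sgn)
  then have "sgn x \<bullet> E x = 0" unfolding E_sgn[OF assms] .
  then show ?thesis using G_ne[OF assms] by (simp add: sgn_div_norm inner_commute)
qed

lemma has_derivative_E: assumes "x \<in> G" shows "(E has_derivative E' x) (at x)"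
  unfolding E_def E'_def
  by (rule has_derivative_compose[OF has_derivative_Q has_derivative_sgn]) (use assms in \<open>auto simp: G_def\<close>)

lemma linear_E': "x \<in> G \<Longrightarrow> linear (E' x)" using has_derivative_E has_derivative_linear by blast

lemma continuous_E: "continuous_on G E"
  using has_derivative_E by (meson continuous_at_imp_continuous_on has_derivative_continuous)

lemma continuous_E': "continuous_on G (\<lambda>x. E' x w)"
proof -
  have "G \<subseteq> K" by (auto simp: G_def)
  then show ?thesis
    unfolding E'_def sgn_deriv_def
    by (intro continuous_intros continuous_on_subset[OF continuous_Q] continuous_on_subset[OF continuous_Q'])
      (auto simp: G_def)
qed

lemma E'_orthogonal: assumes x: "x \<in> G" shows "E' x w \<bullet> E x = 0"
proof -
  have "((\<lambda>y. E y \<bullet> E y) has_derivative (\<lambda>v. E x \<bullet> E' x v + E' x v \<bullet> E x)) (at x)"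
    by (intro has_derivative_inner has_derivative_E x)
  moreover have "((\<lambda>y. E y \<bullet> E y) has_derivative (\<lambda>v. 0)) (at x)"
    by (rule has_derivative_transform_within_open[OF has_derivative_const[of 1] open_G x])
      (metis norm_E norm_eq_1)
  ultimately have "(\<lambda>v. E x \<bullet> E' x v + E' x v \<bullet> E x) = (\<lambda>v. 0)" by (rule has_derivative_unique)
  from fun_cong[OF this, of w] show ?thesis by (simp add: inner_commute)
qed

lemma E'_normal: assumes x: "x \<in> G" shows "E' x w \<bullet> x = - (w \<bullet> E x)"
proof -
  have "((\<lambda>y. E y \<bullet> y) has_derivative (\<lambda>v. E x \<bullet> v + E' x v \<bullet> x)) (at x)"
    by (intro has_derivative_inner has_derivative_E x has_derivative_ident)
  moreover have "((\<lambda>y. E y \<bullet> y) has_derivative (\<lambda>v. 0)) (at x)"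
    by (rule has_derivative_transform_within_open[OF has_derivative_const[of 0] open_G x])
      (simp add: E_tangent)
  ultimately have "(\<lambda>v. E x \<bullet> v + E' x v \<bullet> x) = (\<lambda>v. 0)" by (rule has_derivative_unique)
  from fun_cong[OF this, of w] show ?thesis by (simp add: inner_commute)
qed

lemma scale_G: "x \<in> G \<Longrightarrow> t > 0 \<Longrightarrow> t *\<^sub>R x \<in> G"
  and scale_E: "x \<in> G \<Longrightarrow> t > 0 \<Longrightarrow> E (t *\<^sub>R x) = E x"
proof -
  assume x: "x \<in> G" and t: "t > 0"
  have "sgn (t *\<^sub>R x) = sgn x" using t by (simp add: sgn_scaleR)
  then have "Q (t *\<^sub>R x) c = Q x c" for c
    using Q_sgn[OF scale_K[OF G_sub[OF x] t]] Q_sgn[OF G_sub[OF x]] by metis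
  then show "t *\<^sub>R x \<in> G" "E (t *\<^sub>R x) = E x"
    using x scale_K[OF G_sub[OF x] t] by (auto simp: G_def E_def)
qed

lemma E'_scale:
  assumes x: "x \<in> G" and t: "t > 0" shows "E' (t *\<^sub>R x) w = E' x w /\<^sub>R t"
proof -
  have "((\<lambda>y. E (t *\<^sub>R y)) has_derivative (\<lambda>w. E' (t *\<^sub>R x) (t *\<^sub>R w))) (at x)"
    by (rule has_derivative_compose[where f = "\<lambda>y. t *\<^sub>R y" and g = E])
      (use has_derivative_E[OF scale_G[OF x t]] in \<open>auto intro!: derivative_eq_intros\<close>)
  moreover have "((\<lambda>y. E (t *\<^sub>R y)) has_derivative E' x) (at x)"
    by (rule has_derivative_transform_within_open[OF has_derivative_E[OF x] open_G x]) (simp add: scale_E t)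
  ultimately have "(\<lambda>w. E' (t *\<^sub>R x) (t *\<^sub>R w)) = E' x" by (rule has_derivative_unique)
  from fun_cong[OF this, of "w /\<^sub>R t"] show ?thesis
    using t linear_scale[OF linear_E'[OF x], of "inverse t" w] by simp
qed

lemma E'_radial: assumes x: "x \<in> G" shows "E' x x = 0"
proof -
  have "((\<lambda>t. E (t *\<^sub>R x)) has_derivative (\<lambda>t. E' x (t *\<^sub>R x))) (at 1)"
    by (rule has_derivative_compose[where f = "\<lambda>t. t *\<^sub>R x" and g = E])
      (use has_derivative_E[OF x] in \<open>auto intro!: derivative_eq_intros\<close>)
  moreover have "((\<lambda>t. E (t *\<^sub>R x)) has_derivative (\<lambda>t. 0)) (at 1)"
    by (rule has_derivative_transform_within_open[OF has_derivative_const[of "E x"], of "{0<..}"])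
      (use scale_E[OF x] in auto)
  ultimately have "(\<lambda>t. E' x (t *\<^sub>R x)) = (\<lambda>t. 0)" by (rule has_derivative_unique)
  from fun_cong[OF this, of 1] show ?thesis by simp
qed

text \<open>The eigenline is preserved by the local symmetries, and the sign in the transformation of \<open>E\<close>
  is locally constant by continuity.\<close>

lemma E'_intertwine:
  assumes y: "y \<in> G" "norm y = 1"
  obtains A \<epsilon> where "orthogonal_transformation A" "A a = y" "\<bar>\<epsilon>\<bar> = 1" "E y = \<epsilon> *\<^sub>R A (E a)"
    "\<And>w. E' y (A w) = \<epsilon> *\<^sub>R A (E' a w)"
proof -
  obtain A B N where AB: "orthogonal_transformation A" "orthogonal_transformation B" "open N" "a \<in> N"
    "N \<subseteq> K" "A ` N \<subseteq> K" "A a = y" "\<forall>z\<in>N. F (A z) = B (F z)"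
    using transitive[OF a G_sub[OF y(1)] norm_a y(2)] by metis
  have A: "A z \<bullet> A w = z \<bullet> w" for z w using AB by (auto simp: orthogonal_transformation_def)
  have nA: "norm (A z) = norm z" for z using A by (simp add: norm_eq_sqrt_inner)
  have blA: "bounded_linear A" using AB(1) by (simp add: linear_linear orthogonal_transformation_def)
  interpret A: bounded_linear A by (rule blA)
  \<comment> \<open>Near \<open>a\<close>, both \<open>E (A z)\<close> and \<open>A (E z)\<close>
    are unit vectors in the same eigenline, so \<open>r z\<close> is a sign; a variation below 1
    then makes it constant.\<close>
  define r where "r z = E (A z) \<bullet> A (E z)" for z
  have contA: "isCont A z" for z by (simp add: A.isCont)
  have contr: "isCont r a"
  proof -
    have "isCont E a" "isCont E (A a)"
      using continuous_E open_G a_G y AB(7) by (auto simp: continuous_on_eq_continuous_at)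
    then show ?thesis unfolding r_def
      by (intro continuous_intros isCont_o2[of a A E] isCont_o2[of a E A] contA)
  qed
  have "\<forall>\<^sub>F z in nhds a. z \<in> G" using open_G a_G by (rule eventually_nhds_in_open)
  moreover have "\<forall>\<^sub>F z in nhds a. A z \<in> G"
    using topological_tendstoD[OF contA[of a, unfolded isCont_def tendsto_at_iff_tendsto_nhds] open_G] y AB(7) by simp
  \<comment> \<open>Eigenlines are compared at unit vectors, so it is \<open>sgn z\<close> that has
    to lie in \<open>N\<close>.\<close>
  moreover have "\<forall>\<^sub>F z in nhds a. sgn z \<in> N"
  proof -
    have "isCont sgn a" by (intro continuous_intros) (use norm_a in auto)
    then have "(sgn \<longlongrightarrow> sgn a) (nhds a)" by (simp only: isCont_def tendsto_at_iff_tendsto_nhds)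
    moreover have "sgn a = a" using norm_a by (simp add: sgn_div_norm)
    ultimately show ?thesis using topological_tendstoD[of sgn a "nhds a" N] AB(3,4) by simp
  qed
  moreover have "\<forall>\<^sub>F z in nhds a. \<bar>r z - r a\<bar> < 1"
    using tendstoD[OF contr[unfolded isCont_def tendsto_at_iff_tendsto_nhds], of 1] by (simp add: dist_real_def)
  ultimately have ev: "\<forall>\<^sub>F z in nhds a. z \<in> G \<and> A z \<in> G \<and> sgn z \<in> N \<and> \<bar>r z - r a\<bar> < 1"
    by (intro eventually_conj)
  have sign: "(E (A z) = A (E z) \<and> r z = 1) \<or> (E (A z) = - A (E z) \<and> r z = -1)"
    if z: "z \<in> G" "A z \<in> G" "sgn z \<in> N" for z
  proof -
    have sA: "sgn (A z) = A (sgn z)" by (simp add: sgn_div_norm nA A.scaleR)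
    have ns: "norm (sgn z) = 1" using G_ne[OF z(1)] by (simp add: norm_sgn)
    have "F' (A (sgn z)) (A v) = B (F' (sgn z) v)" for v
      by (rule F'_intertwine[OF AB(1-3) z(3) AB(5,6,8)])
    then have 1: "eig (A (sgn z)) (A (E (sgn z)))"
      using AB z(3) by (intro eig_intertwine[OF _ _ AB(1,2) refl _ eig_E[OF sgn_G[OF z(1)] ns]]) auto
    have 2: "eig (A (sgn z)) (E (A (sgn z)))"
      using sgn_G[OF z(2)] ns by (intro eig_E) (auto simp: sA nA)
    have 3: "E (sgn z) = E z" "E (A (sgn z)) = E (A z)"
      using E_sgn[OF z(1)] E_sgn[OF z(2)] by (auto simp: sA)
    have "A (E z) \<bullet> A (E z) = 1" using norm_E[OF z(1)] by (simp add: A norm_eq_1)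
    then show ?thesis using eig_unique[OF 1 2] unfolding 3 r_def by auto
  qed
  define \<epsilon> where "\<epsilon> = r a"
  have sa: "sgn a = a" using norm_a by (simp add: sgn_div_norm)
  have sign_a: "(E (A a) = A (E a) \<and> r a = 1) \<or> (E (A a) = - A (E a) \<and> r a = -1)"
    by (rule sign) (use a_G y AB sa in auto)
  have "\<forall>\<^sub>F z in nhds a. E (A z) = \<epsilon> *\<^sub>R A (E z)"
    using ev
  proof eventually_elim
    case (elim z)
    then show ?case using sign[of z] sign_a unfolding \<epsilon>_def by auto
  qed
  then obtain N' where N': "open N'" "a \<in> N'" "\<And>z. z \<in> N' \<Longrightarrow> E (A z) = \<epsilon> *\<^sub>R A (E z)"
    unfolding eventually_nhds by blast
  have "((\<lambda>z. E (A z)) has_derivative (\<lambda>w. E' (A a) (A w))) (at a)"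
    by (rule has_derivative_compose[OF bounded_linear.has_derivative[OF blA has_derivative_ident] has_derivative_E])
      (use y AB in simp)
  moreover have "((\<lambda>z. \<epsilon> *\<^sub>R A (E z)) has_derivative (\<lambda>w. \<epsilon> *\<^sub>R A (E' a w))) (at a)"
    by (intro has_derivative_scaleR_right bounded_linear.has_derivative[OF blA] has_derivative_E a_G)
  then have "((\<lambda>z. E (A z)) has_derivative (\<lambda>w. \<epsilon> *\<^sub>R A (E' a w))) (at a)"
    by (rule has_derivative_transform_within_open[OF _ N'(1,2)]) (simp add: N')
  ultimately have "(\<lambda>w. E' (A a) (A w)) = (\<lambda>w. \<epsilon> *\<^sub>R A (E' a w))" by (rule has_derivative_unique)
  then have "E' y (A w) = \<epsilon> *\<^sub>R A (E' a w)" for w using AB(7) by meson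
  moreover have "E y = \<epsilon> *\<^sub>R A (E a)" "\<bar>\<epsilon>\<bar> = 1" using sign_a AB(7) by (auto simp: \<epsilon>_def)
  ultimately show thesis using that AB by blast
qed

definition E2 :: "real ^ 3 \<Rightarrow> real ^ 3" where "E2 x = cross3 (sgn x) (E x)"

lemma frame_E:
  assumes "x \<in> G" shows "orthonormal_triple (sgn x) (E x) (E2 x)"
  unfolding E2_def using norm_E[OF assms] E_tangent[OF assms] G_ne[OF assms]
  by (intro orthonormal_triple_cross3) (auto simp: norm_sgn sgn_div_norm inner_commute)

text \<open>The symmetry may reverse \<open>E\<close>, and independently \<open>E2\<close>, since it
  may change the orientation of the tangent plane. Norms do not see these signs.\<close>

lemma norm_E'_constant:
  assumes y: "y \<in> G" "norm y = 1"
  shows "norm (E' y (E y)) = norm (E' a (E a))" "norm (E' y (E2 y)) = norm (E' a (E2 a))"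
proof -
  obtain A \<epsilon> where A: "orthogonal_transformation A" "A a = y" "\<bar>\<epsilon>\<bar> = 1" "E y = \<epsilon> *\<^sub>R A (E a)"
    "\<And>w. E' y (A w) = \<epsilon> *\<^sub>R A (E' a w)" using E'_intertwine[OF y] by metis
  interpret E': linear "E' y" by (rule linear_E'[OF y(1)])
  have iA: "A z \<bullet> A w = z \<bullet> w" for z w using A by (auto simp: orthogonal_transformation_def)
  have nA: "norm (A z) = norm z" for z using iA by (simp add: norm_eq_sqrt_inner)
  have s: "sgn a = a" "sgn y = y" using norm_a y by (auto simp: sgn_div_norm)
  show "norm (E' y (E y)) = norm (E' a (E a))"
    using A(3) abs_mult_self_eq[of \<epsilon>] by (simp add: A(4,5) E'.scale nA)
  note oy = orthonormal_tripleD[OF frame_E[OF y(1)], unfolded s]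
  note oa = orthonormal_tripleD[OF frame_E[OF a_G], unfolded s]
  define c where "c = A (E2 a) \<bullet> E2 y"
  have "\<epsilon> \<noteq> 0" using A(3) by auto
  then have AE: "A (E a) = inverse \<epsilon> *\<^sub>R E y" using A(4) by simp
  have "A (E2 a) \<bullet> E y = 0" using A(4) oa iA by simp
  moreover have "A (E2 a) \<bullet> y = 0" using A(2) oa iA by metis
  ultimately have c: "A (E2 a) = c *\<^sub>R E2 y"
    using orthonormal_triple_expansion[OF frame_E[OF y(1)], of "A (E2 a)"] s by (simp add: c_def)
  have "\<bar>c\<bar> = 1"
    using arg_cong[OF c, of norm] oa oy by (simp add: iA norm_eq_sqrt_inner)
  then show "norm (E' y (E2 y)) = norm (E' a (E2 a))"
    using A(5)[of "E2 a"] A(3) unfolding c E'.scale by (metis nA norm_scaleR mult_1)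
qed

text \<open>The connection coefficients of the frame: the \<open>E2\<close>-components of the
  derivatives of \<open>E\<close> along \<open>E\<close> and along \<open>E2\<close>. The factor
  \<open>norm x\<close> makes them constant on rays.\<close>

definition \<alpha> :: "real ^ 3 \<Rightarrow> real" where "\<alpha> x = norm x * (E' x (E x) \<bullet> E2 x)"
definition \<beta> :: "real ^ 3 \<Rightarrow> real" where "\<beta> x = norm x * (E' x (E2 x) \<bullet> E2 x)"

lemma E'_sgn:
  assumes "x \<in> G" shows "E' (sgn x) w = norm x *\<^sub>R E' x w"
  using E'_scale[OF assms, of "inverse (norm x)" w] G_ne[OF assms] by (simp add: sgn_div_norm)

lemma E2_sgn: "x \<in> G \<Longrightarrow> E2 (sgn x) = E2 x" by (simp add: E2_def E_sgn sgn_sgn_vector)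

text \<open>At a unit point the derivative of \<open>E\<close> has no component along
  \<open>E\<close>, and its radial component is -1 in the direction \<open>E\<close> and 0 in the
  direction \<open>E2\<close>. What is left of the constant squared norm is the square of the
  coefficient.\<close>

lemma squares_constant:
  assumes x: "x \<in> G"
  shows "(\<alpha> x)\<^sup>2 = (norm (E' a (E a)))\<^sup>2 - 1" "(\<beta> x)\<^sup>2 = (norm (E' a (E2 a)))\<^sup>2"
proof -
  define y where "y = sgn x"
  have y: "y \<in> G" "norm y = 1" "sgn y = y" using sgn_G x G_ne[OF x] by (auto simp: y_def norm_sgn sgn_sgn_vector)
  have \<alpha>: "\<alpha> x = E' y (E y) \<bullet> E2 y" and \<beta>: "\<beta> x = E' y (E2 y) \<bullet> E2 y"
    using x by (simp_all add: \<alpha>_def \<beta>_def y_def E'_sgn E2_sgn E_sgn)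
  note o = orthonormal_tripleD[OF frame_E[OF y(1)], unfolded y(3)]
  note n = orthonormal_triple_norm[OF frame_E[OF y(1)], unfolded y(3)]
  show "(\<alpha> x)\<^sup>2 = (norm (E' a (E a)))\<^sup>2 - 1" "(\<beta> x)\<^sup>2 = (norm (E' a (E2 a)))\<^sup>2"
    unfolding norm_E'_constant[OF y(1,2), symmetric] power2_norm_eq_inner
      n[of "E' y (E y)"] n[of "E' y (E2 y)"] \<alpha> \<beta>
    by (simp_all add: E'_orthogonal[OF y(1)] E'_normal[OF y(1)] o)
qed

lemma continuous_E2: "continuous_on G E2"
  unfolding E2_def by (intro continuous_on_cross continuous_intros continuous_E) (use G_ne in auto)

lemma continuous_E'_field:
  assumes "continuous_on G f" shows "continuous_on G (\<lambda>x. E' x (f x))"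
proof -
  have "E' x w = (\<Sum>b\<in>Basis. (w \<bullet> b) *\<^sub>R E' x b)" if "x \<in> G" for x w
    using linear_sum[OF linear_E'[OF that], of "\<lambda>b. (w \<bullet> b) *\<^sub>R b" Basis]
    by (simp add: euclidean_representation linear_scale[OF linear_E'[OF that]])
  moreover have "continuous_on G (\<lambda>x. \<Sum>b\<in>Basis. (f x \<bullet> b) *\<^sub>R E' x b)"
    by (intro continuous_intros assms continuous_E')
  ultimately show ?thesis by (simp cong: continuous_on_cong)
qed

text \<open>The squares leave at most two values, and a continuous function with finite range on a
  connected set is constant.\<close>

lemma constant_coefficients:
  assumes "connected N" "N \<subseteq> G" "a \<in> N" "x \<in> N"
  shows "\<alpha> x = \<alpha> a" "\<beta> x = \<beta> a"
proof -
  have const: "f x = f a" if "continuous_on G f" "\<And>x. x \<in> G \<Longrightarrow> (f x)\<^sup>2 = k" for f :: "real ^ 3 \<Rightarrow> real" and k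
  proof -
    have "f ` N \<subseteq> {sqrt k, - sqrt k}"
      using that(2) assms(2) by (auto simp: real_sqrt_abs[symmetric] abs_real_def split: if_splits)
        (smt (verit) real_sqrt_abs subsetD)
    then have "finite (f ` N)" by (rule finite_subset) simp
    then have "f constant_on N"
      by (intro continuous_finite_range_constant assms continuous_on_subset[OF that(1)])
    then show ?thesis using assms unfolding constant_on_def by metis
  qed
  have "continuous_on G \<alpha>" "continuous_on G \<beta>"
    unfolding \<alpha>_def \<beta>_def by (intro continuous_intros continuous_E'_field continuous_E continuous_E2)+
  then show "\<alpha> x = \<alpha> a" "\<beta> x = \<beta> a" using const squares_constant by blast+
qed

text \<open>The radial derivative of \<open>E\<close> vanishes, and unit length and tangency of
  \<open>E\<close> fix its components along \<open>E\<close> and the radius, so the two coefficients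
  determine the rest. Once they are constant, this is the hypothesis \<open>form\<close> of
  \<open>no_frame_with_constant_coefficients\<close>.\<close>

lemma E'_expansion:
  assumes x: "x \<in> G"
  shows "E' x w = inverse (norm x) *\<^sub>R
    ((w \<bullet> E x) *\<^sub>R (\<alpha> x *\<^sub>R E2 x - sgn x) + (w \<bullet> E2 x) *\<^sub>R (\<beta> x *\<^sub>R E2 x))"
proof -
  have n: "norm x > 0" using G_ne[OF x] by simp
  interpret E': linear "E' x" by (rule linear_E'[OF x])
  note fr = frame_E[OF x]
  note o = orthonormal_tripleD[OF fr]
  have "E' x (sgn x) = 0" using E'_radial[OF x] by (simp add: sgn_div_norm E'.scale)
  then have 1: "E' x w = (w \<bullet> E x) *\<^sub>R E' x (E x) + (w \<bullet> E2 x) *\<^sub>R E' x (E2 x)"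
    by (subst orthonormal_triple_expansion[OF fr, of w]) (simp add: E'.add E'.scale)
  have 2: "E' x w \<bullet> sgn x = - (w \<bullet> E x) / norm x" for w
    using E'_normal[OF x, of w] by (simp add: sgn_div_norm field_simps)
  have "E' x (E x) = inverse (norm x) *\<^sub>R (\<alpha> x *\<^sub>R E2 x - sgn x)"
    using n by (subst orthonormal_triple_expansion[OF fr, of "E' x (E x)"])
      (simp add: 2 E'_orthogonal[OF x] o \<alpha>_def scaleR_right_diff_distrib inverse_eq_divide)
  moreover have "E' x (E2 x) = inverse (norm x) *\<^sub>R (\<beta> x *\<^sub>R E2 x)"
    using n by (subst orthonormal_triple_expansion[OF fr, of "E' x (E2 x)"])
      (simp add: 2 E'_orthogonal[OF x] o \<beta>_def)
  ultimately show ?thesis unfolding 1 by (simp add: scaleR_right_distrib mult.commute)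
qed

lemma distinct_singular_values_contradiction: False
proof -
  obtain r where r: "r > 0" "ball a r \<subseteq> G" using open_G a_G openE by blast
  show False
  proof (rule no_frame_with_constant_coefficients[of "ball a r" a E E' "\<alpha> a" "\<beta> a"])
    show "norm (E a) = 1" "a \<bullet> E a = 0"
      using norm_E[OF a_G] E_tangent[OF a_G] by (auto simp: inner_commute)
    show "(E has_derivative E' x) (at x)" if "x \<in> ball a r" for x
      using has_derivative_E r that by blast
    show "E' x w = inverse (norm x) *\<^sub>R
      ((w \<bullet> E x) *\<^sub>R (\<alpha> a *\<^sub>R cross3 (sgn x) (E x) - sgn x)
        + (w \<bullet> cross3 (sgn x) (E x)) *\<^sub>R (\<beta> a *\<^sub>R cross3 (sgn x) (E x)))"
      if x: "x \<in> ball a r" for x w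
    proof -
      have "\<alpha> x = \<alpha> a" "\<beta> x = \<beta> a"
        using constant_coefficients[of "ball a r" x] r x by auto
      then show ?thesis using E'_expansion[of x w] r(2) x by (auto simp: E2_def)
    qed
  qed (use r norm_a in auto)
qed

end

end

section \<open>Constancy of homogeneous distance-decreasing maps\<close>

lemma (in homogeneous_map) F_constant:
  assumes x: "x \<in> K" and y: "y \<in> K"
  shows "F x = F y"
proof -
  define a where "a = sgn x"
  have a: "a \<in> K" "norm a = 1" using sgn_in_K[OF x] x zero_notin_K by (auto simp: a_def norm_sgn)
  obtain u v where fr: "orthonormal_triple a u v" and diag: "F' a u \<bullet> F' a v = 0"
    using linear_diagonalizing_frame[OF linear_F'[OF a(1)] a(2)] by metis
  note o = orthonormal_tripleD[OF fr]
  define l where "l = F' a u \<bullet> F' a u"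
  have m: "F' a v \<bullet> F' a v = l"
    using distinct_singular_values_contradiction[OF a(1) fr diag] unfolding l_def by metis
  have metric_a: "F' a c \<bullet> F' a w = l * (c \<bullet> w - (c \<bullet> a) * (w \<bullet> a))" for c w
  proof -
    have F': "F' a c = (c \<bullet> u) *\<^sub>R F' a u + (c \<bullet> v) *\<^sub>R F' a v" for c
      by (subst orthonormal_triple_expansion[OF fr, of c])
        (simp add: linear_add[OF linear_F'[OF a(1)]] linear_scale[OF linear_F'[OF a(1)]] F'_radial[OF a(1)])
    have "c \<bullet> w = (c \<bullet> a) * (w \<bullet> a) + (c \<bullet> u) * (w \<bullet> u) + (c \<bullet> v) * (w \<bullet> v)"
      by (subst orthonormal_triple_expansion[OF fr, of w]) (simp add: inner_simps mult.commute)
    then show ?thesis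
      using diag m by (simp add: F'[of c] F'[of w] inner_simps inner_commute[of "F' a v" "F' a u"]
          l_def[symmetric] algebra_simps)
  qed
  have metric: "F' z c \<bullet> F' z w = l * (c \<bullet> w - (c \<bullet> z) * (w \<bullet> z))" if z: "z \<in> K" "norm z = 1" for z c w
  proof -
    obtain A B where AB: "orthogonal_transformation A" "orthogonal_transformation B" "A a = z"
      "\<And>v. F' z (A v) = B (F' a v)" using transitive[OF a(1) z(1) a(2) z(2)] by metis
    obtain c' w' where cw: "c = A c'" "w = A w'" using orthogonal_transformation_surj[OF AB(1)] by (metis surjD)
    have A: "A p \<bullet> A q = p \<bullet> q" and B: "B p \<bullet> B q = p \<bullet> q" for p q
      using AB by (auto simp: orthogonal_transformation_def)
    show ?thesis unfolding cw AB(4) B metric_a unfolding AB(3)[symmetric] A ..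
  qed
  have "\<not> l > 0"
  proof
    assume "l > 0"
    then show False
      using conformal_contradiction[of "sqrt l" a] metric a by (simp add: real_sqrt_pow2)
  qed
  moreover have "l \<ge> 0" by (simp add: l_def)
  ultimately have "l = 0" by simp
  have "F' z w = 0" if z: "z \<in> K" for z w
    using F'_inner_scale[OF z, of w w] metric[OF sgn_in_K[OF z], of w w] z zero_notin_K \<open>l = 0\<close>
    by (cases "z = 0") (auto simp: norm_sgn)
  then have "(F has_derivative (\<lambda>w. 0)) (at z)" if "z \<in> K" for z
    using deriv_F[OF that] that by (metis (no_types, lifting) ext)
  then show ?thesis
    using has_derivative_zero_unique_connected[OF open_K connected_K _ x y] by blast
qed

lemma distance_decreasing_inner:
  fixes f :: "real ^ 3 \<Rightarrow> real ^ 3"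
  assumes "distance_decreasing_on V f" "f ` V \<subseteq> S2" "V \<subseteq> S2" "a \<in> V" "b \<in> V" "a \<noteq> b"
  shows "a \<bullet> b < f a \<bullet> f b"
proof -
  have n: "norm a = 1" "norm b = 1" "norm (f a) = 1" "norm (f b) = 1" using assms by auto
  have "arccos (f a \<bullet> f b) < arccos (a \<bullet> b)"
    using assms by (auto simp: distance_decreasing_on_def sphere_dist_def)
  moreover have "\<bar>f a \<bullet> f b\<bar> \<le> 1" "\<bar>a \<bullet> b\<bar> \<le> 1"
    using Cauchy_Schwarz_ineq2[of "f a" "f b"] Cauchy_Schwarz_ineq2[of a b] n by auto
  ultimately show ?thesis using arccos_less_mono by auto
qed

text \<open>The pointwise local symmetries of \<open>f\<close> on the sphere extend to the cone because orthogonal maps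
  commute with \<open>sgn\<close>.\<close>

theorem homogeneous_decreasing_C2_constant:
  fixes f :: "real ^ 3 \<Rightarrow> real ^ 3"
  assumes V: "openin (top_of_set S2) V" "connected V" and fV: "f ` V \<subseteq> S2"
    and C2: "C2_on V f" and dd: "distance_decreasing_on V f"
    and hom: "\<And>a b. a \<in> V \<Longrightarrow> b \<in> V \<Longrightarrow> \<exists>A B N. orthogonal_transformation A \<and> orthogonal_transformation B \<and>
      openin (top_of_set V) N \<and> a \<in> N \<and> A a = b \<and> A ` N \<subseteq> V \<and> (\<forall>x\<in>N. f (A x) = B (f x))"
    and xy: "x \<in> V" "y \<in> V"
  shows "f x = f y"
proof -
  obtain F' F'' where F:
    "\<And>x. x \<in> open_cone V \<Longrightarrow> ((\<lambda>x. f (sgn x)) has_derivative F' x) (at x)"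
    "\<And>x v. x \<in> open_cone V \<Longrightarrow> ((\<lambda>y. F' y v) has_derivative F'' x v) (at x)"
    "\<And>v w. continuous_on (open_cone V) (\<lambda>x. F'' x v w)"
    using C2_on_radial_extension[OF V(1) C2] by blast
  have VS: "V \<subseteq> S2" using openin_imp_subset[OF V(1)] by simp
  have sgnV: "sgn x = x" if "x \<in> V" for x using that VS by (auto simp: sgn_div_norm)
  have cone: "z \<in> open_cone V \<longleftrightarrow> z \<in> V" if "norm z = 1" for z
    using that by (auto simp: open_cone_def sgn_div_norm)
  interpret homogeneous_map "open_cone V" "\<lambda>x. f (sgn x)" F' F''
  proof
    show "open (open_cone V)" "connected (open_cone V)" "0 \<notin> open_cone V"
      using open_open_cone[OF V(1)] connected_open_cone[OF V(2) VS] by (auto simp: open_cone_def)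
    show "t *\<^sub>R x \<in> open_cone V" "f (sgn (t *\<^sub>R x)) = f (sgn x)" if "x \<in> open_cone V" "t > 0" for x t
      using that by (auto simp: open_cone_def sgn_scaleR)
    show "norm (f (sgn x)) = 1" if "x \<in> open_cone V" for x
      using that fV by (auto simp: open_cone_def)
    show "x \<bullet> y < f (sgn x) \<bullet> f (sgn y)"
      if "x \<in> open_cone V" "y \<in> open_cone V" "norm x = 1" "norm y = 1" "x \<noteq> y" for x y
    proof -
      have "x \<in> V" "y \<in> V" using that cone by auto
      then show ?thesis using distance_decreasing_inner[OF dd fV VS] that sgnV by simp
    qed
    show "\<exists>A B N. orthogonal_transformation A \<and> orthogonal_transformation B \<and> open N \<and> x \<in> N \<and>
        N \<subseteq> open_cone V \<and> A ` N \<subseteq> open_cone V \<and> A x = y \<and> (\<forall>z\<in>N. f (sgn (A z)) = B (f (sgn z)))"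
      if "x \<in> open_cone V" "y \<in> open_cone V" "norm x = 1" "norm y = 1" for x y
    proof -
      have xy: "x \<in> V" "y \<in> V" using that cone by auto
      obtain A B N where *: "orthogonal_transformation A" "orthogonal_transformation B"
        "openin (top_of_set V) N" "x \<in> N" "A x = y" "A ` N \<subseteq> V" "\<forall>x\<in>N. f (A x) = B (f x)"
        using hom[OF xy] by blast
      have N: "openin (top_of_set S2) N" using openin_trans *(3) V(1) by blast
      have sA: "sgn (A z) = A (sgn z)" for z
        using *(1) by (simp add: orthogonal_transformation sgn_div_norm linear_scale)
      have A0: "A z = 0 \<longleftrightarrow> z = 0" for z
        using *(1) by (metis norm_eq_zero orthogonal_transformation_norm)
      show ?thesis
        by (intro exI[of _ A] exI[of _ B] exI[of _ "open_cone N"])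
          (use * xy sgnV openin_imp_subset[OF *(3)] open_open_cone[OF N] that A0
            in \<open>auto simp: open_cone_def sA\<close>)
    qed
  qed (use F in auto)
  have "f (sgn x) = f (sgn y)" by (rule F_constant) (use xy VS cone in auto)
  then show ?thesis using xy sgnV by simp
qed

section \<open>Orthogonal maps and dual 2-vectors\<close>

text \<open>\<open>A\<close> is prescribed on a basis chosen among the \<open>p i\<close>. Equality
  of the Gram matrices makes it orthogonal and gives \<open>A (p i) - q i\<close> norm zero for the
  remaining indices too, so consistency of the prescription is a conclusion.\<close>

lemma orthogonal_transformation_extending:
  fixes p q :: "'i \<Rightarrow> 'a::euclidean_space"
  assumes inner: "\<And>i j. i \<in> I \<Longrightarrow> j \<in> I \<Longrightarrow> q i \<bullet> q j = p i \<bullet> p j" and span: "span (p ` I) = UNIV"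
  obtains A where "orthogonal_transformation A" "\<And>i. i \<in> I \<Longrightarrow> A (p i) = q i"
proof -
  obtain B where B: "B \<subseteq> p ` I" "independent B" "p ` I \<subseteq> span B"
    using maximal_independent_subset by blast
  have spanB: "x \<in> span B" for x
    using span span_mono[OF B(3)] by (auto simp: span_span)
  obtain ix where ix: "\<And>b. b \<in> B \<Longrightarrow> ix b \<in> I" "\<And>b. b \<in> B \<Longrightarrow> p (ix b) = b"
    using B(1) by (metis image_iff subsetD)
  obtain A where A: "linear A" "\<And>b. b \<in> B \<Longrightarrow> A b = q (ix b)"
    using linear_independent_extend[OF B(2), of "\<lambda>b. q (ix b)"] by blast
  interpret A: linear A by fact
  have Aq: "A x \<bullet> q i = x \<bullet> p i" if "i \<in> I" for x i
    using spanB[of x]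
  proof (induction rule: span_induct_alt)
    case base then show ?case by (simp add: A.zero)
  next
    case (step c b y)
    then show ?case using inner[OF ix(1) that] ix(2) A(2) by (simp add: A.add A.scale inner_simps)
  qed
  have AA: "A x \<bullet> A y = x \<bullet> y" for x y
    using spanB[of y]
  proof (induction rule: span_induct_alt)
    case base then show ?case by (simp add: A.zero)
  next
    case (step c b y)
    then show ?case using Aq[OF ix(1)] ix(2) A(2) by (simp add: A.add A.scale inner_simps)
  qed
  have "A (p i) = q i" if "i \<in> I" for i
  proof -
    have "(A (p i) - q i) \<bullet> (A (p i) - q i) = 0"
      using Aq[OF that, of "p i"] inner[OF that that]
      by (simp add: inner_diff_left inner_diff_right AA inner_commute[of "q i" "A (p i)"])
    then show ?thesis by simp
  qed
  with A AA show thesis using that unfolding orthogonal_transformation_def by blast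
qed

text \<open>\<open>sdual d\<close> is the self-dual part for \<open>d = 1\<close> and the anti-self-dual part for \<open>d = - 1\<close>, and
  \<open>J d a\<close> is the skew map with \<open>J d a u \<bullet> v = a \<bullet> sdual d u v\<close>: for \<open>norm a = 1\<close> it is the orthogonal
  complex structure whose complex lines are the oriented planes with \<open>d\<close>-component \<open>a\<close>.\<close>

definition sdual :: "real \<Rightarrow> real ^ 4 \<Rightarrow> real ^ 4 \<Rightarrow> real ^ 3" where
  "sdual d u v = vector
     [plucker u v 1 2 + d * plucker u v 3 4,
      plucker u v 1 3 - d * plucker u v 2 4,
      plucker u v 1 4 + d * plucker u v 2 3]"

definition J :: "real \<Rightarrow> real ^ 3 \<Rightarrow> real ^ 4 \<Rightarrow> real ^ 4" where
  "J d a u = vector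
     [- a$1 * u$2 - a$2 * u$3 - a$3 * u$4,
      a$1 * u$1 + d * a$2 * u$4 - d * a$3 * u$3,
      - d * a$1 * u$4 + a$2 * u$1 + d * a$3 * u$2,
      d * a$1 * u$3 - d * a$2 * u$2 + a$3 * u$1]"

lemma self_dual_eq: "self_dual = sdual 1" and anti_self_dual_eq: "anti_self_dual = sdual (- 1)"
  by (simp_all add: fun_eq_iff self_dual_def anti_self_dual_def sdual_def)

lemma vector_4_nth [simp]:
  "(vector [w, x, y, z] :: 'a::zero ^ 4) $ 1 = w" "(vector [w, x, y, z] :: 'a ^ 4) $ 2 = x"
  "(vector [w, x, y, z] :: 'a ^ 4) $ 3 = y" "(vector [w, x, y, z] :: 'a ^ 4) $ 4 = z"
  unfolding vector_def by auto

lemmas coordinate_simps = vec_eq_iff forall_3 forall_4 inner_vec_def sum_3 sum_4 sdual_def plucker_def J_def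

lemma J_inner: "J d a u \<bullet> v = a \<bullet> sdual d u v"
  by (simp add: coordinate_simps algebra_simps)

lemma linear_J: "linear (J d a)"
  by (rule linearI) (simp_all add: coordinate_simps algebra_simps)

lemma linear_J_left: "linear (\<lambda>a. J d a u)"
  by (rule linearI) (simp_all add: coordinate_simps algebra_simps)

text \<open>With \<open>u $ 1\<close> as real part and \<open>a\<close> as imaginary quaternion,
  \<open>J 1 a u\<close> and \<open>J (-1) a u\<close> are the quaternion products of
  \<open>a\<close> and \<open>u\<close> in the two orders. This explains the square here and the
  commutation in \<open>J_commute\<close>.\<close>

lemma J_J: assumes "d = 1 \<or> d = -1" shows "J d a (J d a u) = - ((a \<bullet> a) *\<^sub>R u)"
  using assms by (auto simp: coordinate_simps algebra_simps)

lemma J_commute: assumes "d = 1 \<or> d = -1" shows "J d a (J (- d) b u) = J (- d) b (J d a u)"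
  using assms by (auto simp: coordinate_simps algebra_simps)

lemma J_inner_J: assumes "d = 1 \<or> d = -1" shows "J d a u \<bullet> J d b u = (a \<bullet> b) * (u \<bullet> u)"
  using assms by (auto simp: coordinate_simps algebra_simps)

lemma norm_J: assumes "d = 1 \<or> d = -1" shows "norm (J d a u) = norm a * norm u"
  using J_inner_J[OF assms, of a u a] by (simp add: norm_eq_sqrt_inner real_sqrt_mult)

lemma sdual_J: assumes "d = 1 \<or> d = -1" shows "sdual d u (J d a u) = (u \<bullet> u) *\<^sub>R a"
  using assms by (auto simp: coordinate_simps algebra_simps)

lemma det_4:
  "det (A :: 'a::comm_ring_1 ^ 4 ^ 4) =
    A$1$1 * (A$2$2 * (A$3$3 * A$4$4 - A$3$4 * A$4$3) - A$2$3 * (A$3$2 * A$4$4 - A$3$4 * A$4$2)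
      + A$2$4 * (A$3$2 * A$4$3 - A$3$3 * A$4$2))
    - A$1$2 * (A$2$1 * (A$3$3 * A$4$4 - A$3$4 * A$4$3) - A$2$3 * (A$3$1 * A$4$4 - A$3$4 * A$4$1)
      + A$2$4 * (A$3$1 * A$4$3 - A$3$3 * A$4$1))
    + A$1$3 * (A$2$1 * (A$3$2 * A$4$4 - A$3$4 * A$4$2) - A$2$2 * (A$3$1 * A$4$4 - A$3$4 * A$4$1)
      + A$2$4 * (A$3$1 * A$4$2 - A$3$2 * A$4$1))
    - A$1$4 * (A$2$1 * (A$3$2 * A$4$3 - A$3$3 * A$4$2) - A$2$2 * (A$3$1 * A$4$3 - A$3$3 * A$4$1)
      + A$2$3 * (A$3$1 * A$4$2 - A$3$2 * A$4$1))"
proof -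
  have f1: "finite {2::4, 3, 4}" "1 \<notin> {2::4, 3, 4}" by auto
  have f2: "finite {3::4, 4}" "2 \<notin> {3::4, 4}" by auto
  have f3: "finite {4::4}" "3 \<notin> {4::4}" by auto
  show ?thesis
    unfolding det_def UNIV_4
    unfolding sum_over_permutations_insert[OF f1]
    unfolding sum_over_permutations_insert[OF f2]
    unfolding sum_over_permutations_insert[OF f3]
    unfolding permutes_sing
    by (simp add: sign_swap_id permutation_swap_id permutation_compose sign_compose sign_id swap_id_eq
        algebra_simps)
qed

text \<open>The first two terms are the Gram determinant, the inner product of the 2-vectors of
  \<open>u\<close>, \<open>v\<close> and of \<open>u'\<close>, \<open>v'\<close>. The determinant is
  their wedge product, that is, the inner product of one with the Hodge dual of the other.\<close>

lemma sdual_inner: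
  assumes "d = 1 \<or> d = -1"
  shows "sdual d u v \<bullet> sdual d u' v' =
    (u \<bullet> u') * (v \<bullet> v') - (u \<bullet> v') * (v \<bullet> u') + d * det (vector [u, v, u', v'] :: real ^ 4 ^ 4)"
  using assms by (auto simp: det_4 coordinate_simps algebra_simps)

lemma det_vector_image:
  fixes u v u' v' :: "real ^ 4"
  assumes "linear G"
  shows "det (vector [G u, G v, G u', G v'] :: real ^ 4 ^ 4) = det (matrix G) * det (vector [u, v, u', v'] :: real ^ 4 ^ 4)"
proof -
  have G: "G w $ i = (\<Sum>j\<in>UNIV. w $ j * matrix G $ i $ j)" for w i
  proof -
    have "G w = matrix G *v w" using assms by (simp add: matrix_works)
    then show ?thesis by (simp add: matrix_vector_mult_def mult.commute)
  qed
  have "(vector [G u, G v, G u', G v'] :: real ^ 4 ^ 4) = vector [u, v, u', v'] ** transpose (matrix G)"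
    by (simp add: vec_eq_iff matrix_matrix_mult_def transpose_def forall_4 G)
  then show ?thesis by (simp add: det_mul)
qed

text \<open>An orthogonal map keeps the Gram term of \<open>sdual_inner\<close> and multiplies the
  wedge term by its determinant; reversing the orientation of four-space thus exchanges the two
  factors. With the inner products matched, \<open>orthogonal_transformation_extending\<close>
  provides \<open>A\<close>, the family being indexed by all pairs of vectors.\<close>

lemma sdual_orthogonal_image:
  assumes G: "orthogonal_transformation G" and d: "d = 1 \<or> d = -1"
  obtains A where "orthogonal_transformation A"
    "\<And>u v. sdual d (G u) (G v) = A (sdual (det (matrix G) * d) u v)"
proof -
  define s where "s = det (matrix G)"
  have s: "s = 1 \<or> s = -1"
    unfolding s_def using det_orthogonal_matrix G orthogonal_transformation_matrix by blast
  have sd: "s * d = 1 \<or> s * d = -1" using s d by auto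
  have lin: "linear G" and GG: "G x \<bullet> G y = x \<bullet> y" for x y
    using G by (auto simp: orthogonal_transformation_def)
  have "\<exists>A. orthogonal_transformation A \<and>
    (\<forall>p\<in>UNIV. A (sdual (s * d) (fst p) (snd p)) = sdual d (G (fst p)) (G (snd p)))"
  proof (rule orthogonal_transformation_extending)
    show "sdual d (G (fst i)) (G (snd i)) \<bullet> sdual d (G (fst j)) (G (snd j))
      = sdual (s * d) (fst i) (snd i) \<bullet> sdual (s * d) (fst j) (snd j)" for i j
      unfolding sdual_inner[OF d] sdual_inner[OF sd] GG det_vector_image[OF lin] by (simp add: s_def)
    have "a \<in> (\<lambda>p. sdual (s * d) (fst p) (snd p)) ` UNIV" for a
    proof -
      obtain u :: "real ^ 4" where "norm u = 1" using vector_choose_size[of 1] by auto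
      then show ?thesis
        using sdual_J[OF sd, of u a] by (intro image_eqI[of _ _ "(u, J (s * d) a u)"]) (auto simp: norm_eq_1)
    qed
    then show "span ((\<lambda>p. sdual (s * d) (fst p) (snd p)) ` UNIV) = UNIV"
      using span_superset by blast
  qed blast
  then show thesis using that unfolding s_def by auto
qed

section \<open>Great circle fibrations as graphs\<close>

lemma bounded_bilinear_sdual: "bounded_bilinear (sdual d)"
  unfolding bilinear_conv_bounded_bilinear[symmetric] bilinear_def
  by (auto intro!: linearI simp: coordinate_simps algebra_simps)

lemma bounded_bilinear_J: "bounded_bilinear (J d)"
  unfolding bilinear_conv_bounded_bilinear[symmetric] bilinear_def
  by (simp add: linear_J linear_J_left)

lemma fibration_fibers:
  assumes "great_circle_fibration W F"
  shows "C \<in> F \<Longrightarrow> C \<subseteq> W" "C \<in> F \<Longrightarrow> \<exists>x. x \<in> C" "x \<in> W \<Longrightarrow> \<exists>C\<in>F. x \<in> C"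
    "C \<in> F \<Longrightarrow> great_circle C" "openin (top_of_set S3) W"
proof -
  obtain B :: "(real ^ 4) set topology" and p
    where Bp: "fiber_bundle (top_of_set W) B (top_of_set (sphere (0::complex) 1)) p"
    and F: "F = (\<lambda>b. {x \<in> W. p x = b}) ` topspace B"
    using assms unfolding great_circle_fibration_def by blast
  have p: "p ` W = topspace B" using Bp unfolding fiber_bundle_def by simp
  have F': "F = (\<lambda>y. {x \<in> W. p x = p y}) ` W" unfolding F p[symmetric] by (simp add: image_image)
  show "C \<in> F \<Longrightarrow> C \<subseteq> W" "C \<in> F \<Longrightarrow> \<exists>x. x \<in> C" "x \<in> W \<Longrightarrow> \<exists>C\<in>F. x \<in> C"
    by (auto simp: F')
  show "C \<in> F \<Longrightarrow> great_circle C" "openin (top_of_set S3) W"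
    using assms unfolding great_circle_fibration_def by blast+
qed

text \<open>Moving \<open>x\<close> slightly in the direction \<open>w\<close> and normalizing stays
  in \<open>A\<close>, so \<open>span A\<close> contains \<open>x + t *\<^sub>R w\<close> for some
  \<open>t > 0\<close> and hence \<open>w\<close>.\<close>

lemma span_open_subset_sphere:
  fixes A :: "'a::euclidean_space set"
  assumes A: "openin (top_of_set (sphere 0 1)) A" and x: "x \<in> A"
  shows "span A = UNIV"
proof -
  obtain T where T: "open T" "A = sphere 0 1 \<inter> T" using A by (auto simp: openin_open)
  have nx: "norm x = 1" using T x by auto
  have "w \<in> span A" for w
  proof -
    have "isCont (\<lambda>t. sgn (x + t *\<^sub>R w)) 0"
      by (intro continuous_intros) (use nx in auto)
    then have "((\<lambda>t. sgn (x + t *\<^sub>R w)) \<longlongrightarrow> x) (at_right 0)"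
      using nx by (auto simp: isCont_def sgn_div_norm intro: filterlim_mono[OF _ order_refl at_le])
    then have "\<forall>\<^sub>F t in at_right 0. sgn (x + t *\<^sub>R w) \<in> T"
      using T x by (intro topological_tendstoD) auto
    moreover have "isCont (\<lambda>t. x + t *\<^sub>R w) 0" by (intro continuous_intros)
    then have "((\<lambda>t. x + t *\<^sub>R w) \<longlongrightarrow> x) (at_right 0)"
      by (auto simp: isCont_def intro: filterlim_mono[OF _ order_refl at_le])
    then have "\<forall>\<^sub>F t in at_right 0. x + t *\<^sub>R w \<in> - {0}"
      using nx by (intro topological_tendstoD) auto
    ultimately have "\<forall>\<^sub>F t in at_right 0. t > 0 \<and> sgn (x + t *\<^sub>R w) \<in> T \<and> x + t *\<^sub>R w \<noteq> 0"
      using eventually_at_right_less[of "0::real"] by eventually_elim auto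
    then obtain t where t: "t > 0" "sgn (x + t *\<^sub>R w) \<in> T" "x + t *\<^sub>R w \<noteq> 0"
      using eventually_happens'[OF trivial_limit_at_right_real] by blast
    then have "sgn (x + t *\<^sub>R w) \<in> A" using T by (simp add: norm_sgn)
    then have "norm (x + t *\<^sub>R w) *\<^sub>R sgn (x + t *\<^sub>R w) \<in> span A" by (intro span_scale span_base)
    then have "x + t *\<^sub>R w \<in> span A" using t(3) by (simp add: sgn_div_norm)
    then have "x + t *\<^sub>R w - x \<in> span A" using span_diff[OF _ span_base[OF x]] by blast
    then have "t *\<^sub>R w \<in> span A" by simp
    from span_scale[OF this, of "inverse t"] have "inverse t *\<^sub>R (t *\<^sub>R w) \<in> span A" .
    then show ?thesis using t(1) by simp
  qed
  then show ?thesis by blast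
qed

text \<open>Keeping spherical distances means keeping inner products, and an open piece of the
  sphere spans the space, so equal Gram matrices give the linear extension.\<close>

lemma isometry_onto_orthogonal:
  assumes A: "openin (top_of_set S3) A" "x \<in> A" and B: "B \<subseteq> S3" and g: "isometry_onto g A B"
  obtains G where "orthogonal_transformation G" "\<And>y. y \<in> A \<Longrightarrow> g y = G y"
proof -
  have AS: "A \<subseteq> S3" using openin_imp_subset[OF A(1)] by simp
  have gB: "g ` A = B" using g by (simp add: isometry_onto_def)
  have "g i \<bullet> g j = i \<bullet> j" if ij: "i \<in> A" "j \<in> A" for i j
  proof -
    have n: "norm i = 1" "norm j = 1" "norm (g i) = 1" "norm (g j) = 1" using ij AS B gB by auto
    have "arccos (g i \<bullet> g j) = arccos (i \<bullet> j)"
      using g ij by (simp add: isometry_onto_def sphere_dist_def)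
    moreover have "\<bar>g i \<bullet> g j\<bar> \<le> 1" "\<bar>i \<bullet> j\<bar> \<le> 1"
      using Cauchy_Schwarz_ineq2[of i j] Cauchy_Schwarz_ineq2[of "g i" "g j"] n by auto
    ultimately show ?thesis by (metis cos_arccos_abs)
  qed
  moreover have "span ((\<lambda>x. x) ` A) = UNIV" using span_open_subset_sphere[OF A] by simp
  ultimately obtain G where "orthogonal_transformation G" "\<And>i. i \<in> A \<Longrightarrow> G i = g i"
    using orthogonal_transformation_extending[of A g "\<lambda>x. x"] by blast
  then show thesis using that by metis
qed

text \<open>The sign \<open>d\<close> merges the two cases of the associated function:
  \<open>V\<close> lies in the self-dual factor for \<open>d = 1\<close> and in the anti-self-dual
  one for \<open>d = -1\<close>.\<close>

locale oriented_fibration =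
  fixes W :: "(real ^ 4) set" and F :: "(real ^ 4) set set" and V :: "(real ^ 3) set"
    and f :: "real ^ 3 \<Rightarrow> real ^ 3" and \<tau> :: "real ^ 4 \<Rightarrow> real ^ 4" and d :: real
  assumes fibration: "great_circle_fibration W F"
    and orientation: "consistent_orientation W F \<tau>"
    and d: "d = 1 \<or> d = -1"
    and open_V: "openin (top_of_set S2) V" and f_V: "f ` V \<subseteq> S2"
    and decreasing: "distance_decreasing_on V f"
    and graph: "{(sdual d x (\<tau> x), sdual (- d) x (\<tau> x)) | x. x \<in> W} = {(a, f a) | a. a \<in> V}"
begin

definition s :: "real ^ 4 \<Rightarrow> real ^ 3" where "s x = sdual d x (\<tau> x)"

text \<open>For \<open>a \<in> V\<close>, the plane with components \<open>a\<close> and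
  \<open>f a\<close> is where the commuting complex structures \<open>J d a\<close> and
  \<open>J (- d) (f a)\<close> coincide. A fiber thus becomes the solution set of a linear equation
  with parameter \<open>a\<close>.\<close>

definition eq_J :: "real ^ 3 \<Rightarrow> real ^ 4 \<Rightarrow> bool" where
  "eq_J a y \<longleftrightarrow> J d a y = J (- d) (f a) y"

definition fib :: "real ^ 3 \<Rightarrow> (real ^ 4) set" where "fib a = {y \<in> S3. eq_J a y}"

lemma d': "- d = 1 \<or> - d = -1" using d by auto

lemma V_S2: "V \<subseteq> S2" using openin_imp_subset[OF open_V] by simp

lemma V_unit: "a \<in> V \<Longrightarrow> a \<bullet> a = 1" "a \<in> V \<Longrightarrow> f a \<bullet> f a = 1"
  using V_S2 f_V by (auto simp: norm_eq_1[symmetric])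

lemma W_S3: "x \<in> W \<Longrightarrow> norm x = 1"
  using openin_imp_subset[OF fibration_fibers(5)[OF fibration]] by auto

lemma \<tau>_unit: assumes "x \<in> W" shows "norm (\<tau> x) = 1" "x \<bullet> \<tau> x = 0"
  using fibration_fibers(3)[OF fibration assms] orientation unfolding consistent_orientation_def by blast+

lemma s_V: assumes "x \<in> W" shows "s x \<in> V" "sdual (- d) x (\<tau> x) = f (s x)"
proof -
  have "(sdual d x (\<tau> x), sdual (- d) x (\<tau> x)) \<in> {(a, f a) | a. a \<in> V}"
    unfolding graph[symmetric] using assms by blast
  then show "s x \<in> V" "sdual (- d) x (\<tau> x) = f (s x)" by (auto simp: s_def)
qed

lemma s_surj: assumes "a \<in> V" obtains x where "x \<in> W" "s x = a"
proof -
  have "(a, f a) \<in> {(sdual d x (\<tau> x), sdual (- d) x (\<tau> x)) | x. x \<in> W}"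
    unfolding graph using assms by blast
  then show thesis using that by (auto simp: s_def)
qed

text \<open>By \<open>J_inner\<close> the unit vectors \<open>\<tau> x\<close> and
  \<open>J e c x\<close> have inner product \<open>c \<bullet> c = 1\<close>, so they
  coincide.\<close>

lemma \<tau>_eq_J: assumes x: "x \<in> W" shows "\<tau> x = J d (s x) x" "\<tau> x = J (- d) (f (s x)) x"
proof -
  have eq: "\<tau> x = J e c x" if e: "e = 1 \<or> e = -1" and c: "c = sdual e x (\<tau> x)" "c \<bullet> c = 1" for e c
  proof -
    have "(J e c x - \<tau> x) \<bullet> (J e c x - \<tau> x) = J e c x \<bullet> J e c x - 2 * (J e c x \<bullet> \<tau> x) + \<tau> x \<bullet> \<tau> x"
      by (simp add: inner_simps inner_commute)
    also have "\<dots> = 0"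
      using c W_S3[OF x] \<tau>_unit[OF x] J_inner_J[OF e, of c x c] J_inner[of e c x "\<tau> x"]
      by (simp add: norm_eq_1)
    finally show ?thesis by simp
  qed
  show "\<tau> x = J d (s x) x" by (rule eq[OF d]) (use s_V[OF x] V_unit in \<open>auto simp: s_def\<close>)
  show "\<tau> x = J (- d) (f (s x)) x" by (rule eq[OF d']) (use s_V[OF x] V_unit in auto)
qed

lemma eq_J_0: "eq_J a 0" and eq_J_add: "eq_J a x \<Longrightarrow> eq_J a y \<Longrightarrow> eq_J a (x + y)"
  and eq_J_scale: "eq_J a x \<Longrightarrow> eq_J a (c *\<^sub>R x)"
  by (simp_all add: eq_J_def linear_0[OF linear_J] linear_add[OF linear_J] linear_scale[OF linear_J])

lemma eq_J_diff: "eq_J a x \<Longrightarrow> eq_J a y \<Longrightarrow> eq_J a (x - y)"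
  using eq_J_add[of a x "(-1) *\<^sub>R y"] eq_J_scale[of a y "-1"] by simp

lemma subspace_eq_J: "subspace {y. eq_J a y}"
  by (auto simp: subspace_def eq_J_0 eq_J_add eq_J_scale)

lemma eq_J_J: assumes "a \<in> V" "eq_J a y" shows "eq_J a (J d a y)"
proof -
  have "J (- d) (f a) (J d a y) = J (- d) (f a) (J (- d) (f a) y)" using assms(2) by (simp add: eq_J_def)
  then show ?thesis using assms(1) by (simp add: eq_J_def J_J[OF d] J_J[OF d'] V_unit)
qed

text \<open>The plane of a fiber is determined by its two components: if \<open>w\<close> lies in a plane with the same
  components and is orthogonal to the plane of \<open>y\<close> and \<open>J d a y\<close>, then the inner product of the
  two 2-vectors is \<open>0\<close> as a Gram determinant, but \<open>w \<bullet> w\<close> by components.\<close>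

lemma eq_J_orthogonal_imp_0:
  assumes a: "a \<in> V" and y: "eq_J a y" "norm y = 1" and w: "eq_J a w" "w \<bullet> y = 0" "w \<bullet> J d a y = 0"
  shows "w = 0"
proof -
  have eqs: "J (- d) (f a) y = J d a y" "J (- d) (f a) w = J d a w" using y w by (auto simp: eq_J_def)
  have yy: "y \<bullet> y = 1" using y by (simp add: norm_eq_1)
  have 1: "sdual d y (J d a y) \<bullet> sdual d w (J d a w) = w \<bullet> w"
    by (simp add: sdual_J[OF d] V_unit[OF a] yy)
  have 2: "sdual (- d) y (J d a y) \<bullet> sdual (- d) w (J d a w) = w \<bullet> w"
    unfolding eqs[symmetric] by (simp add: sdual_J[OF d'] V_unit[OF a] yy)
  have "sdual d y (J d a y) \<bullet> sdual d w (J d a w) + sdual (- d) y (J d a y) \<bullet> sdual (- d) w (J d a w)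
    = 2 * ((y \<bullet> w) * (J d a y \<bullet> J d a w) - (y \<bullet> J d a w) * (J d a y \<bullet> w))"
    unfolding sdual_inner[OF d] sdual_inner[OF d'] by simp
  then show ?thesis using w unfolding 1 2 by (simp add: inner_commute)
qed

end

context oriented_fibration
begin

lemma J_orthogonal: "J d a y \<bullet> y = 0" "y \<bullet> J d a y = 0"
  by (simp_all add: inner_commute[of y] J_inner) (simp_all add: coordinate_simps)

lemma eq_J_expansion:
  assumes a: "a \<in> V" and y: "eq_J a y" "norm y = 1" and z: "eq_J a z"
  shows "z = (z \<bullet> y) *\<^sub>R y + (z \<bullet> J d a y) *\<^sub>R J d a y"
proof -
  have yy: "y \<bullet> y = 1" using y by (simp add: norm_eq_1)
  have "z - ((z \<bullet> y) *\<^sub>R y + (z \<bullet> J d a y) *\<^sub>R J d a y) = 0"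
  proof (rule eq_J_orthogonal_imp_0[OF a y])
    show "eq_J a (z - ((z \<bullet> y) *\<^sub>R y + (z \<bullet> J d a y) *\<^sub>R J d a y))"
      by (intro eq_J_diff eq_J_add eq_J_scale eq_J_J a y z)
  qed (simp_all add: inner_simps J_orthogonal J_inner_J[OF d] V_unit[OF a] yy)
  then show ?thesis by simp
qed

lemma fiber_eq_fib:
  assumes C: "C \<in> F" "x \<in> C" shows "C = fib (s x)"
proof -
  have xW: "x \<in> W" using fibration_fibers(1)[OF fibration C(1)] C(2) by blast
  note sV = s_V(1)[OF xW]
  obtain P where P: "subspace P" "dim P = 2" "C = P \<inter> S3"
    using fibration_fibers(4)[OF fibration C(1)] unfolding great_circle_def by blast
  have "\<tau> x \<in> span C" using orientation C unfolding consistent_orientation_def by blast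
  moreover have "span C \<subseteq> P" using P by (intro span_minimal) auto
  ultimately have \<tau>P: "\<tau> x \<in> P" and xP: "x \<in> P" using C P by auto
  have eqx: "eq_J (s x) x" using \<tau>_eq_J[OF xW] by (simp add: eq_J_def)
  have nx: "norm x = 1" by (rule W_S3[OF xW])
  have ne: "x \<noteq> \<tau> x" "x \<noteq> 0" "\<tau> x \<noteq> 0" using \<tau>_unit[OF xW] nx by (auto simp: norm_eq_1)
  have "independent {x, \<tau> x}"
    by (rule pairwise_orthogonal_independent)
      (use ne \<tau>_unit[OF xW] in \<open>auto simp: pairwise_def orthogonal_def inner_commute\<close>)
  then have sub: "P \<subseteq> span {x, \<tau> x}"
    by (rule card_ge_dim_independent[rotated]) (use xP \<tau>P ne P(2) in auto)
  have eqt: "eq_J (s x) (\<tau> x)" using eq_J_J[OF sV eqx] \<tau>_eq_J(1)[OF xW] by simp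
  have "span {x, \<tau> x} \<subseteq> {y. eq_J (s x) y}"
    using eqx eqt by (intro span_minimal subspace_eq_J) auto
  with sub have "C \<subseteq> fib (s x)" using P by (auto simp: fib_def)
  moreover have "fib (s x) \<subseteq> C"
  proof
    fix y assume y: "y \<in> fib (s x)"
    then have "y = (y \<bullet> x) *\<^sub>R x + (y \<bullet> \<tau> x) *\<^sub>R \<tau> x"
      using eq_J_expansion[OF sV eqx nx, of y] \<tau>_eq_J(1)[OF xW] by (simp add: fib_def)
    moreover have "(y \<bullet> x) *\<^sub>R x + (y \<bullet> \<tau> x) *\<^sub>R \<tau> x \<in> P"
      using P(1) xP \<tau>P by (intro subspace_add subspace_scale)
    ultimately show "y \<in> C" using y P by (auto simp: fib_def)
  qed
  ultimately show ?thesis by blast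
qed

lemma fib_in_F: assumes "a \<in> V" shows "fib a \<in> F"
proof -
  obtain x where x: "x \<in> W" "s x = a" using s_surj[OF assms] by blast
  obtain C where C: "C \<in> F" "x \<in> C" using fibration_fibers(3)[OF fibration x(1)] by blast
  then show ?thesis using fiber_eq_fib[OF C] x by simp
qed

lemma fib_sub_W: "a \<in> V \<Longrightarrow> y \<in> fib a \<Longrightarrow> y \<in> W"
  using fib_in_F fibration_fibers(1)[OF fibration] by blast

lemma in_fib_s: "x \<in> W \<Longrightarrow> x \<in> fib (s x)"
  using \<tau>_eq_J by (simp add: fib_def eq_J_def W_S3)

text \<open>A fiber cannot occur with both orientations, since \<open>f\<close> would then map two antipodal points to
  antipodal points.\<close>

lemma s_fib: assumes a: "a \<in> V" and y: "y \<in> fib a" shows "s y = a"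
proof -
  have yW: "y \<in> W" using fib_sub_W[OF a y] .
  have eqy: "eq_J a y" "norm y = 1" using y by (auto simp: fib_def)
  have yy: "y \<bullet> y = 1" using eqy by (simp add: norm_eq_1)
  have "\<tau> y \<in> span (fib a)" using orientation fib_in_F[OF a] y unfolding consistent_orientation_def by blast
  moreover have "span (fib a) \<subseteq> {y. eq_J a y}" by (intro span_minimal subspace_eq_J) (auto simp: fib_def)
  ultimately have "eq_J a (\<tau> y)" by blast
  then have t: "\<tau> y = (\<tau> y \<bullet> J d a y) *\<^sub>R J d a y"
    using eq_J_expansion[OF a eqy, of "\<tau> y"] \<tau>_unit[OF yW] by (simp add: inner_commute)
  define c where "c = \<tau> y \<bullet> J d a y"
  have t: "\<tau> y = c *\<^sub>R J d a y" using t by (simp add: c_def)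
  have "norm (J d a y) = 1" using norm_J[OF d, of a y] eqy V_S2 a by auto
  then have "\<bar>c\<bar> = 1" using arg_cong[OF t, of norm] \<tau>_unit[OF yW] by simp
  interpret sd: bounded_bilinear "sdual e" for e by (rule bounded_bilinear_sdual)
  have s: "s y = c *\<^sub>R a" unfolding s_def t by (simp add: sd.scaleR_right sdual_J[OF d] yy)
  have "J d a y = J (- d) (f a) y" using eqy by (simp add: eq_J_def)
  then have fs: "f (s y) = c *\<^sub>R f a"
    unfolding s_V(2)[OF yW, symmetric] t by (simp add: sd.scaleR_right sdual_J[OF d'] yy)
  have "c \<noteq> -1"
  proof
    assume c: "c = -1"
    then have "- a \<in> V" "f (- a) = - f a" using s fs s_V(1)[OF yW] by auto
    moreover have "a \<noteq> - a"
    proof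
      assume "a = - a"
      then have "a \<bullet> a = - (a \<bullet> a)" by (metis inner_minus_left)
      then show False using V_unit(1)[OF a] by simp
    qed
    ultimately show False
      using distance_decreasing_inner[OF decreasing f_V V_S2 a, of "- a"] V_unit[OF a] by simp
  qed
  then show ?thesis using \<open>\<bar>c\<bar> = 1\<close> s by (auto simp: abs_if split: if_splits)
qed

lemma F_eq: "F = fib ` V"
proof
  show "F \<subseteq> fib ` V"
  proof
    fix C assume C: "C \<in> F"
    then obtain x where x: "x \<in> C" using fibration_fibers(2)[OF fibration] by blast
    then have "x \<in> W" using fibration_fibers(1)[OF fibration C] by blast
    then show "C \<in> fib ` V" using fiber_eq_fib[OF C x] s_V(1) by blast
  qed
  show "fib ` V \<subseteq> F" using fib_in_F by blast
qed

lemma continuous_\<tau>: "continuous_on W \<tau>"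
  using orientation unfolding consistent_orientation_def by blast

lemma V_eq: "V = s ` W"
  using s_V(1) s_surj by blast

lemma connected_V: assumes "connected W" shows "connected V"
  unfolding V_eq s_def
  by (intro connected_continuous_image assms bounded_bilinear.continuous_on[OF bounded_bilinear_sdual]
      continuous_on_id continuous_\<tau>)

section \<open>Continuity of \<open>f\<close> and stability of fibers\<close>

lemma f_nonexpansive:
  assumes "a \<in> V" "b \<in> V" shows "norm (f a - f b) \<le> norm (a - b)"
proof (cases "a = b")
  case False
  have "(norm (f a - f b))\<^sup>2 \<le> (norm (a - b))\<^sup>2"
    using distance_decreasing_inner[OF decreasing f_V V_S2 assms False] V_unit assms
    by (simp add: power2_norm_eq_inner inner_simps inner_commute)
  then show ?thesis by (rule power2_le_imp_le) simp
qed simp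

lemma continuous_f: "continuous_on V f"
  unfolding continuous_on_iff
proof (intro ballI allI impI)
  fix a and e :: real assume a: "a \<in> V" and e: "e > 0"
  have "dist (f b) (f a) < e" if "b \<in> V" "dist b a < e" for b
    using f_nonexpansive[OF that(1) a] that(2) by (simp add: dist_norm)
  then show "\<exists>k>0. \<forall>b\<in>V. dist b a < k \<longrightarrow> dist (f b) (f a) < e" using e by blast
qed

text \<open>The defect \<open>\<phi> a\<close> is bounded below by some \<open>m > 0\<close> on the
  compact complement of \<open>A\<close>, while on unit vectors \<open>\<phi> b\<close> differs from
  it by at most twice \<open>norm (b - a)\<close>, once for each complex structure. This gives the
  radius \<open>m / 2\<close>.\<close>

lemma eventually_fib_subset:
  assumes a: "a \<in> V" and A: "openin (top_of_set S3) A" "fib a \<subseteq> A"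
  shows "\<forall>\<^sub>F b in at a within V. fib b \<subseteq> A"
proof -
  obtain T where T: "open T" "A = S3 \<inter> T" using A(1) by (auto simp: openin_open)
  define Z where "Z = S3 - T"
  have Z: "compact Z" unfolding Z_def by (intro compact_diff T compact_sphere)
  define \<phi> where "\<phi> b x = J d b x - J (- d) (f b) x" for b x
  have contJ: "continuous_on X (J e c)" for X e c by (intro linear_continuous_on linear_conv_bounded_linear[THEN iffD1] linear_J)
  have pos: "norm (\<phi> a x) > 0" if "x \<in> Z" for x
    using that A(2) T by (auto simp: Z_def \<phi>_def fib_def eq_J_def)
  have "\<exists>m>0. \<forall>x\<in>Z. m \<le> norm (\<phi> a x)"
  proof (cases "Z = {}")
    case True then show ?thesis by (intro exI[of _ 1]) auto
  next
    case False
    have cont: "continuous_on Z (\<lambda>x. norm (\<phi> a x))" unfolding \<phi>_def by (intro continuous_intros contJ)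
    obtain x where "x \<in> Z" "\<forall>y\<in>Z. norm (\<phi> a x) \<le> norm (\<phi> a y)"
      using continuous_attains_inf[OF Z False, of "\<lambda>x. norm (\<phi> a x)"] cont by blast
    then show ?thesis using pos by blast
  qed
  then obtain m where m: "m > 0" "\<And>x. x \<in> Z \<Longrightarrow> m \<le> norm (\<phi> a x)" by blast
  have "\<forall>\<^sub>F b in at a within V. b \<in> V \<and> dist b a < m / 2"
    unfolding eventually_at using m(1) by (intro exI[of _ "m / 2"]) auto
  then show ?thesis
  proof eventually_elim
    case (elim b)
    then have b: "b \<in> V" "norm (b - a) < m / 2" by (auto simp: dist_norm)
    show "fib b \<subseteq> A"
    proof (rule ccontr)
      assume "\<not> fib b \<subseteq> A"
      then obtain x where x: "x \<in> fib b" "x \<notin> A" by blast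
      then have xZ: "x \<in> Z" and nx: "norm x = 1" and \<phi>b: "\<phi> b x = 0"
        using T by (auto simp: fib_def Z_def \<phi>_def eq_J_def)
      have "\<phi> a x = - (\<phi> b x - \<phi> a x)" using \<phi>b by simp
      also have "\<dots> = - (J d (b - a) x - J (- d) (f b - f a) x)"
        by (simp add: \<phi>_def linear_diff[OF linear_J_left])
      finally have "norm (\<phi> a x) \<le> norm (J d (b - a) x) + norm (J (- d) (f b - f a) x)"
        by (simp add: norm_triangle_ineq4 norm_minus_commute)
      also have "\<dots> \<le> norm (b - a) + norm (b - a)"
        using f_nonexpansive[OF b(1) a] by (simp add: norm_J[OF d] norm_J[OF d'] nx)
      finally show False using m(2)[OF xZ] b(2) by simp
    qed
  qed
qed

text \<open>For \<open>a \<in> V\<close> this is twice the orthogonal projection to the plane of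
  \<open>fib a\<close>, the eigenspace for 1 of the symmetric involution sending \<open>x\<close> to
  \<open>- J (- d) (f a) (J d a x)\<close>. It moves a point continuously into neighbouring
  fibers.\<close>

definition proj :: "real ^ 4 \<Rightarrow> real ^ 3 \<Rightarrow> real ^ 4" where
  "proj x a = x - J (- d) (f a) (J d a x)"

lemma eq_J_proj: assumes "a \<in> V" shows "eq_J a (proj x a)"
proof -
  have "J d a (J (- d) (f a) (J d a x)) = J (- d) (f a) (J d a (J d a x))" by (rule J_commute[OF d])
  also have "\<dots> = - J (- d) (f a) x"
    by (simp add: J_J[OF d] V_unit[OF assms] linear_neg[OF linear_J])
  finally show ?thesis
    by (simp add: eq_J_def proj_def linear_diff[OF linear_J] J_J[OF d'] V_unit[OF assms])
qed

lemma proj_fib: assumes "a \<in> V" "x \<in> fib a" shows "proj x a = 2 *\<^sub>R x"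
proof -
  have "J (- d) (f a) (J d a x) = J (- d) (f a) (J (- d) (f a) x)"
    using assms(2) by (simp add: fib_def eq_J_def)
  then show ?thesis using assms(1) by (simp add: proj_def J_J[OF d'] V_unit scaleR_2)
qed

lemma continuous_proj: "continuous_on V (proj x)"
  unfolding proj_def
  by (intro continuous_intros bounded_bilinear.continuous_on[OF bounded_bilinear_J] continuous_f)

lemma sgn_proj_fib: assumes "a \<in> V" "proj x a \<noteq> 0" shows "sgn (proj x a) \<in> fib a"
  using eq_J_scale[OF eq_J_proj[OF assms(1), of x], of "inverse (norm (proj x a))"] assms(2)
  by (simp add: fib_def norm_sgn) (simp add: sgn_div_norm)

end

section \<open>Local symmetries of the associated function\<close>

context oriented_fibration
begin

text \<open>The isometry is the restriction of an orthogonal map \<open>G\<close>, which carries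
  fibers near \<open>fib a\<close> to fibers and acts on oriented planes by orthogonal maps of the
  components. It remains to follow the orientations of the fibers, which \<open>G\<close> may
  reverse, and to exclude an exchange of the components.\<close>

lemma local_symmetry:
  assumes lfh: "locally_fiberwise_homogeneous W F" and a: "a \<in> V" and b: "b \<in> V"
  shows "\<exists>A B N. orthogonal_transformation A \<and> orthogonal_transformation B \<and>
    openin (top_of_set V) N \<and> a \<in> N \<and> A a = b \<and> A ` N \<subseteq> V \<and> (\<forall>x\<in>N. f (A x) = B (f x))"
proof -
  have WS: "W \<subseteq> S3" and W: "openin (top_of_set S3) W"
    using fibration_fibers(5)[OF fibration] openin_imp_subset by auto
  obtain X Y g where XY: "openin (top_of_set W) X" "openin (top_of_set W) Y" "fib a \<subseteq> X" "fib b \<subseteq> Y"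
    "isometry_onto g X Y" "\<forall>E\<in>F. E \<subseteq> X \<longrightarrow> g ` E \<in> F" "g ` fib a = fib b"
    using lfh fib_in_F[OF a] fib_in_F[OF b] unfolding locally_fiberwise_homogeneous_def by metis
  have X: "openin (top_of_set S3) X" "X \<subseteq> W" and YW: "Y \<subseteq> W"
    using openin_trans[OF XY(1) W] openin_imp_subset[OF XY(1)] openin_imp_subset[OF XY(2)] by auto
  obtain x0 where x0: "x0 \<in> W" "s x0 = a" using s_surj[OF a] by blast
  then have x0a: "x0 \<in> fib a" using in_fib_s by blast
  then have x0X: "x0 \<in> X" using XY by blast
  obtain G where G: "orthogonal_transformation G" "\<And>y. y \<in> X \<Longrightarrow> g y = G y"
    using isometry_onto_orthogonal[OF X(1) x0X _ XY(5)] YW WS by blast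
  have GG: "G x \<bullet> G y = x \<bullet> y" for x y using G by (auto simp: orthogonal_transformation_def)
  interpret G: linear G using G by (simp add: orthogonal_transformation_def)
  \<comment> \<open>On fibers inside \<open>X\<close> this is the sign by which \<open>G\<close>
    changes the orientation of the fiber through \<open>x\<close>.\<close>
  define \<epsilon> where "\<epsilon> x = \<tau> (G x) \<bullet> G (\<tau> x)" for x
  have sign: "G x \<in> W \<and> \<tau> (G x) = \<epsilon> x *\<^sub>R G (\<tau> x) \<and> \<bar>\<epsilon> x\<bar> = 1"
    if c: "c \<in> V" "fib c \<subseteq> X" and x: "x \<in> fib c" for c x
  proof -
    have "g ` fib c \<in> F" using XY(6) fib_in_F[OF c(1)] c(2) by blast
    moreover have "g ` fib c = G ` fib c" using G(2) c(2) by (intro image_cong) auto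
    ultimately obtain c' where c': "c' \<in> V" "G ` fib c = fib c'" unfolding F_eq by auto
    have xW: "x \<in> W" and sx: "s x = c" using x c fib_sub_W s_fib by auto
    have Gx: "G x \<in> fib c'" using c' x by blast
    then have GxW: "G x \<in> W" and sGx: "s (G x) = c'" using c' fib_sub_W s_fib by auto
    have eqx: "eq_J c x" "norm x = 1" using x by (auto simp: fib_def)
    have "\<tau> x \<in> fib c"
      using eq_J_J[OF c(1) eqx(1)] \<tau>_eq_J(1)[OF xW] \<tau>_unit[OF xW] sx by (simp add: fib_def)
    then have "G (\<tau> x) \<in> fib c'" using c' by blast
    then have "eq_J c' (G (\<tau> x))" by (simp add: fib_def)
    moreover have "eq_J c' (G x)" "norm (G x) = 1" using Gx by (auto simp: fib_def)
    ultimately have "G (\<tau> x) = (G (\<tau> x) \<bullet> G x) *\<^sub>R G x + (G (\<tau> x) \<bullet> J d c' (G x)) *\<^sub>R J d c' (G x)"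
      using eq_J_expansion[OF c'(1)] by blast
    then have G\<tau>: "G (\<tau> x) = \<epsilon> x *\<^sub>R \<tau> (G x)"
      using \<tau>_unit[OF xW] \<tau>_eq_J(1)[OF GxW] sGx by (simp add: \<epsilon>_def GG inner_commute)
    have "norm (G (\<tau> x)) = 1" using \<tau>_unit[OF xW] by (simp add: norm_eq_sqrt_inner GG)
    then have e: "\<bar>\<epsilon> x\<bar> = 1" using arg_cong[OF G\<tau>, of norm] \<tau>_unit[OF GxW] by simp
    then have "\<epsilon> x * \<epsilon> x = 1" using abs_mult_self_eq[of "\<epsilon> x"] by simp
    then have "\<tau> (G x) = \<epsilon> x *\<^sub>R G (\<tau> x)" unfolding G\<tau> by simp
    then show ?thesis using GxW e by simp
  qed
  have cont\<epsilon>: "continuous_on X \<epsilon>"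
  proof -
    have 1: "continuous_on Z G" for Z
      by (intro linear_continuous_on linear_conv_bounded_linear[THEN iffD1] G.linear_axioms)
    have 2: "G ` X \<subseteq> W" using XY(5) G(2) YW by (force simp: isometry_onto_def)
    have 3: "continuous_on X \<tau>" using continuous_\<tau> X(2) continuous_on_subset by blast
    show ?thesis unfolding \<epsilon>_def
      by (intro continuous_intros continuous_on_compose2[OF continuous_\<tau> 1 2] continuous_on_compose2[OF 1[of UNIV] 3]) simp
  qed
  \<comment> \<open>A local section through \<open>x0\<close>: one point \<open>x c\<close> in each
    fiber near \<open>fib a\<close>, tending to \<open>x0\<close> as \<open>c\<close> tends to
    \<open>a\<close>.\<close>
  define x where "x c = sgn (proj x0 c)" for c
  have "norm x0 = 1" using W_S3 x0 by blast
  then have xa: "x a = x0" unfolding x_def proj_fib[OF a x0a] by (simp add: sgn_scaleR) (simp add: sgn_div_norm)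
  have ne_a: "proj x0 a \<noteq> 0" using proj_fib[OF a x0a] \<open>norm x0 = 1\<close> by auto
  have pt: "(proj x0 \<longlongrightarrow> proj x0 a) (at a within V)"
    using continuous_proj a by (simp add: continuous_on_def)
  have xt: "(x \<longlongrightarrow> x0) (at a within V)"
    using tendsto_sgn[OF pt ne_a] xa unfolding x_def by simp
  define P where "P c \<longleftrightarrow> c \<in> V \<and> fib c \<subseteq> X \<and> proj x0 c \<noteq> 0 \<and> \<epsilon> (x c) = \<epsilon> x0" for c
  have ev: "\<forall>\<^sub>F c in at a within V. P c"
  proof -
    have 1: "\<forall>\<^sub>F c in at a within V. c \<in> V \<and> fib c \<subseteq> X"
      using eventually_fib_subset[OF a X(1) XY(3)] by (auto simp: eventually_at_filter elim!: eventually_mono)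
    have 2: "\<forall>\<^sub>F c in at a within V. proj x0 c \<noteq> 0"
      using topological_tendstoD[OF pt, of "- {0}"] ne_a by auto
    have 12: "\<forall>\<^sub>F c in at a within V. x c \<in> X"
      using 1 2 by eventually_elim (use sgn_proj_fib in \<open>auto simp: x_def\<close>)
    have "((\<lambda>c. \<epsilon> (x c)) \<longlongrightarrow> \<epsilon> x0) (at a within V)"
      by (rule continuous_on_tendsto_compose[OF cont\<epsilon> xt x0X 12])
    then have 3: "\<forall>\<^sub>F c in at a within V. dist (\<epsilon> (x c)) (\<epsilon> x0) < 1" by (rule tendstoD) simp
    show ?thesis using 1 2 3
    proof eventually_elim
      case (elim c)
      then have "x c \<in> fib c" using sgn_proj_fib by (simp add: x_def)
      then have "\<bar>\<epsilon> (x c)\<bar> = 1" "\<bar>\<epsilon> x0\<bar> = 1" using sign elim a XY(3) x0a by blast+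
      then have "\<epsilon> (x c) = \<epsilon> x0" using elim by (auto simp: dist_real_def abs_if split: if_splits)
      then show ?case using elim by (simp add: P_def)
    qed
  qed
  \<comment> \<open>The filter \<open>at a within V\<close> leaves out \<open>a\<close>
    itself.\<close>
  have "P a" unfolding P_def using a XY(3) ne_a xa by auto
  obtain S where S: "open S" "a \<in> S" "\<And>c. c \<in> S \<inter> V \<Longrightarrow> P c"
    using ev \<open>P a\<close> unfolding eventually_at_topological by (metis IntD1 IntD2)
  define N where "N = S \<inter> V"
  have N: "openin (top_of_set V) N" "a \<in> N" "N \<subseteq> V"
    using S a by (auto simp: N_def openin_open)
  define e where "e = \<epsilon> x0"
  have e: "\<bar>e\<bar> = 1" using sign[OF a XY(3) x0a] by (simp add: e_def)
  define y where "y c = G (x c)" for c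
  have y: "y c \<in> W" "s (y c) = e *\<^sub>R sdual d (G (x c)) (G (\<tau> (x c)))"
    "f (s (y c)) = e *\<^sub>R sdual (- d) (G (x c)) (G (\<tau> (x c)))" "x c \<in> W" "s (x c) = c" if "c \<in> N" for c
  proof -
    have c: "c \<in> V" "fib c \<subseteq> X" "proj x0 c \<noteq> 0" "\<epsilon> (x c) = e"
      using S(3) that by (auto simp: N_def P_def e_def)
    have xc: "x c \<in> fib c" using sgn_proj_fib c by (simp add: x_def)
    then have s: "y c \<in> W" "\<tau> (y c) = e *\<^sub>R G (\<tau> (x c))" using sign[OF c(1,2) xc] c(4) by (auto simp: y_def)
    interpret sd: bounded_bilinear "sdual k" for k by (rule bounded_bilinear_sdual)
    show "y c \<in> W" by (rule s(1))
    show "s (y c) = e *\<^sub>R sdual d (G (x c)) (G (\<tau> (x c)))" unfolding s_def s(2) by (simp add: y_def sd.scaleR_right)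
    show "f (s (y c)) = e *\<^sub>R sdual (- d) (G (x c)) (G (\<tau> (x c)))"
      unfolding s_V(2)[OF s(1), symmetric] s(2) by (simp add: y_def sd.scaleR_right)
    show "x c \<in> W" "s (x c) = c" using fib_sub_W[OF c(1) xc] s_fib[OF c(1) xc] by auto
  qed
  have ya: "s (y a) = b"
  proof -
    have "y a = g x0" using G(2)[OF x0X] xa by (simp add: y_def)
    then have "y a \<in> fib b" using XY(7) x0a by blast
    then show ?thesis by (rule s_fib[OF b])
  qed
  define k where "k = det (matrix G)"
  have k: "k = 1 \<or> k = -1"
    unfolding k_def using det_orthogonal_matrix G(1) orthogonal_transformation_matrix by blast
  obtain A where A: "orthogonal_transformation A" "\<And>u v. sdual d (G u) (G v) = A (sdual (k * d) u v)"
    using sdual_orthogonal_image[OF G(1) d] unfolding k_def by blast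
  obtain B where B: "orthogonal_transformation B" "\<And>u v. sdual (- d) (G u) (G v) = B (sdual (k * - d) u v)"
    using sdual_orthogonal_image[OF G(1) d'] unfolding k_def by blast
  have iso: "orthogonal_transformation (\<lambda>v. e *\<^sub>R C v)" if "orthogonal_transformation C" for C :: "real ^ 3 \<Rightarrow> real ^ 3"
    using that e unfolding orthogonal_transformation by (auto intro: linear_compose_scale_right)
  \<comment> \<open>For determinant -1 the points \<open>c\<close> and \<open>f c\<close> change
    roles under the symmetry, so the strict decrease at the images of \<open>a\<close> and
    \<open>c\<close> reads \<open>f a \<bullet> f c < a \<bullet> c\<close>, the reverse of its
    instance at \<open>a\<close> and \<open>c\<close>. A second point \<open>c\<close> of
    \<open>N\<close> exists because the sphere has no isolated points.\<close>
  have "k = 1"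
  proof (rule ccontr)
    assume "k \<noteq> 1"
    then have k: "k = -1" using k by simp
    have syf: "s (y c) = e *\<^sub>R A (f c)" "f (s (y c)) = e *\<^sub>R B c" if "c \<in> N" for c
      using y[OF that] s_V(2)[OF y(4)[OF that]] by (simp_all add: A B k) (simp add: s_def[symmetric])
    have A': "(e *\<^sub>R A p) \<bullet> (e *\<^sub>R A q) = p \<bullet> q" and B': "(e *\<^sub>R B p) \<bullet> (e *\<^sub>R B q) = p \<bullet> q" for p q
      using iso[OF A(1)] iso[OF B(1)] unfolding orthogonal_transformation_def by auto
    have "openin (top_of_set S2) N" using openin_trans[OF N(1) open_V] .
    then obtain T where T: "open T" "N = S2 \<inter> T" by (auto simp: openin_open)
    have "connected S2" by (rule connected_sphere) simp
    moreover have "S2 \<noteq> {p}" for p :: "real ^ 3"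
    proof -
      obtain q :: "real ^ 3" where "norm q = 1" using vector_choose_size[of 1] by auto
      then have "q \<in> S2" "- q \<in> S2" "q \<bullet> q = 1" by (auto simp: norm_eq_1)
      moreover from this have "q \<bullet> q \<noteq> (- q) \<bullet> q" by simp
      ultimately show ?thesis by (metis singletonD)
    qed
    moreover have "a \<in> S2" using a V_S2 by blast
    ultimately have "a islimpt S2" using connected_imp_perfect by blast
    then obtain c where c: "c \<in> S2" "c \<in> T" "c \<noteq> a" using T N(2) unfolding islimpt_def by blast
    then have cN: "c \<in> N" using T by blast
    have "s (y a) \<noteq> s (y c)"
    proof
      assume "s (y a) = s (y c)"
      then have "e *\<^sub>R B a = e *\<^sub>R B c" using syf(2)[OF N(2)] syf(2)[OF cN] by metis
      then have "(e *\<^sub>R B a) \<bullet> (e *\<^sub>R B a) = (e *\<^sub>R B a) \<bullet> (e *\<^sub>R B c)" by metis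
      then have "a \<bullet> a = a \<bullet> c" unfolding B' .
      moreover have "c \<bullet> c = a \<bullet> a" using c(1) \<open>a \<in> S2\<close> by (simp add: norm_eq_1)
      ultimately have "(a - c) \<bullet> (a - c) = 0" by (simp add: inner_simps inner_commute)
      then show False using c(3) by simp
    qed
    then have "s (y a) \<bullet> s (y c) < f (s (y a)) \<bullet> f (s (y c))"
      using distance_decreasing_inner[OF decreasing f_V V_S2] s_V(1) y(1) N(2) cN by blast
    then have "f a \<bullet> f c < a \<bullet> c" unfolding syf(2)[OF N(2)] syf(2)[OF cN] unfolding syf(1)[OF N(2)] syf(1)[OF cN] A' B' .
    moreover have "a \<bullet> c < f a \<bullet> f c"
      using distance_decreasing_inner[OF decreasing f_V V_S2] a cN N(3) c(3) by blast
    ultimately show False by simp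
  qed
  then have sy: "s (y c) = e *\<^sub>R A c" "f (s (y c)) = e *\<^sub>R B (f c)" if "c \<in> N" for c
    using y[OF that] s_V(2)[OF y(4)[OF that]] by (simp_all add: A B) (simp add: s_def[symmetric])
  show ?thesis
  proof (intro exI conjI)
    show "orthogonal_transformation (\<lambda>v. e *\<^sub>R A v)" "orthogonal_transformation (\<lambda>v. e *\<^sub>R B v)"
      by (rule iso, fact)+
    show "openin (top_of_set V) N" "a \<in> N" by fact+
    show "e *\<^sub>R A a = b" using sy(1)[OF N(2)] ya by simp
    show "(\<lambda>v. e *\<^sub>R A v) ` N \<subseteq> V" using sy(1) s_V(1) y(1) by force
    show "\<forall>c\<in>N. f (e *\<^sub>R A c) = e *\<^sub>R B (f c)" using sy by metis
  qed
qed

end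

section \<open>Hopf fibrations from complex structures\<close>

definition mult_i :: "real ^ 4 \<Rightarrow> real ^ 4" where
  "mult_i z = vector [- z$2, z$1, - z$4, z$3]"

lemma to_C2_scale:
  "to_C2 (\<alpha> *\<^sub>R z + \<beta> *\<^sub>R mult_i z) = (Complex \<alpha> \<beta> * fst (to_C2 z), Complex \<alpha> \<beta> * snd (to_C2 z))"
  by (simp add: to_C2_def mult_i_def complex_eq_iff algebra_simps)

lemma inj_to_C2: "to_C2 x = to_C2 y \<longleftrightarrow> x = y"
  by (auto simp: to_C2_def vec_eq_iff forall_4)

text \<open>For a unit vector \<open>e\<close> and a unit vector \<open>h\<close> orthogonal to
  \<open>e\<close> and \<open>I e\<close>, skewness of \<open>I\<close> makes \<open>e\<close>,
  \<open>I e\<close>, \<open>h\<close>, \<open>I h\<close> an orthonormal basis. The map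
  \<open>g\<close> with these columns carries \<open>mult_i\<close> to \<open>I\<close>, hence
  complex lines to \<open>I\<close>-invariant planes.\<close>

lemma Hopf_fibration_of_complex_structure:
  fixes I :: "real ^ 4 \<Rightarrow> real ^ 4"
  assumes I: "linear I" "\<And>x. I (I x) = - x" "\<And>x y. I x \<bullet> I y = x \<bullet> y"
  obtains H where "Hopf_fibration H"
    "\<And>x. norm x = 1 \<Longrightarrow> {y \<in> S3. \<exists>\<alpha> \<beta>. y = \<alpha> *\<^sub>R x + \<beta> *\<^sub>R I x} \<in> H"
proof -
  interpret I: linear I by fact
  have skew: "I x \<bullet> y = - (x \<bullet> I y)" for x y
    using I(3)[of x "I y"] by (simp add: I(2))
  then have Ixx: "I x \<bullet> x = 0" "x \<bullet> I x = 0" for x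
    using skew[of x x] inner_commute[of x "I x"] by linarith+
  obtain e :: "real ^ 4" where e: "norm e = 1" using vector_choose_size[of 1] by auto
  have "dim {e, I e} \<le> card {e, I e}" by (rule dim_le_card') simp
  also have "\<dots> \<le> 2" by (simp add: card_insert_if)
  finally have "dim {e, I e} < DIM(real ^ 4)" by simp
  then obtain h' where h': "h' \<noteq> 0" "\<And>y. y \<in> span {e, I e} \<Longrightarrow> orthogonal h' y"
    using orthogonal_to_subspace_exists by blast
  define h where "h = sgn h'"
  have h: "h \<bullet> h = 1" "h \<bullet> e = 0" "h \<bullet> I e = 0"
    using h'(1) h'(2)[of e] h'(2)[of "I e"] norm_sgn[of h']
    by (auto simp: h_def span_base orthogonal_def norm_eq_1[symmetric]) (auto simp: sgn_div_norm)
  have ee: "e \<bullet> e = 1" using e by (simp add: norm_eq_1)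
  define g where "g y = y$1 *\<^sub>R e + y$2 *\<^sub>R I e + y$3 *\<^sub>R h + y$4 *\<^sub>R I h" for y :: "real ^ 4"
  have g_lin: "linear g" by (rule linearI) (simp_all add: g_def algebra_simps)
  have hI: "I h \<bullet> e = 0" "I h \<bullet> I e = 0" "I h \<bullet> I h = 1" "I e \<bullet> I e = 1"
    using h ee by (simp_all add: I(3) skew[of h e])
  have gg: "g x \<bullet> g y = x \<bullet> y" for x y
  proof -
    have "g x \<bullet> g y = x$1 * y$1 + x$2 * y$2 + x$3 * y$3 + x$4 * y$4"
      unfolding g_def using h hI ee Ixx
      by (simp add: inner_add_left inner_add_right inner_commute[of e h] inner_commute[of "I e" h]
          inner_commute[of e "I h"] inner_commute[of "I e" "I h"])
    then show ?thesis by (simp add: inner_vec_def sum_4)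
  qed
  have g_orth: "orthogonal_transformation g" using g_lin gg by (simp add: orthogonal_transformation_def)
  interpret g: linear g by (rule g_lin)
  have ng: "norm (g x) = norm x" for x by (simp add: norm_eq_sqrt_inner gg)
  have gI: "g (mult_i z) = I (g z)" for z
    by (simp add: g_def mult_i_def I.add I.scale I(2))
  define H where "H = (\<lambda>C. g ` C) ` standard_Hopf_fibration"
  have surj: "\<exists>z. x = g z" for x using orthogonal_transformation_surj[OF g_orth] by (metis surjD)
  have "g ` S3 = S3"
  proof
    show "S3 \<subseteq> g ` S3"
    proof
      fix x :: "real ^ 4" assume "x \<in> S3"
      then show "x \<in> g ` S3" using surj[of x] ng by force
    qed
  qed (auto simp: ng)
  then have "isometry_onto g S3 S3" by (simp add: isometry_onto_def sphere_dist_def gg)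
  then have "Hopf_fibration H" unfolding Hopf_fibration_def H_def by blast
  moreover have "{y \<in> S3. \<exists>\<alpha> \<beta>. y = \<alpha> *\<^sub>R x + \<beta> *\<^sub>R I x} \<in> H" if x: "norm x = 1" for x
  proof -
    obtain z where z: "x = g z" using surj by blast
    define L where "L = {(c * fst (to_C2 z), c * snd (to_C2 z)) | c. True}"
    have "z \<noteq> 0" using x z by (auto simp: g.zero)
    then have "(fst (to_C2 z), snd (to_C2 z)) \<noteq> (0, 0)"
      by (auto simp: to_C2_def vec_eq_iff forall_4 complex_eq_iff)
    then have "L \<in> complex_lines" unfolding L_def complex_lines_def by blast
    then have std: "{y \<in> S3. to_C2 y \<in> L} \<in> standard_Hopf_fibration" unfolding standard_Hopf_fibration_def by blast
    have img: "{y \<in> S3. \<exists>\<alpha> \<beta>. y = \<alpha> *\<^sub>R x + \<beta> *\<^sub>R I x} = g ` {y \<in> S3. to_C2 y \<in> L}"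
    proof -
      have L: "to_C2 y \<in> L \<longleftrightarrow> (\<exists>\<alpha> \<beta>. y = \<alpha> *\<^sub>R z + \<beta> *\<^sub>R mult_i z)" for y
      proof
        assume "to_C2 y \<in> L"
        then obtain c where "to_C2 y = (c * fst (to_C2 z), c * snd (to_C2 z))" by (auto simp: L_def)
        then have "to_C2 y = to_C2 (Re c *\<^sub>R z + Im c *\<^sub>R mult_i z)" by (simp add: to_C2_scale)
        then show "\<exists>\<alpha> \<beta>. y = \<alpha> *\<^sub>R z + \<beta> *\<^sub>R mult_i z" unfolding inj_to_C2 by blast
      next
        assume "\<exists>\<alpha> \<beta>. y = \<alpha> *\<^sub>R z + \<beta> *\<^sub>R mult_i z"
        then show "to_C2 y \<in> L" using to_C2_scale unfolding L_def by blast
      qed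
      have eq: "g (\<alpha> *\<^sub>R z + \<beta> *\<^sub>R mult_i z) = \<alpha> *\<^sub>R x + \<beta> *\<^sub>R I x" for \<alpha> \<beta>
        by (simp add: g.add g.scale gI z)
      show ?thesis
      proof (intro subset_antisym subsetI)
        fix y assume "y \<in> {y \<in> S3. \<exists>\<alpha> \<beta>. y = \<alpha> *\<^sub>R x + \<beta> *\<^sub>R I x}"
        then obtain \<alpha> \<beta> where y: "norm y = 1" "y = g (\<alpha> *\<^sub>R z + \<beta> *\<^sub>R mult_i z)" by (auto simp: eq)
        then show "y \<in> g ` {y \<in> S3. to_C2 y \<in> L}"
          using y ng[of "\<alpha> *\<^sub>R z + \<beta> *\<^sub>R mult_i z"]
          by (intro image_eqI[where f = g, OF y(2)]) (auto simp: L)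
      next
        fix y assume "y \<in> g ` {y \<in> S3. to_C2 y \<in> L}"
        then show "y \<in> {y \<in> S3. \<exists>\<alpha> \<beta>. y = \<alpha> *\<^sub>R x + \<beta> *\<^sub>R I x}"
          by (auto simp: L ng) (use eq in blast)
      qed
    qed
    show ?thesis unfolding H_def img using std by (rule imageI)
  qed
  ultimately show thesis using that by blast
qed

lemma J_skew: "J d a u \<bullet> v = - (u \<bullet> J d a v)"
  by (simp add: coordinate_simps algebra_simps)

text \<open>With \<open>f\<close> constant, the complex structure \<open>J (- d) c\<close> is the
  same for all fibers, and each fiber plane is spanned by one of its points and the image of that
  point.\<close>

lemma (in oriented_fibration) Hopf_of_constant:
  assumes c: "c \<bullet> c = 1" and f: "\<And>a. a \<in> V \<Longrightarrow> f a = c"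
  shows "\<exists>H. Hopf_fibration H \<and> F \<subseteq> H"
proof -
  define I where "I = J (- d) c"
  obtain H where H: "Hopf_fibration H"
    "\<And>x. norm x = 1 \<Longrightarrow> {y \<in> S3. \<exists>\<alpha> \<beta>. y = \<alpha> *\<^sub>R x + \<beta> *\<^sub>R I x} \<in> H"
  proof (rule Hopf_fibration_of_complex_structure[of I])
    show "linear I" unfolding I_def by (rule linear_J)
    show "I (I x) = - x" "I x \<bullet> I y = x \<bullet> y" for x y
      by (simp_all add: I_def J_J[OF d'] c J_skew[of _ _ x])
  qed blast
  have "C \<in> H" if C: "C \<in> F" for C
  proof -
    obtain a where a: "a \<in> V" "C = fib a" using C F_eq by blast
    obtain x where x: "x \<in> fib a" using fibration_fibers(2)[OF fibration C] a by blast
    then have eqx: "eq_J a x" "norm x = 1" by (auto simp: fib_def)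
    have Jx: "J d a x = I x" using eqx f[OF a(1)] by (simp add: eq_J_def I_def)
    have "fib a = {y \<in> S3. \<exists>\<alpha> \<beta>. y = \<alpha> *\<^sub>R x + \<beta> *\<^sub>R I x}"
    proof (intro subset_antisym subsetI)
      fix y assume "y \<in> fib a"
      then show "y \<in> {y \<in> S3. \<exists>\<alpha> \<beta>. y = \<alpha> *\<^sub>R x + \<beta> *\<^sub>R I x}"
        using eq_J_expansion[OF a(1) eqx, of y] unfolding Jx fib_def by blast
    next
      fix y assume "y \<in> {y \<in> S3. \<exists>\<alpha> \<beta>. y = \<alpha> *\<^sub>R x + \<beta> *\<^sub>R I x}"
      then obtain \<alpha> \<beta> where y: "y \<in> S3" "y = \<alpha> *\<^sub>R x + \<beta> *\<^sub>R J d a x" unfolding Jx by blast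
      have "eq_J a y" unfolding y(2) by (intro eq_J_add eq_J_scale eq_J_J a eqx)
      then show "y \<in> fib a" using y(1) by (simp add: fib_def)
    qed
    then show ?thesis using H(2)[OF eqx(2)] a by simp
  qed
  then show ?thesis using H(1) by blast
qed

lemma (in oriented_fibration) Hopf_of_homogeneous:
  assumes "connected W" "locally_fiberwise_homogeneous W F" "C2_on V f"
  shows "\<exists>H. Hopf_fibration H \<and> F \<subseteq> H"
proof -
  have const: "f a = f b" if "a \<in> V" "b \<in> V" for a b
    using homogeneous_decreasing_C2_constant[OF open_V connected_V[OF assms(1)] f_V assms(3) decreasing
        local_symmetry[OF assms(2)] that] .
  have "\<exists>c. c \<bullet> c = 1 \<and> (\<forall>a\<in>V. f a = c)"
  proof (cases "V = {}")
    \<comment> \<open>Then \<open>F\<close> is empty as well, so any unit vector will do.\<close>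
    case True
    obtain c :: "real ^ 3" where "norm c = 1" using vector_choose_size[of 1] by auto
    then show ?thesis using True by (auto simp: norm_eq_1)
  next
    case False
    then obtain a where "a \<in> V" by blast
    then show ?thesis using V_unit(2) const by blast
  qed
  then show ?thesis using Hopf_of_constant by blast
qed

theorem theorem4p1:
  fixes W :: "(real ^ 4) set" and F :: "(real ^ 4) set set"
    and V :: "(real ^ 3) set" and f :: "real ^ 3 \<Rightarrow> real ^ 3"
  assumes "connected W"
    and "great_circle_fibration W F"
    and "locally_fiberwise_homogeneous W F"
    and "associated_function W F V f"
    and "C2_on V f"
  shows "\<exists>H. Hopf_fibration H \<and> F \<subseteq> H"
proof -
  obtain \<tau> where V: "openin (top_of_set S2) V" "f ` V \<subseteq> S2" "distance_decreasing_on V f"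
    and \<tau>: "consistent_orientation W F \<tau>"
    and graph: "oriented_fibers W \<tau> = {(a, f a) | a. a \<in> V} \<or> oriented_fibers W \<tau> = {(f a, a) | a. a \<in> V}"
    using assms(4) unfolding associated_function_def by blast
  have "\<exists>d::real. (d = 1 \<or> d = -1) \<and>
    {(sdual d x (\<tau> x), sdual (- d) x (\<tau> x)) | x. x \<in> W} = {(a, f a) | a. a \<in> V}"
    using graph
  proof
    assume "oriented_fibers W \<tau> = {(a, f a) | a. a \<in> V}"
    then show ?thesis
      by (intro exI[of _ 1]) (simp add: oriented_fibers_def self_dual_eq anti_self_dual_eq)
  next
    assume g: "oriented_fibers W \<tau> = {(f a, a) | a. a \<in> V}"
    \<comment> \<open>Exchanging the coordinates brings \<open>V\<close> to the first place; the
      first component is then the anti-self-dual one, so \<open>d = -1\<close>.\<close>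
    have "prod.swap ` oriented_fibers W \<tau> = prod.swap ` {(f a, a) | a. a \<in> V}" unfolding g ..
    moreover have "prod.swap ` oriented_fibers W \<tau> = {(sdual (-1) x (\<tau> x), sdual (- (-1)) x (\<tau> x)) | x. x \<in> W}"
      by (force simp: oriented_fibers_def self_dual_eq anti_self_dual_eq image_iff)
    moreover have "prod.swap ` {(f a, a) | a. a \<in> V} = {(a, f a) | a. a \<in> V}" by (force simp: image_iff)
    ultimately show ?thesis by (intro exI[of _ "-1"]) simp
  qed
  then obtain d :: real where d: "d = 1 \<or> d = -1"
    "{(sdual d x (\<tau> x), sdual (- d) x (\<tau> x)) | x. x \<in> W} = {(a, f a) | a. a \<in> V}" by blast
  interpret oriented_fibration W F V f \<tau> d
    by unfold_locales (fact assms(2) \<tau> d V)+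
  show ?thesis by (rule Hopf_of_homogeneous) fact+
qed

end
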